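(* Assume the setting of the context and suppose: (H1) $\theta$ is invertible (with measurable inverse), ergodic and $\mathbb P$-preserving; (H2) there is $\delta>0$ with $\sum_{n\ge1}\alpha_{\mathbb P}(n)^{\delta/(2+\delta)}<\infty$; (H3) there exist a dynamically stationary state $\mathfrak s:\Omega\to\mathcal S_d$ and a deterministic sequence $(r_n)_{n\ge1}\subseteq[0,\infty)$ with $\sum_{n\ge1} r_n^{\delta/(2+\delta)}<\infty$ (same $\delta$ as in (H2)) such that for every random initial state $\vartheta$ and every $n\in\mathbb N$, $\mathbb E_{\mathbb P}\big[\|\Phi^{(n)}_\omega(\vartheta(\omega))-\mathfrak s(\theta^n\omega)\|_1\big]\le r_n$. Fix $m\in\mathbb N$, $\mathbf b\in\mathcal A^m$ and set $\mu_{\mathbf b}:=\mathbb E_{\overline{\mathbb Q}_{\mathfrak s}}[\delta N_1^{\mathbf b}]=\int_\Omega\mathbb Q_{\mathfrak s(\omega);\omega}(C_{\mathbf b})\,d\mathbb P(\omega)$. Then the series $$\Sigma_{\mathbf b}^2:=\mathbb E_{\overline{\mathbb Q}_{\mathfrak s}}\big[(\delta N_1^{\mathbf b}-\mu_{\mathbf b})^2\big]+2\sum_{k=1}^\infty\mathbb E_{\overline{\mathbb Q}_{\mathfrak s}}\big[(\delta N_1^{\mathbf b}-\mu_{\mathbf b})(\delta N_{1+k}^{\mathbf b}-\mu_{\mathbf b})\big]$$ converges absolutely and defines $\Sigma_{\mathbf b}^2\in[0,\infty)$, and under $\overline{\mathbb Q}_{\mathfrak s}$, $$\frac1{\sqrt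 n}\sum_{k=1}^n(\delta N_k^{\mathbf b}-\mu_{\mathbf b})\xrightarrow{\ d\ }\mathcal N(0,\Sigma_{\mathbf b}^2),\qquad n\to\infty.$$ If $\Sigma_{\mathbf b}^2=0$, the normalized sums converge to $0$ in $L^2(\overline{\mathbb Q}_{\mathfrak s})$, hence in probability.
   Context: Let $d\in\mathbb N$, $M_d$ the $d\times d$ complex matrices with trace norm $\|X\|_1=\operatorname{tr}|X|$, $\mathcal S_d$ the density matrices. Let $\mathcal A$ be finite, $(\mathcal A^{\mathbb N},\Sigma)$ the sequence space with product $\sigma$-algebra and coordinates $A_n(\bar a)=a_n$. $(\Omega,\mathcal F,\mathbb P)$ is a probability space, $\theta:\Omega\to\Omega$ measurable. A random instrument is a family of completely positive trace-non-increasing linear maps $\mathcal T_{a;\omega}:M_d\to M_d$ ($a\in\mathcal A$), measurable in $\omega$, with $\sum_a\mathcal T_{a;\omega}$ trace preserving $\mathbb P$-a.s.; write $\mathcal V_\omega=(\mathcal T_{a;\omega})_a$, $\Phi_{k;\omega}=\sum_a\mathcal T_{a;\theta^k\omega}$, $\Phi^{(n)}_\omega=\Phi_{n;\omega}\circ\cdots\circ\Phi_{1;\omega}$. Quenched law: $\mathbb Q_{\rho;\omega}$ is the probability on $\Sigma$ with $\mathbb Q_{\rho;\omega}(A_1=a_1,\dots,A_n=a_n)=\operatorname{tr}[(\mathcal T_{a_n;\theta^n\omega}\circ\cdots\circ\mathcal T_{a_1;\theta\omega})(\rho)]$. A random initial state is a measurable $\vartheta:\Omega\to\mathcal S_d$;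 its annealed law is the probability $\overline{\mathbb Q}_\vartheta(d\omega,d\bar a)=\mathbb P(d\omega)\mathbb Q_{\vartheta(\omega);\omega}(d\bar a)$ on $(\Omega\times\mathcal A^{\mathbb N},\mathcal F\otimes\Sigma)$. A random state $\mathfrak s$ is dynamically stationary if $\Phi^{(n)}_\omega(\mathfrak s(\omega))=\mathfrak s(\theta^n\omega)$ for all $n\in\mathbb N$, $\mathbb P$-a.s. For $\mathbf b=(b_1,\dots,b_m)$, $C_{\mathbf b}=\{\bar a: a_1=b_1,\dots,a_m=b_m\}$ and $\delta N_k^{\mathbf b}(\omega,\bar a)=\mathbf 1\{a_k=b_1,\dots,a_{k+m-1}=b_m\}$. Mixing: $\mathcal F_k=\sigma(\omega\mapsto\mathcal V_{\theta^j\omega}:j\le k)$, $\mathcal F^k=\sigma(\omega\mapsto\mathcal V_{\theta^j\omega}:j\ge k)$, $\alpha_{\mathbb P}(\mathcal B,\mathcal C)=\sup\{|\mathbb P(B\cap C)-\mathbb P(B)\mathbb P(C)|:B\in\mathcal B,C\in\mathcal C\}$, $\alpha_{\mathbb P}(n)=\sup_{k\in\mathbb N}\alpha_{\mathbb P}(\mathcal F_k,\mathcal F^{k+n})$. *)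

theory Defs
  imports "HOL-Analysis.Analysis" "HOL-Probability.Probability"
begin

type_synonym 'd cmat = "complex^'d^'d"

definition cnonneg :: "complex \<Rightarrow> bool" where
  "cnonneg z \<longleftrightarrow> Im z = 0 \<and> 0 \<le> Re z"

definition adj :: "'d::finite cmat \<Rightarrow> 'd cmat" where
  "adj X = (\<chi> i j. cnj (X $ j $ i))"

definition cscale :: "complex \<Rightarrow> 'd::finite cmat \<Rightarrow> 'd cmat" where
  "cscale c X = (\<chi> i j. c * X $ i $ j)"

definition psd :: "'d::finite cmat \<Rightarrow> bool" where
  "psd A \<longleftrightarrow> (\<forall>x::complex^'d. cnonneg (\<Sum>i\<in>UNIV. \<Sum>j\<in>UNIV. cnj (x $ i) * A $ i $ j * x $ j))"

definition mabs :: "'d::finite cmat \<Rightarrow> 'd cmat" where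
  "mabs X = (THE P. psd P \<and> P ** P = adj X ** X)"

definition trnorm :: "'d::finite cmat \<Rightarrow> real" where
  "trnorm X = Re (trace (mabs X))"

definition density_matrix :: "'d::finite cmat \<Rightarrow> bool" where
  "density_matrix \<rho> \<longleftrightarrow> psd \<rho> \<and> trace \<rho> = 1"

definition clinear_map :: "('d::finite cmat \<Rightarrow> 'd cmat) \<Rightarrow> bool" where
  "clinear_map T \<longleftrightarrow> (\<forall>X Y. T (X + Y) = T X + T Y) \<and> (\<forall>c X. T (cscale c X) = cscale c (T X))"

(* positivity of an n x n block matrix with blocks in M_d (an element of M_n(M_d) = M_n \<otimes> M_d) *)
definition block_psd :: "nat \<Rightarrow> (nat \<Rightarrow> nat \<Rightarrow> 'd::finite cmat) \<Rightarrow> bool" where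
  "block_psd n X \<longleftrightarrow> (\<forall>v :: nat \<Rightarrow> complex^'d.
      cnonneg (\<Sum>i<n. \<Sum>j<n. \<Sum>p\<in>UNIV. \<Sum>q\<in>UNIV. cnj (v i $ p) * X i j $ p $ q * v j $ q))"

definition completely_positive :: "('d::finite cmat \<Rightarrow> 'd cmat) \<Rightarrow> bool" where
  "completely_positive T \<longleftrightarrow> clinear_map T \<and>
     (\<forall>n X. block_psd n X \<longrightarrow> block_psd n (\<lambda>i j. T (X i j)))"

definition trace_nonincreasing :: "('d::finite cmat \<Rightarrow> 'd cmat) \<Rightarrow> bool" where
  "trace_nonincreasing T \<longleftrightarrow> (\<forall>\<rho>. psd \<rho> \<longrightarrow> Re (trace (T \<rho>)) \<le> Re (trace \<rho>))"

definition trace_preserving :: "('d::finite cmat \<Rightarrow> 'd cmat) \<Rightarrow> bool" where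
  "trace_preserving T \<longleftrightarrow> (\<forall>X. trace (T X) = trace X)"

definition random_instrument ::
  "'s measure \<Rightarrow> ('a::finite \<Rightarrow> 's \<Rightarrow> 'd::finite cmat \<Rightarrow> 'd cmat) \<Rightarrow> bool" where
  "random_instrument P T \<longleftrightarrow>
     (\<forall>a. \<forall>\<omega>\<in>space P. completely_positive (T a \<omega>) \<and> trace_nonincreasing (T a \<omega>)) \<and>
     (\<forall>a X. (\<lambda>\<omega>. T a \<omega> X) \<in> borel_measurable P) \<and>
     (AE \<omega> in P. trace_preserving (\<lambda>X. \<Sum>a\<in>UNIV. T a \<omega> X))"

definition Phi :: "('a::finite \<Rightarrow> 's \<Rightarrow> 'd::finite cmat \<Rightarrow> 'd cmat) \<Rightarrow> ('s \<Rightarrow> 's) \<Rightarrow> nat \<Rightarrow> 's \<Rightarrow> 'd cmat \<Rightarrow> 'd cmat" where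
  "Phi T \<theta> k \<omega> X = (\<Sum>a\<in>UNIV. T a ((\<theta> ^^ k) \<omega>) X)"

fun Phin :: "('a::finite \<Rightarrow> 's \<Rightarrow> 'd::finite cmat \<Rightarrow> 'd cmat) \<Rightarrow> ('s \<Rightarrow> 's) \<Rightarrow> nat \<Rightarrow> 's \<Rightarrow> 'd cmat \<Rightarrow> 'd cmat" where
  "Phin T \<theta> 0 \<omega> = id"
| "Phin T \<theta> (Suc n) \<omega> = Phi T \<theta> (Suc n) \<omega> \<circ> Phin T \<theta> n \<omega>"

(* Outcome sequences are functions nat \<Rightarrow> 'a, with x i = a_{i+1} (0-based storage). *)
definition seq_space :: "(nat \<Rightarrow> 'a) measure" where
  "seq_space = PiM UNIV (\<lambda>_. count_space UNIV)"

fun Tword :: "('a::finite \<Rightarrow> 's \<Rightarrow> 'd::finite cmat \<Rightarrow> 'd cmat) \<Rightarrow> ('s \<Rightarrow> 's) \<Rightarrow> (nat \<Rightarrow> 'a) \<Rightarrow> nat \<Rightarrow> 's \<Rightarrow> 'd cmat \<Rightarrow> 'd cmat" where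
  "Tword T \<theta> x 0 \<omega> = id"
| "Tword T \<theta> x (Suc n) \<omega> = T (x n) ((\<theta> ^^ Suc n) \<omega>) \<circ> Tword T \<theta> x n \<omega>"

definition quenched ::
  "('a::finite \<Rightarrow> 's \<Rightarrow> 'd::finite cmat \<Rightarrow> 'd cmat) \<Rightarrow> ('s \<Rightarrow> 's) \<Rightarrow> 'd cmat \<Rightarrow> 's \<Rightarrow> (nat \<Rightarrow> 'a) measure" where
  "quenched T \<theta> \<rho> \<omega> = (THE Q. sets Q = sets seq_space \<and> prob_space Q \<and>
      (\<forall>n x. complex_of_real (measure Q {y \<in> space seq_space. \<forall>i<n. y i = x i})
              = trace (Tword T \<theta> x n \<omega> \<rho>)))"

definition annealed ::
  "'s measure \<Rightarrow> ('a::finite \<Rightarrow> 's \<Rightarrow> 'd::finite cmat \<Rightarrow> 'd cmat) \<Rightarrow> ('s \<Rightarrow> 's) \<Rightarrow> ('s \<Rightarrow> 'd cmat)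
     \<Rightarrow> ('s \<times> (nat \<Rightarrow> 'a)) measure" where
  "annealed P T \<theta> \<psi> = measure_of (space P \<times> space seq_space) (sets (P \<Otimes>\<^sub>M seq_space))
      (\<lambda>A. \<integral>\<^sup>+ \<omega>. emeasure (quenched T \<theta> (\<psi> \<omega>) \<omega>) (Pair \<omega> -` A) \<partial>P)"

definition random_state :: "'s measure \<Rightarrow> ('s \<Rightarrow> 'd::finite cmat) \<Rightarrow> bool" where
  "random_state P \<psi> \<longleftrightarrow> \<psi> \<in> borel_measurable P \<and> (\<forall>\<omega>\<in>space P. density_matrix (\<psi> \<omega>))"

definition dyn_stationary ::
  "'s measure \<Rightarrow> ('a::finite \<Rightarrow> 's \<Rightarrow> 'd::finite cmat \<Rightarrow> 'd cmat) \<Rightarrow> ('s \<Rightarrow> 's) \<Rightarrow> ('s \<Rightarrow> 'd cmat) \<Rightarrow> bool" where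
  "dyn_stationary P T \<theta> s \<longleftrightarrow> (AE \<omega> in P. \<forall>n. Phin T \<theta> n \<omega> (s \<omega>) = s ((\<theta> ^^ n) \<omega>))"

(* \<delta>N_k^b (\<omega>, x) = 1{a_k = b_1, ..., a_{k+m-1} = b_m}, with a_j = x (j-1) *)
definition dN :: "'a list \<Rightarrow> nat \<Rightarrow> 's \<times> (nat \<Rightarrow> 'a) \<Rightarrow> real" where
  "dN b k z = (if \<forall>i<length b. snd z (k - 1 + i) = b ! i then 1 else 0)"

definition measure_preserving_map :: "'s measure \<Rightarrow> ('s \<Rightarrow> 's) \<Rightarrow> bool" where
  "measure_preserving_map P \<theta> \<longleftrightarrow> \<theta> \<in> measurable P P \<and> distr P P \<theta> = P"

definition ergodic_map :: "'s measure \<Rightarrow> ('s \<Rightarrow> 's) \<Rightarrow> bool" where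
  "ergodic_map P \<theta> \<longleftrightarrow> (\<forall>A\<in>sets P. \<theta> -` A \<inter> space P = A \<longrightarrow> measure P A = 0 \<or> measure P A = 1)"

definition zpow :: "('s \<Rightarrow> 's) \<Rightarrow> ('s \<Rightarrow> 's) \<Rightarrow> int \<Rightarrow> 's \<Rightarrow> 's" where
  "zpow \<theta> \<theta>i j = (if 0 \<le> j then \<theta> ^^ nat j else \<theta>i ^^ nat (- j))"

definition gen_sigma :: "'s measure \<Rightarrow> ('a::finite \<Rightarrow> 's \<Rightarrow> 'd::finite cmat \<Rightarrow> 'd cmat) \<Rightarrow> ('s \<Rightarrow> 's) \<Rightarrow> ('s \<Rightarrow> 's) \<Rightarrow> int set \<Rightarrow> 's set set" where
  "gen_sigma P T \<theta> \<theta>i J = sigma_sets (space P)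
     {(\<lambda>\<omega>. T a (zpow \<theta> \<theta>i j \<omega>) X) -` B \<inter> space P | a X j B. j \<in> J \<and> B \<in> sets borel}"

definition alpha_sets :: "'s measure \<Rightarrow> 's set set \<Rightarrow> 's set set \<Rightarrow> real" where
  "alpha_sets P \<B> \<C> = (SUP BC\<in>\<B> \<times> \<C>. \<bar>measure P (fst BC \<inter> snd BC) - measure P (fst BC) * measure P (snd BC)\<bar>)"

definition alpha_mix :: "'s measure \<Rightarrow> ('a::finite \<Rightarrow> 's \<Rightarrow> 'd::finite cmat \<Rightarrow> 'd cmat) \<Rightarrow> ('s \<Rightarrow> 's) \<Rightarrow> ('s \<Rightarrow> 's) \<Rightarrow> nat \<Rightarrow> real" where
  "alpha_mix P T \<theta> \<theta>i n = (SUP k\<in>(UNIV::nat set).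
      alpha_sets P (gen_sigma P T \<theta> \<theta>i {j. j \<le> int k}) (gen_sigma P T \<theta> \<theta>i {j. int k + int n \<le> j}))"

definition gauss_law :: "real \<Rightarrow> real measure" where
  "gauss_law v = (if v = 0 then return borel 0 else density lborel (normal_density 0 (sqrt v)))"

end

(* Two ingredients.

   Decorrelation of the outcomes.  Let sigma be the unnormalised state after p letters, weighted by a
   function with values in [0,1] of these letters.  Then sigma + (1 - tr sigma) s(theta^p omega) is a
   random initial state at time p, so (H3) and stationarity give Phi^(n)(sigma) = tr(sigma) s + O(r_n) in
   mean: after a gap the outcomes see the past only through the stationary state.  That state is in turn
   approximated, at the cost of a further r_l, by propagating a fixed state, and then depends on finitely
   many instruments only, so that the strong mixing of the environment applies.

   Central limit theorem.  For centred bounded X_k with summable decorrelation a(n) put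
   Z_k = exp(i u S_k), u = t / sqrt n.  Writing E[Z_k X_k] as the telescoping sum of
   E[(Z_(j+1) - Z_j) X_k], the j far from k contribute O(u) times a tail of a, because
   |Z_(j+1) - Z_j| <= |u|, and each of the finitely many near ones is i u Cov(X_j, X_k) E[Z_k] up to
   o(u).  Hence E[Z_(k+1)] = (1 - u^2 Sigma^2 / 2) E[Z_k] + o(u^2), which is iterated n times and combined
   with Levy's continuity theorem.  No bound on fourth moments is needed. *)
theory Submission
  imports Defs
begin

section \<open>Positive semidefinite matrices and the trace norm\<close>

text \<open>\<open>trnorm\<close>, \<open>quenched\<close> and \<open>annealed\<close> are given
  through \<open>THE\<close> or \<open>measure_of\<close>, so each must first be shown to denote
  something: hence the square root of a positive matrix and the sequence measure built from cylinder
  weights. The outcomes are not functions of the environment, so mixing of the instruments does not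
  apply to them directly. A gap n is used twice: as a whole to replace the influence of the past on
  the state by s, then, for the covariance that is left between two functions of the environment, in
  two halves, one separating the sigma-algebras and one in which a fixed state forgets its start. On
  the past side the fixed state may start arbitrarily far back, since the past sigma-algebra
  contains all negative times, and its error disappears in the limit. In the limit theorem n u^2 =
  t^2 is constant, so the error per step has to be o(u^2). The number of near lags and the gap are
  chosen from the tolerance alone, before n; the terms in |u|^3, whose constants depend on them,
  then vanish. (H2) and (H3) enter through plain summability: a small term is dominated by its power
  with exponent below one.\<close>

definition hip :: "complex^'d::finite \<Rightarrow> complex^'d \<Rightarrow> complex" where
  "hip x y = (\<Sum>i\<in>UNIV. cnj (x $ i) * y $ i)"

lemma psd_iff_hip: "psd A \<longleftrightarrow> (\<forall>x. cnonneg (hip x (A *v x)))"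
  unfolding psd_def hip_def matrix_vector_mult_def
  by (simp add: sum_distrib_left mult.assoc)

lemma hip_adj: "hip x (adj B *v y) = hip (B *v x) y"
  unfolding hip_def matrix_vector_mult_def adj_def
  by (simp add: sum_distrib_left sum_distrib_right mult_ac)
     (subst sum.swap, simp add: mult_ac)

lemma hip_add_right: "hip x (y + z) = hip x y + hip x z"
  by (simp add: hip_def algebra_simps sum.distrib)

lemma hip_scaleR_right: "hip x (c *\<^sub>R y) = of_real c * hip x y"
  unfolding hip_def by (simp add: sum_distrib_left, rule sum.cong) (auto simp: scaleR_conv_of_real)

lemma hip_self: "hip x x = of_real ((norm x)\<^sup>2)"
proof -
  have "hip x x = (\<Sum>i\<in>UNIV. of_real ((norm (x$i))\<^sup>2))"
    unfolding hip_def by (intro sum.cong) (auto simp: complex_norm_square mult.commute simp del: of_real_power)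
  then show ?thesis by (simp add: norm_vec_def L2_set_def sum_nonneg)
qed

lemma cnonneg_add: "cnonneg x \<Longrightarrow> cnonneg y \<Longrightarrow> cnonneg (x + y)"
  by (simp add: cnonneg_def)

lemma cnonneg_scale: "0 \<le> c \<Longrightarrow> cnonneg x \<Longrightarrow> cnonneg (of_real c * x)"
  by (simp add: cnonneg_def)

lemma scaleR_matrix_vector: "(c *\<^sub>R A) *v x = c *\<^sub>R ((A :: complex^'n^'m) *v x)"
  by (simp add: vec_eq_iff matrix_vector_mult_def scaleR_sum_right)

lemma mat_mul_scaleR_left: "(c *\<^sub>R A) ** B = c *\<^sub>R (A ** B :: complex^'n^'m)"
  by (simp add: vec_eq_iff matrix_matrix_mult_def scaleR_sum_right)

lemma mat_mul_scaleR_right: "A ** (c *\<^sub>R B) = c *\<^sub>R (A ** B :: complex^'n^'m)"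
  by (simp add: vec_eq_iff matrix_matrix_mult_def scaleR_sum_right)

lemma mat_mul_diff_left: "(A - B) ** C = A ** C - (B ** C :: complex^'n^'m)"
  by (simp add: vec_eq_iff matrix_matrix_mult_def algebra_simps sum_subtractf)

lemma mat_mul_diff_right: "A ** (B - C) = A ** B - (A ** C :: complex^'n^'m)"
  by (simp add: vec_eq_iff matrix_matrix_mult_def algebra_simps sum_subtractf)

lemma mat_mul_add_left: "(A + B) ** C = A ** C + (B ** C :: complex^'n^'m)"
  by (simp add: vec_eq_iff matrix_matrix_mult_def algebra_simps sum.distrib)

lemma mat_mul_zero [simp]: "0 ** (X :: complex^'n^'m) = 0" "(X :: complex^'n^'m) ** 0 = 0"
  by (simp_all add: vec_eq_iff matrix_matrix_mult_def)

lemma trace_zero [simp]: "trace (0 :: complex^'n^'n) = 0"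
  by (simp add: trace_def)

lemmas mat_algebra = mat_mul_scaleR_left mat_mul_scaleR_right mat_mul_diff_left mat_mul_diff_right
  mat_mul_add_left matrix_add_ldistrib

lemma trace_scaleR: "trace (c *\<^sub>R A) = c *\<^sub>R trace (A :: complex^'n^'n)"
  by (simp add: trace_def scaleR_sum_right)

lemma trace_sum: "trace (\<Sum>i\<in>I. f i) = (\<Sum>i\<in>I. trace (f i :: complex^'n^'n))"
  unfolding trace_def by (simp add: sum_component) (rule sum.swap)

lemma adj_mul: "adj (A ** B) = adj B ** adj A"
  by (simp add: vec_eq_iff adj_def matrix_matrix_mult_def mult.commute)

lemma adj_adj [simp]: "adj (adj A) = A"
  by (simp add: vec_eq_iff adj_def)

lemma adj_mat_1 [simp]: "adj (mat 1) = mat 1"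
  by (auto simp: vec_eq_iff adj_def mat_def)

lemma adj_diff: "adj (A - B) = adj A - adj B"
  by (simp add: vec_eq_iff adj_def)

lemma psd_add: "psd A \<Longrightarrow> psd B \<Longrightarrow> psd (A + B)"
  by (simp add: psd_iff_hip matrix_vector_mult_add_rdistrib hip_add_right cnonneg_add)

lemma psd_scaleR: "0 \<le> c \<Longrightarrow> psd A \<Longrightarrow> psd (c *\<^sub>R A)"
  by (simp add: psd_iff_hip scaleR_matrix_vector hip_scaleR_right cnonneg_scale)

lemma psd_zero [simp]: "psd 0"
  by (simp add: psd_iff_hip hip_def cnonneg_def)

lemma psd_sum: "(\<And>i. i \<in> I \<Longrightarrow> psd (f i)) \<Longrightarrow> psd (\<Sum>i\<in>I. f i)"
  by (induction I rule: infinite_finite_induct) (auto intro: psd_add)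

lemma psd_mat_1 [simp]: "psd (mat 1)"
  by (simp add: psd_iff_hip hip_self cnonneg_def)

lemma psd_sandwich:
  assumes "psd A" shows "psd (adj B ** A ** B)"
  using assms by (simp add: psd_iff_hip matrix_vector_mul_assoc[symmetric] hip_adj)

lemma psd_adj_mul: "psd (adj B ** B)"
  using psd_sandwich[OF psd_mat_1, of B] by simp

text \<open>The form at a vector supported on the coordinates \<open>i\<close> and \<open>j\<close>,
  that is, positivity of a two by two principal block. Hermitian symmetry and the entry bound are
  both read off from it.\<close>

lemma psd_offdiag:
  assumes "psd A" "i \<noteq> j"
  shows "cnonneg (A$i$i * (cnj a * a) + A$i$j * (cnj a * c) + A$j$i * (cnj c * a) + A$j$j * (cnj c * c))"
proof -
  have *: "(\<Sum>q\<in>UNIV. (cnj ((axis i a + axis j c) $ p) * A $ p $ q) * (axis i a + axis j c) $ q)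
     = cnj ((axis i a + axis j c) $ p) * A $ p $ i * a + cnj ((axis i a + axis j c) $ p) * A $ p $ j * c" for p
    by (simp add: axis_def algebra_simps sum.distrib if_distrib[of "\<lambda>x. _ * x"] cong: if_cong)
  have "cnonneg (\<Sum>p\<in>UNIV. \<Sum>q\<in>UNIV. cnj ((axis i a + axis j c) $ p) * A $ p $ q * (axis i a + axis j c) $ q)"
    using assms unfolding psd_def by blast
  also have "(\<Sum>p\<in>UNIV. \<Sum>q\<in>UNIV. cnj ((axis i a + axis j c) $ p) * A $ p $ q * (axis i a + axis j c) $ q)
     = (\<Sum>p\<in>UNIV. (if i = p then cnj a * (A $ p $ i * a + A $ p $ j * c) else 0)
         + (if j = p then cnj c * (A $ p $ i * a + A $ p $ j * c) else 0))"
    unfolding * using assms(2) by (intro sum.cong) (auto simp: axis_def algebra_simps)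
  also have "\<dots> = cnj a * (A $ i $ i * a + A $ i $ j * c) + cnj c * (A $ j $ i * a + A $ j $ j * c)"
    by (simp add: sum.distrib)
  finally show ?thesis by (simp add: algebra_simps)
qed

lemma psd_diag: assumes "psd A" shows "cnonneg (A$i$i)"
proof -
  have "hip (axis i 1) (A *v axis i 1) = A$i$i"
    by (simp add: hip_def matrix_vector_mult_def axis_def if_distrib[of "\<lambda>x. x * _"] if_distrib[of "\<lambda>x. _ * x"]
       if_distrib[of cnj] cong: if_cong)
  then show ?thesis using assms by (metis psd_iff_hip)
qed

lemma psd_hermitian: assumes "psd A" shows "adj A = A"
proof -
  have "cnj (A$j$i) = A$i$j" for i j
  proof (cases "i = j")
    case True then show ?thesis using psd_diag[OF assms, of i] by (simp add: complex_eq_iff cnonneg_def)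
  next
    case False
    show ?thesis
      \<comment> \<open>Polarisation: reality of the form at (1, 1) makes the imaginary parts of the
        two entries opposite, reality at (1, \<i>) makes the real parts equal.\<close>
      using psd_offdiag[OF assms False, of 1 1] psd_offdiag[OF assms False, of 1 \<i>]
        psd_diag[OF assms, of i] psd_diag[OF assms, of j]
      by (simp add: complex_eq_iff cnonneg_def)
  qed
  then show ?thesis by (simp add: vec_eq_iff adj_def)
qed

lemma psd_trace: assumes "psd A" shows "0 \<le> Re (trace A)" "Im (trace A) = 0"
  using psd_diag[OF assms] by (auto simp: trace_def cnonneg_def intro!: sum_nonneg)

lemma psd_entry_le:
  assumes "psd A" shows "norm (A$i$j) \<le> (Re (A$i$i) + Re (A$j$j)) / 2"
proof (cases "i = j")
  case True
  then show ?thesis using psd_diag[OF assms, of i] by (simp add: cnonneg_def cmod_def)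
next
  case False
  define z where "z = A$i$j"
  \<comment> \<open>The phase that turns both cross terms of the form into -|z|. With first
    coordinate 1 the form becomes the sum of the two diagonal entries minus 2|z|.\<close>
  define u where "u = (if z = 0 then 1 else - cnj z / of_real (norm z))"
  have zu: "z * u = - of_real (norm z)" "cnj u * u = 1"
    using complex_norm_square[of z] by (auto simp: u_def field_simps power2_eq_square)
  have "A$j$i = cnj z" using psd_hermitian[OF assms] by (auto simp: vec_eq_iff adj_def z_def)
  then have "A$j$i * cnj u = cnj (z * u)" by simp
  then have "A$j$i * cnj u = - of_real (norm z)" unfolding zu by simp
  then show ?thesis
    using psd_offdiag[OF assms False, of 1 u] zu
    by (simp add: cnonneg_def z_def[symmetric])
qed

text \<open>Lets convergence of positive increments be checked on the real sequence of their traces,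
  and later turns trace norm bounds into bounds on \<open>norm\<close>, which is the entrywise
  Euclidean norm here.\<close>

lemma psd_norm_le_trace:
  fixes A :: "'d::finite cmat"
  assumes "psd A" shows "norm A \<le> real CARD('d) * Re (trace A)"
proof -
  have "norm A \<le> (\<Sum>i\<in>UNIV. norm (A$i))" by (simp add: norm_vec_def L2_set_le_sum)
  also have "\<dots> \<le> (\<Sum>i\<in>UNIV. \<Sum>j\<in>UNIV. norm (A$i$j))"
    by (intro sum_mono) (simp add: norm_vec_def L2_set_le_sum)
  also have "\<dots> \<le> (\<Sum>i\<in>(UNIV::'d set). \<Sum>j\<in>(UNIV::'d set). (Re (A$i$i) + Re (A$j$j)) / 2)"
    by (intro sum_mono psd_entry_le assms)
  also have "\<dots> = real CARD('d) * Re (trace A)"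
    by (simp add: trace_def add_divide_distrib sum.distrib sum_distrib_left sum_divide_distrib[symmetric])
  finally show ?thesis .
qed

lemma psd_trace_0: "psd A \<Longrightarrow> Re (trace A) = 0 \<Longrightarrow> A = 0"
  using psd_norm_le_trace[of A] by simp

section \<open>Uniqueness and existence of the positive square root\<close>

lemma norm_sq_trace: "(norm X)\<^sup>2 = Re (trace (adj X ** X))"
proof -
  have "(norm X)\<^sup>2 = (\<Sum>i\<in>UNIV. \<Sum>j\<in>UNIV. (norm (X$i$j))\<^sup>2)"
    by (simp add: norm_vec_def L2_set_def sum_nonneg)
  also have "\<dots> = (\<Sum>j\<in>UNIV. \<Sum>i\<in>UNIV. (norm (X$i$j))\<^sup>2)" by (rule sum.swap)
  also have "\<dots> = Re (trace (adj X ** X))"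
    unfolding cmod_power2 by (simp add: trace_def matrix_matrix_mult_def adj_def power2_eq_square)
  finally show ?thesis .
qed

lemma trace_le_norm:
  fixes X :: "'d::finite cmat" shows "norm (trace X) \<le> real CARD('d) * norm X"
proof -
  have "norm (trace X) \<le> (\<Sum>i\<in>UNIV. norm (X$i$i))" unfolding trace_def by (rule norm_sum)
  also have "\<dots> \<le> (\<Sum>i\<in>(UNIV::'d set). norm X)"
    by (intro sum_mono) (meson Finite_Cartesian_Product.norm_nth_le order_trans)
  finally show ?thesis by simp
qed

text \<open>With \<open>R = P - Q\<close> one has \<open>R P + Q R = 0\<close>; multiplying by \<open>R\<close> and taking traces gives
  \<open>R P R = R Q R = 0\<close>, hence \<open>R\<^sup>3 = 0\<close>. No commutation of \<open>P\<close> and \<open>Q\<close> is needed.\<close>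
lemma psd_sqrt_unique:
  assumes P: "psd P" and Q: "psd Q" and eq: "P ** P = Q ** Q"
  shows "P = Q"
proof -
  define D where "D = P - Q"
  have aD: "adj D = D" using P Q by (simp add: D_def adj_diff psd_hermitian)
  have DPD: "psd (D ** P ** D)" "psd (D ** Q ** D)"
    using psd_sandwich[OF P, of D] psd_sandwich[OF Q, of D] aD by auto
  have "D ** P + Q ** D = 0" using eq by (simp add: D_def mat_algebra)
  then have "(D ** P + Q ** D) ** D = 0" by (simp add: vec_eq_iff matrix_matrix_mult_def)
  then have "trace (D ** P ** D) + trace (Q ** D ** D) = 0"
    by (simp add: mat_mul_add_left trace_add[symmetric] trace_0[unfolded mat_0])
  moreover have "trace (Q ** D ** D) = trace (D ** Q ** D)"
    by (metis matrix_mul_assoc trace_mul_sym)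
  ultimately have "Re (trace (D ** P ** D)) + Re (trace (D ** Q ** D)) = 0"
    by (simp add: complex_eq_iff)
  then have "D ** P ** D = 0" "D ** Q ** D = 0"
    using psd_trace[OF DPD(1)] psd_trace[OF DPD(2)] psd_trace_0[OF DPD(1)] psd_trace_0[OF DPD(2)] by auto
  then have D3: "D ** D ** D = 0" by (simp add: D_def mat_algebra)
  have "(norm (D ** D))\<^sup>2 = Re (trace (D ** D ** D ** D))"
    by (simp add: norm_sq_trace adj_mul aD matrix_mul_assoc)
  also have "\<dots> = 0" by (simp add: D3)
  finally have "D ** D = 0" by simp
  then have "(norm D)\<^sup>2 = 0" by (simp add: norm_sq_trace aD trace_def)
  then show ?thesis by (simp add: D_def)
qed


text \<open>Polynomials in \<open>B\<close> with nonnegative coefficients; the increments of \<open>sqrt_iter\<close> below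
  are of this kind, so for \<open>B \<ge> 0\<close> the iteration is monotone.\<close>
inductive_set pos_poly :: "'d::finite cmat \<Rightarrow> 'd cmat set" for B where
  zero: "0 \<in> pos_poly B"
| one: "mat 1 \<in> pos_poly B"
| step: "X \<in> pos_poly B \<Longrightarrow> X ** B \<in> pos_poly B"
| add: "X \<in> pos_poly B \<Longrightarrow> Y \<in> pos_poly B \<Longrightarrow> X + Y \<in> pos_poly B"
| scale: "X \<in> pos_poly B \<Longrightarrow> 0 \<le> c \<Longrightarrow> c *\<^sub>R X \<in> pos_poly B"

lemma pos_poly_commute: "X \<in> pos_poly B \<Longrightarrow> X ** B = B ** X"
proof (induction rule: pos_poly.induct)
  case (step X)
  then show ?case by (metis matrix_mul_assoc)
qed (simp_all add: mat_algebra)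

lemma pos_poly_mult: "Y \<in> pos_poly B \<Longrightarrow> X \<in> pos_poly B \<Longrightarrow> X ** Y \<in> pos_poly B"
  by (induction rule: pos_poly.induct) (auto simp: mat_algebra matrix_mul_assoc intro: pos_poly.intros)

lemma pos_poly_commute2: "Y \<in> pos_poly B \<Longrightarrow> X \<in> pos_poly B \<Longrightarrow> X ** Y = Y ** X"
proof (induction rule: pos_poly.induct)
  case (step Z)
  have "X ** (Z ** B) = Z ** (X ** B)" using step by (simp add: matrix_mul_assoc)
  also have "\<dots> = Z ** B ** X" using pos_poly_commute[OF step.prems] by (simp add: matrix_mul_assoc)
  finally show ?case .
qed (simp_all add: mat_algebra)

text \<open>The claim on \<open>X ** B\<close> is carried along to make the induction work: since
  \<open>X\<close> commutes with \<open>B\<close>, the new product X B B equals B X B, a sandwich of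
  \<open>X\<close> by a Hermitian matrix.\<close>

lemma pos_poly_psd_aux:
  assumes "psd B" "X \<in> pos_poly B" shows "psd X \<and> psd (X ** B)"
  using assms(2)
proof (induction rule: pos_poly.induct)
  case (step X)
  have "X ** B ** B = adj B ** X ** B"
    using pos_poly_commute[OF step.hyps] psd_hermitian[OF assms(1)] by simp
  then show ?case using step psd_sandwich[of X B] by simp
qed (use assms(1) in \<open>auto simp: mat_algebra intro: psd_add psd_scaleR\<close>)

lemmas pos_poly_psd = pos_poly_psd_aux[THEN conjunct1]

lemma psd_closed: "closed (Collect psd :: 'd::finite cmat set)"
proof -
  have *: "closed (Collect cnonneg)"
    unfolding cnonneg_def by (intro closed_Collect_conj closed_Collect_eq closed_Collect_le continuous_intros)
  have "Collect psd = (\<Inter>x. (\<lambda>A::'d cmat. \<Sum>i\<in>UNIV. \<Sum>j\<in>UNIV. cnj (x $ i) * A $ i $ j * x $ j) -` Collect cnonneg)"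
    by (auto simp: psd_def)
  also have "closed \<dots>"
    by (intro closed_INT ballI closed_vimage * continuous_intros)
  finally show ?thesis .
qed

lemma continuous_on_mat_mul [continuous_intros]:
  fixes f g :: "'x::topological_space \<Rightarrow> 'd::finite cmat"
  assumes "continuous_on S f" "continuous_on S g"
  shows "continuous_on S (\<lambda>x. f x ** g x)"
  unfolding matrix_matrix_mult_def by (intro continuous_intros assms)

lemma continuous_on_adj [continuous_intros]:
  fixes f :: "'x::topological_space \<Rightarrow> 'd::finite cmat"
  assumes "continuous_on S f"
  shows "continuous_on S (\<lambda>x. adj (f x))"
  unfolding adj_def by (intro continuous_intros assms)

lemma continuous_on_trace [continuous_intros]:
  fixes f :: "'x::topological_space \<Rightarrow> 'd::finite cmat"
  assumes "continuous_on S f"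
  shows "continuous_on S (\<lambda>x. trace (f x))"
  unfolding trace_def by (intro continuous_intros assms)

text \<open>A fixed point satisfies 2 Y = B + Y Y, that is, (1 - Y)(1 - Y) = 1 - B. The iteration
  thus computes one minus the square root of 1 - B, using only products and sums with nonnegative
  coefficients.\<close>

fun sqrt_iter :: "'d::finite cmat \<Rightarrow> nat \<Rightarrow> 'd cmat" where
  "sqrt_iter B 0 = 0"
| "sqrt_iter B (Suc n) = (1/2) *\<^sub>R (B + sqrt_iter B n ** sqrt_iter B n)"

lemma pos_poly_self: "B \<in> pos_poly B"
  using pos_poly.step[OF pos_poly.one, of B] by simp

lemma sqrt_iter_pos_poly: "sqrt_iter B n \<in> pos_poly B"
  by (induction n) (auto intro!: pos_poly.intros pos_poly_self pos_poly_mult)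

lemma sqrt_iter_incr: "sqrt_iter B (Suc n) - sqrt_iter B n \<in> pos_poly B"
proof (induction n)
  case 0 then show ?case by (auto intro!: pos_poly.scale pos_poly_self)
next
  case (Suc n)
  let ?x = "sqrt_iter B (Suc n)" and ?y = "sqrt_iter B n"
  \<comment> \<open>Commutation lets the difference of squares factor: the new increment is half the
    old increment times the sum of the two iterates.\<close>
  have "?x ** ?y = ?y ** ?x" using sqrt_iter_pos_poly pos_poly_commute2 by blast
  then have "sqrt_iter B (Suc (Suc n)) - ?x = (1/2) *\<^sub>R ((?x - ?y) ** (?x + ?y))"
    unfolding sqrt_iter.simps(2)[of B "Suc n"]
    by (subst (3) sqrt_iter.simps) (simp add: mat_algebra scaleR_diff_right[symmetric] del: sqrt_iter.simps)
  then show ?case using Suc by (auto intro!: pos_poly.intros pos_poly_mult sqrt_iter_pos_poly simp del: sqrt_iter.simps)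
qed

lemma sqrt_iter_le_1:
  assumes B: "psd B" "psd (mat 1 - B)" shows "psd (mat 1 - sqrt_iter B n)"
proof (induction n)
  case (Suc n)
  define Y where "Y = sqrt_iter B n"
  have Y: "psd Y" using pos_poly_psd[OF B(1)] sqrt_iter_pos_poly Y_def by metis
  have aY: "adj Y = Y" by (rule psd_hermitian[OF Y])
  have Y1: "psd (mat 1 - Y)" using Suc Y_def by simp
  \<comment> \<open>With Y the current iterate, 1 - Y Y is a sum of visibly positive terms: Y (1 -
    Y) Y + (1 - Y) Y (1 - Y) = Y - Y Y, and adding 1 - Y gives 1 - Y Y.\<close>
  have *: "mat 1 - sqrt_iter B (Suc n) = (1/2) *\<^sub>R ((mat 1 - B) + ((mat 1 - Y) +
      (adj Y ** (mat 1 - Y) ** Y + adj (mat 1 - Y) ** Y ** (mat 1 - Y))))"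
    by (simp add: Y_def[symmetric] mat_algebra aY adj_diff matrix_mul_assoc)
      (simp add: vec_eq_iff, simp add: scaleR_conv_of_real field_simps)
  show ?case unfolding * by (intro psd_scaleR psd_add psd_sandwich B Y Y1) simp
qed simp

text \<open>The iterates increase in the positive order and stay below 1, so their traces converge.
  The norm of a positive increment is controlled by its trace, so the iterates themselves are
  Cauchy.\<close>

lemma psd_sqrt_exists_contraction:
  fixes B :: "'d::finite cmat"
  assumes B: "psd B" "psd (mat 1 - B)"
  shows "\<exists>P. psd P \<and> P ** P = mat 1 - B"
proof -
  let ?Y = "sqrt_iter B"
  have diff: "psd (?Y (n + k) - ?Y n)" for n k
  proof (induction k)
    case (Suc k)
    have "?Y (n + Suc k) - ?Y n = (?Y (Suc (n + k)) - ?Y (n + k)) + (?Y (n + k) - ?Y n)" by simp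
    then show ?case using Suc pos_poly_psd[OF B(1) sqrt_iter_incr] by (metis psd_add)
  qed simp
  define t where "t n = Re (trace (?Y n))" for n
  have tdiff: "Re (trace (?Y (n + k) - ?Y n)) = t (n + k) - t n" for n k
    by (simp add: t_def trace_sub)
  have "incseq t"
    using psd_trace(1)[OF diff] unfolding tdiff incseq_def by (metis diff_ge_0_iff_ge le_iff_add)
  moreover have "t n \<le> real CARD('d)" for n
    using psd_trace(1)[OF sqrt_iter_le_1[OF B, of n]] by (simp add: t_def trace_sub trace_I)
  ultimately have "convergent t" by (meson incseq_convergent convergentI)
  then have "Cauchy t" by (rule convergent_Cauchy)
  have "Cauchy ?Y"
  proof (rule metric_CauchyI)
    fix e :: real assume "0 < e"
    then obtain N where N: "\<And>n m. n \<ge> N \<Longrightarrow> m \<ge> N \<Longrightarrow> dist (t m) (t n) < e / real CARD('d)"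
      using metric_CauchyD[OF \<open>Cauchy t\<close>, of "e / real CARD('d)"] by fastforce
    have le: "dist (?Y (n + k)) (?Y n) < e" if "n \<ge> N" for n k
    proof -
      have "dist (?Y (n + k)) (?Y n) \<le> real CARD('d) * (t (n + k) - t n)"
        using psd_norm_le_trace[OF diff, of n k] unfolding tdiff by (simp add: dist_norm)
      also have "\<dots> < e" using N[of n "n + k"] that by (simp add: dist_real_def abs_less_iff field_simps)
      finally show ?thesis .
    qed
    have "dist (?Y m) (?Y n) < e" if "m \<ge> N" "n \<ge> N" for m n
      using le[of n "m - n"] le[of m "n - m"] that by (cases "m \<ge> n") (auto simp: dist_commute)
    then show "\<exists>M. \<forall>m\<ge>M. \<forall>n\<ge>M. dist (?Y m) (?Y n) < e" by blast
  qed
  then obtain Y where Y: "?Y \<longlonglongrightarrow> Y" using Cauchy_convergent convergent_def by blast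
  have "psd (mat 1 - Y)"
    using closed_sequentially[OF psd_closed, of "\<lambda>n. mat 1 - ?Y n" "mat 1 - Y"] sqrt_iter_le_1[OF B]
      tendsto_diff[OF tendsto_const Y] by auto
  moreover have "Y = (1/2) *\<^sub>R (B + Y ** Y)"
  proof (rule LIMSEQ_unique)
    show "(\<lambda>n. ?Y (Suc n)) \<longlonglongrightarrow> Y" by (rule LIMSEQ_Suc[OF Y])
    have "continuous_on UNIV (\<lambda>Y. (1/2) *\<^sub>R (B + Y ** Y))" by (intro continuous_intros)
    then show "(\<lambda>n. ?Y (Suc n)) \<longlonglongrightarrow> (1/2) *\<^sub>R (B + Y ** Y)"
      using continuous_on_tendsto_compose[OF _ Y, of UNIV "\<lambda>Y. (1/2) *\<^sub>R (B + Y ** Y)"] by simp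
  qed
  then have "2 *\<^sub>R Y = 2 *\<^sub>R (1/2) *\<^sub>R (B + Y ** Y)" by (rule arg_cong)
  then have "Y + Y = B + Y ** Y" by (simp add: scaleR_2)
  then have "(mat 1 - Y) ** (mat 1 - Y) = mat 1 - B" by (simp add: mat_algebra algebra_simps)
  ultimately show ?thesis by blast
qed

lemma hip_Cauchy: "norm (hip x y) \<le> norm x * norm y"
proof -
  have "norm (hip x y) \<le> (\<Sum>i\<in>UNIV. \<bar>norm (x$i)\<bar> * \<bar>norm (y$i)\<bar>)"
    unfolding hip_def by (rule sum_norm_le) (simp add: norm_mult)
  also have "\<dots> \<le> norm x * norm y" unfolding norm_vec_def by (rule L2_set_mult_ineq)
  finally show ?thesis .
qed

lemma norm_matrix_vector_le: "norm (A *v x) \<le> norm (A :: complex^'n^'m) * norm x"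
proof -
  have "norm ((A *v x) $ i) \<le> norm (A $ i) * norm x" for i
  proof -
    have "norm ((A *v x) $ i) \<le> (\<Sum>j\<in>UNIV. \<bar>norm (A$i$j)\<bar> * \<bar>norm (x$j)\<bar>)"
      unfolding matrix_vector_mult_def by (simp, rule sum_norm_le) (simp add: norm_mult)
    also have "\<dots> \<le> norm (A $ i) * norm x" unfolding norm_vec_def by (rule L2_set_mult_ineq)
    finally show ?thesis .
  qed
  then have "norm (A *v x) \<le> L2_set (\<lambda>i. norm (A $ i) * norm x) UNIV"
    unfolding norm_vec_def[of "A *v x"] by (intro L2_set_mono) auto
  then show ?thesis by (simp add: L2_set_left_distrib norm_vec_def[of A])
qed

text \<open>The form of \<open>A\<close> is real and at most the norm of \<open>A\<close> times the
  squared norm of the vector. This scales a positive matrix into the range of the square root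
  iteration, and writes a Hermitian matrix as a difference of two positive ones.\<close>

lemma hermitian_add_norm_psd:
  fixes A :: "'d::finite cmat"
  assumes "adj A = A" "norm A \<le> c" shows "psd (c *\<^sub>R mat 1 + A)"
  unfolding psd_iff_hip
proof
  fix x :: "complex^'d"
  have "cnj (hip x (A *v x)) = hip (A *v x) x" by (simp add: hip_def mult.commute)
  also have "\<dots> = hip x (A *v x)" by (metis hip_adj assms(1))
  finally have "Im (hip x (A *v x)) = 0" by (simp add: complex_eq_iff)
  moreover have "norm (hip x (A *v x)) \<le> c * (norm x)\<^sup>2"
  proof -
    have "norm (hip x (A *v x)) \<le> norm x * (norm A * norm x)"
      by (meson hip_Cauchy norm_matrix_vector_le mult_left_mono norm_ge_zero order_trans)
    also have "\<dots> \<le> norm x * (c * norm x)" by (intro mult_left_mono mult_right_mono assms) auto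
    finally show ?thesis by (simp add: power2_eq_square mult_ac)
  qed
  ultimately show "cnonneg (hip x ((c *\<^sub>R mat 1 + A) *v x))"
    using abs_Re_le_cmod[of "hip x (A *v x)"]
    by (simp add: cnonneg_def matrix_vector_mult_add_rdistrib hip_add_right scaleR_matrix_vector
        hip_scaleR_right hip_self)
qed

lemma psd_sqrt_exists:
  fixes A :: "'d::finite cmat"
  assumes A: "psd A" shows "\<exists>P. psd P \<and> P ** P = A"
proof (cases "A = 0")
  case True then show ?thesis by (intro exI[of _ 0]) simp
next
  case False
  define c where "c = norm A"
  have c: "c > 0" using False by (simp add: c_def)
  \<comment> \<open>After division by its norm \<open>A\<close> has the form 1 - B with
    \<open>B\<close> and 1 - B positive; the root is scaled back by \<open>sqrt c\<close>.\<close>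
  define B where "B = mat 1 - (1/c) *\<^sub>R A"
  have "adj (- ((1/c) *\<^sub>R A)) = - ((1/c) *\<^sub>R A)"
    using psd_hermitian[OF A] by (simp add: adj_def vec_eq_iff)
  then have "psd B" using hermitian_add_norm_psd[of "- ((1/c) *\<^sub>R A)" 1] c by (simp add: B_def c_def)
  moreover have 1: "mat 1 - B = (1/c) *\<^sub>R A" by (simp add: B_def)
  then have "psd (mat 1 - B)" using A c by (simp add: psd_scaleR)
  ultimately obtain P where P: "psd P" "P ** P = (1/c) *\<^sub>R A"
    using psd_sqrt_exists_contraction 1 by metis
  have "psd (sqrt c *\<^sub>R P)" using P c by (simp add: psd_scaleR)
  moreover have "(sqrt c *\<^sub>R P) ** (sqrt c *\<^sub>R P) = A" using P(2) c by (simp add: mat_algebra)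
  ultimately show ?thesis by blast
qed

section \<open>Absolute value and trace norm\<close>

lemma mabs: "psd (mabs X)" "mabs X ** mabs X = adj X ** X"
proof -
  have "\<exists>!P. psd P \<and> P ** P = adj X ** X"
    using psd_sqrt_exists[OF psd_adj_mul] psd_sqrt_unique by metis
  from theI'[OF this] show "psd (mabs X)" "mabs X ** mabs X = adj X ** X"
    by (auto simp: mabs_def)
qed

lemma mabs_eq: "psd P \<Longrightarrow> P ** P = adj X ** X \<Longrightarrow> mabs X = P"
  by (rule psd_sqrt_unique[OF mabs(1)]) (simp_all add: mabs(2))

lemma norm_mabs [simp]: "norm (mabs X) = norm X"
proof -
  have "(norm (mabs X))\<^sup>2 = (norm X)\<^sup>2"
    unfolding norm_sq_trace psd_hermitian[OF mabs(1)] mabs(2) ..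
  then show ?thesis by simp
qed

lemma norm_le_trnorm:
  fixes X :: "'d::finite cmat" shows "norm X \<le> real CARD('d) * trnorm X"
  using psd_norm_le_trace[OF mabs(1)[of X]] by (simp add: trnorm_def)

lemma trnorm_nonneg: "0 \<le> trnorm X"
  by (simp add: trnorm_def psd_trace mabs)

lemma trnorm_le_norm:
  fixes X :: "'d::finite cmat" shows "trnorm X \<le> real CARD('d) * norm X"
  using trace_le_norm[of "mabs X"] complex_Re_le_cmod[of "trace (mabs X)"] by (simp add: trnorm_def)

text \<open>Closed graph argument: by uniqueness of the root, the graph is cut out by closed
  conditions, and \<open>mabs\<close> preserves the norm, so it maps a closed ball into the same
  compact ball. Open balls then exhaust the space. The purpose is measurability of
  \<open>trnorm\<close>.\<close>

lemma continuous_mabs: "continuous_on UNIV (mabs :: 'd::finite cmat \<Rightarrow> 'd cmat)"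
proof -
  have "continuous_on (cball 0 r) (mabs :: 'd cmat \<Rightarrow> 'd cmat)" for r
  proof (rule continuous_from_closed_graph)
    show "compact (cball 0 r :: 'd cmat set)" by simp
    have "(\<lambda>X::'d cmat. (X, mabs X)) ` cball 0 r
        = {z. fst z \<in> cball 0 r \<and> snd z \<in> Collect psd \<and> snd z ** snd z = adj (fst z) ** fst z}"
      by (auto simp: mabs image_iff) (metis mabs_eq)
    also have "closed \<dots>"
      by (intro closed_Collect_conj closed_Collect_eq continuous_intros closed_vimage[of "cball 0 r" fst, unfolded vimage_def]
         closed_vimage[of "Collect psd" snd, unfolded vimage_def] psd_closed) auto
    finally show "closed ((\<lambda>X::'d cmat. (X, mabs X)) ` cball 0 r)" .
  qed auto
  then have "continuous_on (ball 0 r) (mabs :: 'd cmat \<Rightarrow> 'd cmat)" for r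
    by (meson ball_subset_cball continuous_on_subset)
  then have "continuous_on (\<Union>r\<in>UNIV. ball 0 r) (mabs :: 'd cmat \<Rightarrow> 'd cmat)"
    by (intro continuous_on_open_UN) auto
  moreover have "(\<Union>r\<in>UNIV. ball (0::'d cmat) r) = UNIV"
    using gt_ex by auto
  ultimately show ?thesis by simp
qed

lemma trnorm_measurable [measurable]: "trnorm \<in> borel_measurable borel"
  unfolding trnorm_def by (intro borel_measurable_continuous_onI continuous_intros continuous_mabs)

section \<open>Probability measures on sequence space\<close>

definition words :: "nat \<Rightarrow> 'a::finite list set" where "words n = {w. length w = n}"

definition prefix_word :: "nat \<Rightarrow> (nat \<Rightarrow> 'a) \<Rightarrow> 'a list" where "prefix_word n y = map y [0..<n]"

lemma finite_words [simp]: "finite (words n)"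
  using finite_lists_length_eq[of "UNIV :: 'a set" n] by (simp add: words_def)

lemma words_0 [simp]: "words 0 = {[]}"
  by (auto simp: words_def)

lemma sum_words_add:
  "(\<Sum>w\<in>words (n + k). f w) = (\<Sum>u\<in>words n. \<Sum>v\<in>words k. f (u @ v))"
  unfolding sum.cartesian_product
  by (rule sum.reindex_bij_witness[of _ "\<lambda>(u, v). u @ v" "\<lambda>w. (take n w, drop n w)"])
     (auto simp: words_def)

lemma sum_words_1: "(\<Sum>w\<in>words (Suc 0). f w) = (\<Sum>a\<in>UNIV. f [a])"
  by (rule sum.reindex_bij_witness[of _ "\<lambda>a. [a]" hd]) (auto simp: words_def length_Suc_conv)

lemma sum_words_Suc: "(\<Sum>w\<in>words (Suc n). f w) = (\<Sum>w\<in>words n. \<Sum>a\<in>UNIV. f (w @ [a]))"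
  using sum_words_add[of f n 1] by (simp add: sum_words_1)

lemma prefix_word_Suc: "prefix_word (Suc n) y = prefix_word n y @ [y n]"
  by (simp add: prefix_word_def)

lemma prefix_word_in_words [simp]: "prefix_word n y \<in> words n"
  by (simp add: prefix_word_def words_def)

lemma prefix_word_eq_iff: "prefix_word n y = prefix_word n x \<longleftrightarrow> (\<forall>i<n. y i = x i)"
  by (auto simp: prefix_word_def)

lemma prefix_word_eq_word: "prefix_word n y = w \<longleftrightarrow> length w = n \<and> (\<forall>i\<in>{0..<n}. y i = w ! i)"
  unfolding prefix_word_def list_eq_iff_nth_eq by auto

lemma prefix_word_exists: "w \<in> words n \<Longrightarrow> \<exists>x. prefix_word n x = w"
  by (intro exI[of _ "\<lambda>i. w ! i"]) (auto simp: prefix_word_def words_def map_nth)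

lemma space_seq_space [simp]: "space seq_space = UNIV"
  by (auto simp: seq_space_def space_PiM)

lemma sets_PiM_cylinder:
  assumes "{0..<n} \<subseteq> I" "countable I"
  shows "{y \<in> space (PiM I (\<lambda>_. count_space (UNIV::'a set))). prefix_word n y = w} \<in> sets (PiM I (\<lambda>_. count_space UNIV))"
proof -
  have "{y \<in> space (PiM I (\<lambda>_. count_space (UNIV::'a set))). prefix_word n y = w}
    = (if length w = n then {y \<in> space (PiM I (\<lambda>_. count_space UNIV)). \<forall>i\<in>{0..<n}. y i = w ! i} else {})"
    by (simp add: prefix_word_eq_word)
  also have "\<dots> \<in> sets (PiM I (\<lambda>_. count_space UNIV))"
    using assms by (auto intro!: sets.sets_Collect_finite_All)
  finally show ?thesis .
qed

lemma prefix_word_measurable_PiM: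
  assumes "{0..<n} \<subseteq> I" "countable I"
  shows "prefix_word n \<in> measurable (PiM I (\<lambda>_. count_space (UNIV :: 'a::finite set))) (count_space UNIV)"
  by (rule measurable_count_space_eq_countable[THEN iffD2])
     (use sets_PiM_cylinder[OF assms] in \<open>auto simp: vimage_def Int_def conj_commute\<close>)

lemma prefix_word_measurable [measurable]:
  "prefix_word n \<in> measurable seq_space (count_space (UNIV :: 'a::finite list set))"
  unfolding seq_space_def by (rule prefix_word_measurable_PiM) auto

section \<open>Measures with prescribed cylinder probabilities\<close>

definition consistent_weights :: "('a::finite list \<Rightarrow> real) \<Rightarrow> bool" where
  "consistent_weights p \<longleftrightarrow> p [] = 1 \<and> (\<forall>w. 0 \<le> p w) \<and> (\<forall>w. (\<Sum>a\<in>UNIV. p (w @ [a])) = p w)"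

text \<open>The ratios p (w @ [a]) / p w are transition probabilities given the letters so far, and
  the Ionescu-Tulcea theorem assembles them; the weights telescope back into
  \<open>p\<close>.\<close>

lemma sequence_measure_exists:
  fixes p :: "'a::finite list \<Rightarrow> real"
  assumes "consistent_weights p"
  shows "\<exists>Q. sets Q = sets seq_space \<and> prob_space Q \<and>
    (\<forall>n x. measure Q {y \<in> space seq_space. prefix_word n y = prefix_word n x} = p (prefix_word n x))"
proof -
  have p: "p [] = 1" "\<And>w. 0 \<le> p w" "\<And>w. (\<Sum>a\<in>UNIV. p (w @ [a])) = p w"
    using assms by (auto simp: consistent_weights_def)
  \<comment> \<open>After a word of weight zero the uniform law is a filler: nonnegativity and
    consistency force all extensions of such a word to have weight zero too.\<close>
  define f where "f w a = (if p w = 0 then 1 / real CARD('a) else p (w @ [a]) / p w)" for w a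
  have f0: "0 \<le> f w a" for w a using p(2) by (simp add: f_def)
  have f1: "(\<Sum>a\<in>UNIV. f w a) = 1" for w
    using p(3) by (cases "p w = 0") (simp_all add: f_def sum_divide_distrib[symmetric])
  define k where "k w = embed_pmf (f w)" for w
  have k: "pmf (k w) a = f w a" for w a
    unfolding k_def
  proof (rule pmf_embed_pmf)
    show "(\<integral>\<^sup>+x. ennreal (f w x) \<partial>count_space UNIV) = 1"
      using f0 f1 by (simp add: nn_integral_count_space_finite)
  qed (rule f0)
  have pf: "p (w @ [a]) = p w * f w a" for w a
  proof (cases "p w = 0")
    case True
    then have "p (w @ [a]) = 0" using p(2,3) sum_nonneg_eq_0_iff[of UNIV "\<lambda>a. p (w @ [a])"] by auto
    then show ?thesis using True by simp
  qed (simp add: f_def)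
  let ?M = "\<lambda>i::nat. count_space (UNIV :: 'a set)"
  define K where "K i x = measure_pmf (k (prefix_word i x))" for i and x :: "nat \<Rightarrow> 'a"
  interpret IT: Ionescu_Tulcea K ?M
  proof (rule Ionescu_Tulcea.intro)
    fix i
    have "(\<lambda>w. measure_pmf (k w)) \<in> measurable (count_space UNIV) (subprob_algebra (count_space UNIV))"
      by (simp add: measure_pmf_in_subprob_algebra)
    from measurable_compose[OF prefix_word_measurable_PiM[of i "{0..<i}"] this]
    show "K i \<in> measurable (PiM {0..<i} ?M) (subprob_algebra (?M i))"
      by (simp add: K_def[abs_def])
  qed (unfold K_def, rule prob_space_measure_pmf)
  \<comment> \<open>The only point of the empty product, from which the construction starts.
    Finite-horizon laws live on functions that are \<open>undefined\<close> outside {0..<n}, so a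
    cylinder becomes a singleton there.\<close>
  let ?u = "\<lambda>_::nat. undefined :: 'a"
  have u: "?u \<in> space (PiM {0..<0} ?M)" by (simp add: space_PiM)
  have singleton: "{restrict x {0..<n}} \<in> sets (PiM {0..<n} ?M)" for n and x :: "nat \<Rightarrow> 'a"
  proof -
    have "{restrict x {0..<n}} = {y \<in> space (PiM {0..<n} ?M). prefix_word n y = prefix_word n x}"
      by (auto simp: prefix_word_eq_iff space_PiM PiE_def extensional_def restrict_def fun_eq_iff)
    then show ?thesis using sets_PiM_cylinder[of n "{0..<n}"] by auto
  qed
  have C: "emeasure (IT.C 0 n ?u) {restrict x {0..<n}} = ennreal (p (prefix_word n x))" for n x
  proof (induction n)
    case 0
    have "restrict x {0..<0} = ?u" by auto
    then show ?case using singleton[of x 0] by (simp add: prefix_word_def p emeasure_return)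
  next
    case (Suc n)
    have eP: "emeasure (IT.eP n y) {restrict x {0..<Suc n}}
        = ennreal (f (prefix_word n x) (x n)) * indicator {restrict x {0..<n}} y"
      if y: "y \<in> space (PiM {0..<n} ?M)" for y
    proof -
      have "emeasure (IT.eP n y) {restrict x {0..<Suc n}}
          = emeasure (K n y) ((\<lambda>a. y(n := a)) -` {restrict x {0..<Suc n}})"
        using IT.emeasure_eP[OF y singleton] by simp
      also have "\<dots> = ennreal (f (prefix_word n x) (x n)) * indicator {restrict x {0..<n}} y"
      proof (cases "y = restrict x {0..<n}")
        case True
        have "y(n := a) = restrict x {0..<Suc n} \<longleftrightarrow> a = x n" for a
        proof
          assume "y(n := a) = restrict x {0..<Suc n}"
          from fun_cong[OF this, of n] show "a = x n" by simp
        qed (auto simp: True fun_eq_iff)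
        then have "(\<lambda>a. y(n := a)) -` {restrict x {0..<Suc n}} = {x n}" by auto
        moreover have "prefix_word n y = prefix_word n x" using True by (simp add: prefix_word_eq_iff)
        ultimately show ?thesis using True by (simp add: K_def emeasure_pmf_single k)
      next
        case False
        then obtain i where i: "y i \<noteq> restrict x {0..<n} i" by (metis ext)
        then have "i < n" using y by (auto simp: space_PiM PiE_def extensional_def split: if_splits)
        then have "(\<lambda>a. y(n := a)) -` {restrict x {0..<Suc n}} = {}"
          using i by (auto dest!: fun_cong[of _ _ i])
        then show ?thesis using False by simp
      qed
      finally show ?thesis .
    qed
    have "emeasure (IT.C 0 (Suc n) ?u) {restrict x {0..<Suc n}}
        = (\<integral>\<^sup>+y. emeasure (IT.eP n y) {restrict x {0..<Suc n}} \<partial>IT.C 0 n ?u)"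
    proof -
      have "space (IT.C 0 n ?u) \<noteq> {}"
        using IT.prob_space_C[OF u] by (rule prob_space.not_empty)
      moreover have "IT.eP n \<in> measurable (IT.C 0 n ?u) (subprob_algebra (PiM {0..<Suc n} ?M))"
        by (subst measurable_cong_sets[OF IT.sets_C[OF u, of n] refl]) (simp only: add_0 IT.measurable_eP)
      ultimately show ?thesis using singleton[where n="Suc n"] by (simp add: emeasure_bind)
    qed
    also have "\<dots> = (\<integral>\<^sup>+y. ennreal (f (prefix_word n x) (x n)) * indicator {restrict x {0..<n}} y \<partial>IT.C 0 n ?u)"
      using IT.space_C[OF u, of n] by (intro nn_integral_cong eP) simp
    also have "\<dots> = ennreal (f (prefix_word n x) (x n)) * ennreal (p (prefix_word n x))"
      using singleton[of x n] IT.sets_C[OF u, of n]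
      by (subst nn_integral_cmult_indicator) (simp_all only: Suc add_0)
    also have "\<dots> = ennreal (p (prefix_word (Suc n) x))"
      by (simp add: prefix_word_Suc pf ennreal_mult[symmetric] f0 p mult.commute)
    finally show ?case .
  qed
  have L: "emeasure IT.PF.lim {y. prefix_word n y = prefix_word n x} = ennreal (p (prefix_word n x))" for n x
  proof -
    have "{y. prefix_word n y = prefix_word n x} = prod_emb UNIV ?M {0..<n} {restrict x {0..<n}}"
      by (simp add: set_eq_iff prod_emb_def prefix_word_eq_iff fun_eq_iff)
    then have "emeasure IT.PF.lim {y. prefix_word n y = prefix_word n x}
       = emeasure (IT.C 0 n ?u) (prod_emb {0..<n} ?M {0..<n} {restrict x {0..<n}})"
      using IT.lim[of "{0..<n}"] IT.emeasure_CI[of "{0..<n}" n] singleton[of x n] by simp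
    also have "prod_emb {0..<n} ?M {0..<n} {restrict x {0..<n}} = {restrict x {0..<n}}"
      by (rule prod_emb_id) (auto simp: PiE_def)
    finally show ?thesis using C by simp
  qed
  then have "measure IT.PF.lim {y \<in> space seq_space. prefix_word n y = prefix_word n x} = p (prefix_word n x)" for n x
    using p(2) by (simp add: measure_def)
  moreover have "sets IT.PF.lim = sets seq_space" by (simp add: seq_space_def)
  moreover have "prob_space IT.PF.lim" 
    using L[of 0] by (intro prob_spaceI) (simp add: prefix_word_def p space_PiM)
  ultimately show ?thesis by blast
qed

text \<open>A generator restricts finitely many coordinates, hence is a condition on a long enough
  prefix. Uniqueness and measurability of sequence measures thus reduce to finite sums over
  words.\<close>

lemma prod_algebra_prefix:
  assumes "A \<in> prod_algebra UNIV (\<lambda>_::nat. count_space (UNIV :: 'a::finite set))"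
  obtains n W where "A = {y. prefix_word n y \<in> W}"
proof -
  obtain J E where JE: "A = prod_emb UNIV (\<lambda>_. count_space UNIV) J (Pi\<^sub>E J E)" "finite J"
    using assms by (auto elim!: prod_algebraE)
  then obtain n where n: "\<forall>j\<in>J. j < n" using finite_nat_set_iff_bounded by blast
  have "A = {y. \<forall>j\<in>J. y j \<in> E j}"
    unfolding JE(1) by (auto simp: prod_emb_def PiE_iff extensional_def)
  also have "\<dots> = {y. prefix_word n y \<in> {w. \<forall>j\<in>J. w ! j \<in> E j}}"
    using n by (auto simp: prefix_word_def)
  finally show ?thesis by (rule that)
qed

lemma emeasure_prefix_word:
  fixes W :: "'a::finite list set"
  assumes Q: "sets Q = sets seq_space"
  shows "emeasure Q {y. prefix_word n y \<in> W} = (\<Sum>w\<in>W \<inter> words n. emeasure Q {y. prefix_word n y = w})"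
proof -
  have pm: "prefix_word n \<in> measurable Q (count_space (UNIV :: 'a list set))"
    using prefix_word_measurable measurable_cong_sets[OF Q refl] by blast
  have sp: "space Q = UNIV" using sets_eq_imp_space_eq[OF Q] by simp
  have "(\<Sum>w\<in>W \<inter> words n. emeasure Q {y. prefix_word n y = w})
     = emeasure Q (\<Union>w\<in>W \<inter> words n. {y. prefix_word n y = w})"
  proof (rule sum_emeasure)
    show "(\<lambda>w. {y. prefix_word n y = w}) ` (W \<inter> words n) \<subseteq> sets Q"
      using measurable_sets[OF pm, of "{_}"] sp by (auto simp: vimage_def)
  qed (auto simp: disjoint_family_on_def)
  also have "(\<Union>w\<in>W \<inter> words n. {y. prefix_word n y = w}) = {y. prefix_word n y \<in> W}"
    by auto
  finally show ?thesis ..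
qed

lemma sequence_measure_eqI:
  fixes Q Q' :: "(nat \<Rightarrow> 'a::finite) measure"
  assumes Q: "sets Q = sets seq_space" "prob_space Q" and Q': "sets Q' = sets seq_space" "prob_space Q'"
    and eq: "\<And>n x. measure Q {y. prefix_word n y = prefix_word n x} = measure Q' {y. prefix_word n y = prefix_word n x}"
  shows "Q = Q'"
proof (rule measure_eqI_generator_eq)
  interpret Q: prob_space Q by fact
  interpret Q': prob_space Q' by fact
  let ?E = "prod_algebra UNIV (\<lambda>_::nat. count_space (UNIV :: 'a set))"
  show "Int_stable ?E" by (rule Int_stable_prod_algebra)
  show "?E \<subseteq> Pow UNIV" by simp
  show "sets Q = sigma_sets UNIV ?E" "sets Q' = sigma_sets UNIV ?E"
    using Q Q' by (simp_all add: seq_space_def sets_PiM)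
  fix A assume "A \<in> ?E"
  then obtain n W where A: "A = {y. prefix_word n y \<in> W}" by (rule prod_algebra_prefix)
  have "emeasure Q {y. prefix_word n y = w} = emeasure Q' {y. prefix_word n y = w}" if "w \<in> words n" for w
    using prefix_word_exists[OF that] eq[of n] by (auto simp: Q.emeasure_eq_measure Q'.emeasure_eq_measure)
  then show "emeasure Q A = emeasure Q' A"
    unfolding A emeasure_prefix_word[OF Q(1)] emeasure_prefix_word[OF Q'(1)] by (intro sum.cong) auto
next
  interpret Q: prob_space Q by fact
  show "range (\<lambda>_::nat. UNIV) \<subseteq> prod_algebra UNIV (\<lambda>_::nat. count_space (UNIV :: 'a set))"
    using prod_algebraI[of "{0}" UNIV "\<lambda>_. UNIV" "\<lambda>_. count_space (UNIV::'a set)"]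
    by (auto simp: prod_emb_def vimage_def restrict_PiE_iff)
  show "emeasure Q UNIV \<noteq> \<infinity>" using Q.emeasure_finite by simp
qed auto

lemma sequence_kernel_measurable:
  fixes K :: "'s \<Rightarrow> (nat \<Rightarrow> 'a::finite) measure"
  assumes K: "\<And>\<omega>. \<omega> \<in> space M \<Longrightarrow> prob_space (K \<omega>)" "\<And>\<omega>. \<omega> \<in> space M \<Longrightarrow> sets (K \<omega>) = sets seq_space"
    and meas: "\<And>n x. (\<lambda>\<omega>. measure (K \<omega>) {y. prefix_word n y = prefix_word n x}) \<in> borel_measurable M"
  shows "K \<in> measurable M (prob_algebra seq_space)"
proof (rule measurable_prob_algebra_generated)
  let ?E = "prod_algebra UNIV (\<lambda>_::nat. count_space (UNIV :: 'a set))"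
  show "sets seq_space = sigma_sets UNIV ?E" by (simp add: seq_space_def sets_PiM)
  show "Int_stable ?E" by (rule Int_stable_prod_algebra)
  fix A assume "A \<in> ?E"
  then obtain n W where A: "A = {y. prefix_word n y \<in> W}" by (rule prod_algebra_prefix)
  have m: "(\<lambda>\<omega>. ennreal (measure (K \<omega>) {y. prefix_word n y = w})) \<in> borel_measurable M" if "w \<in> words n" for w
    using prefix_word_exists[OF that] meas[of n] by auto
  have "emeasure (K \<omega>) A = (\<Sum>w\<in>W \<inter> words n. ennreal (measure (K \<omega>) {y. prefix_word n y = w}))"
    if "\<omega> \<in> space M" for \<omega>
  proof -
    interpret prob_space "K \<omega>" by (rule K(1)[OF that])
    show ?thesis unfolding A emeasure_prefix_word[OF K(2)[OF that]] by (simp add: emeasure_eq_measure)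
  qed
  then show "(\<lambda>\<omega>. emeasure (K \<omega>) A) \<in> borel_measurable M"
    by (subst measurable_cong) (use m in auto)
qed (use K in auto)

section \<open>Words of instruments and the quenched law\<close>

text \<open>The composition of \<open>Tword\<close>, but recursing on the first letter while the
  environment moves along. In this form words can be cut and concatenated. The i-th letter, counted
  from one, reads the environment shifted i times.\<close>

fun Tlist :: "('a::finite \<Rightarrow> 's \<Rightarrow> 'd::finite cmat \<Rightarrow> 'd cmat) \<Rightarrow> ('s \<Rightarrow> 's) \<Rightarrow> 'a list \<Rightarrow> 's \<Rightarrow> 'd cmat \<Rightarrow> 'd cmat" where
  "Tlist T \<theta> [] \<omega> X = X"
| "Tlist T \<theta> (a # w) \<omega> X = Tlist T \<theta> w (\<theta> \<omega>) (T a (\<theta> \<omega>) X)"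

lemma Tlist_append: "Tlist T \<theta> (u @ w) \<omega> X = Tlist T \<theta> w ((\<theta> ^^ length u) \<omega>) (Tlist T \<theta> u \<omega> X)"
  by (induction u arbitrary: \<omega> X) (simp_all add: funpow_swap1)

lemma Tword_eq_Tlist: "Tword T \<theta> x n \<omega> X = Tlist T \<theta> (prefix_word n x) \<omega> X"
proof (induction n)
  case (Suc n)
  then show ?case by (simp add: prefix_word_Suc Tlist_append) (simp add: prefix_word_def)
qed (simp add: prefix_word_def)

lemma cscale_of_real: "cscale (of_real c) X = c *\<^sub>R X"
  by (simp add: vec_eq_iff cscale_def, simp add: scaleR_conv_of_real)

lemma clinear_map_scaleR: "clinear_map f \<Longrightarrow> f (c *\<^sub>R X) = c *\<^sub>R f X"
  unfolding clinear_map_def by (metis cscale_of_real)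

lemma clinear_map_add: "clinear_map f \<Longrightarrow> f (X + Y) = f X + f Y"
  by (simp add: clinear_map_def)

lemma clinear_map_zero: "clinear_map f \<Longrightarrow> f 0 = 0"
  using clinear_map_scaleR[of f 0 0] by simp

lemma clinear_map_diff: "clinear_map f \<Longrightarrow> f (X - Y) = f X - f Y"
  using clinear_map_add[of f "X - Y" Y] by (simp add: algebra_simps)

lemma clinear_map_sum: "clinear_map f \<Longrightarrow> f (\<Sum>i\<in>I. g i) = (\<Sum>i\<in>I. f (g i))"
  by (induction I rule: infinite_finite_induct) (simp_all add: clinear_map_zero clinear_map_add)

definition matrix_unit :: "'d::finite \<Rightarrow> 'd \<Rightarrow> 'd cmat" where
  "matrix_unit i j = (\<chi> p q. if p = i \<and> q = j then 1 else 0)"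

lemma matrix_unit_expansion: "X = (\<Sum>i\<in>UNIV. \<Sum>j\<in>UNIV. cscale (X$i$j) (matrix_unit i j))"
proof -
  have "(\<Sum>i\<in>UNIV. \<Sum>j\<in>UNIV. if p = i \<and> q = j then X $ i $ j else 0) = X $ p $ q" for p q
  proof -
    have "(\<Sum>j\<in>UNIV. if p = i \<and> q = j then X $ i $ j else 0) = (if p = i then X $ i $ q else 0)" for i
      by simp
    then show ?thesis by simp
  qed
  then show ?thesis
    by (simp add: vec_eq_iff cscale_def matrix_unit_def if_distrib[of "\<lambda>x. _ * x"] cong: if_cong)
qed

text \<open>Instruments are measurable only for a fixed argument. Expanding the random argument in
  matrix units leaves finitely many products of a measurable entry and a map at a fixed
  matrix.\<close>

lemma clinear_map_apply_measurable:
  fixes f :: "'s \<Rightarrow> 'd::finite cmat \<Rightarrow> 'd cmat"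
  assumes lin: "\<And>\<omega>. \<omega> \<in> space N \<Longrightarrow> clinear_map (f \<omega>)"
    and f: "\<And>X. (\<lambda>\<omega>. f \<omega> X) \<in> borel_measurable N" and \<rho>: "\<rho> \<in> borel_measurable N"
  shows "(\<lambda>\<omega>. f \<omega> (\<rho> \<omega>)) \<in> borel_measurable N"
proof -
  have sc: "(\<lambda>\<omega>. cscale (c \<omega>) (Y \<omega>)) \<in> borel_measurable N"
    if "c \<in> borel_measurable N" "Y \<in> borel_measurable N" for c and Y :: "'s \<Rightarrow> 'd cmat"
    by (rule borel_measurable_continuous_Pair[OF that]) (unfold cscale_def, intro continuous_intros)
  have entry: "(\<lambda>\<omega>. \<rho> \<omega> $ i $ j) \<in> borel_measurable N" for i j
    by (rule borel_measurable_continuous_on[OF _ \<rho>]) (intro continuous_intros)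
  have "f \<omega> (\<rho> \<omega>) = (\<Sum>i\<in>UNIV. \<Sum>j\<in>UNIV. cscale (\<rho> \<omega> $ i $ j) (f \<omega> (matrix_unit i j)))"
    if "\<omega> \<in> space N" for \<omega>
    using lin[OF that]
    by (subst matrix_unit_expansion[of "\<rho> \<omega>"]) (simp add: clinear_map_sum, simp add: clinear_map_def)
  then show ?thesis
    by (subst measurable_cong) (auto intro!: borel_measurable_sum sc entry f)
qed

lemma psd_preserving:
  assumes "completely_positive f" "psd X" shows "psd (f X)"
proof -
  have "block_psd 1 (\<lambda>i j. Y) \<longleftrightarrow> psd Y" for Y :: "'a cmat"
    unfolding block_psd_def psd_def by (auto dest: spec[of _ "\<lambda>_. _"])
  then show ?thesis using assms unfolding completely_positive_def by blast
qed

lemma completely_positive_clinear: "completely_positive f \<Longrightarrow> clinear_map f"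
  by (simp add: completely_positive_def)

lemma density_matrix_norm_le:
  fixes \<rho> :: "'d::finite cmat" assumes "density_matrix \<rho>" shows "norm \<rho> \<le> real CARD('d)"
  using psd_norm_le_trace[of \<rho>] assms by (simp add: density_matrix_def)

locale instrument_system = prob_space P for P :: "'s measure" +
  fixes T :: "'a::finite \<Rightarrow> 's \<Rightarrow> 'd::finite cmat \<Rightarrow> 'd cmat" and \<theta> :: "'s \<Rightarrow> 's"
  assumes instr: "random_instrument P T"
    and \<theta>_meas [measurable]: "\<theta> \<in> measurable P P"
    and pres: "distr P P \<theta> = P"
begin

lemma \<theta>_space: "\<omega> \<in> space P \<Longrightarrow> \<theta> \<omega> \<in> space P"
  using \<theta>_meas by (rule measurable_space)

lemma \<theta>n_meas [measurable]: "(\<theta> ^^ n) \<in> measurable P P"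
  by (induction n) (auto intro: measurable_comp)

lemma \<theta>n_space: "\<omega> \<in> space P \<Longrightarrow> (\<theta> ^^ n) \<omega> \<in> space P"
  using \<theta>n_meas by (rule measurable_space)

lemma distr_\<theta>n: "distr P P (\<theta> ^^ n) = P"
proof (induction n)
  case (Suc n)
  have "distr P P (\<theta> ^^ Suc n) = distr (distr P P (\<theta> ^^ n)) P \<theta>"
    by (subst distr_distr) (auto simp: comp_def)
  then show ?case by (simp only: Suc.IH pres)
qed (simp add: distr_id)

lemma integral_\<theta>n:
  fixes f :: "'s \<Rightarrow> real"
  assumes "f \<in> borel_measurable P" shows "(\<integral>\<omega>. f ((\<theta> ^^ n) \<omega>) \<partial>P) = (\<integral>\<omega>. f \<omega> \<partial>P)"
  using integral_distr[OF \<theta>n_meas assms, of n] by (simp add: distr_\<theta>n)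

lemma AE_\<theta>n: "AE \<omega> in P. Q \<omega> \<Longrightarrow> AE \<omega> in P. Q ((\<theta> ^^ n) \<omega>)"
  by (rule AE_distrD[OF \<theta>n_meas[of n]]) (unfold distr_\<theta>n)

lemma T_cp: "\<omega> \<in> space P \<Longrightarrow> completely_positive (T a \<omega>)"
  using instr by (simp add: random_instrument_def)

lemma T_meas [measurable]: "(\<lambda>\<omega>. T a \<omega> X) \<in> borel_measurable P"
  using instr by (simp add: random_instrument_def)

lemma Tlist_clinear: "\<omega> \<in> space P \<Longrightarrow> clinear_map (Tlist T \<theta> w \<omega>)"
proof (induction w arbitrary: \<omega>)
  case (Cons a w)
  then show ?case
    using Cons.IH[OF \<theta>_space[OF Cons.prems]] completely_positive_clinear[OF T_cp[OF \<theta>_space[OF Cons.prems], of a]]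
    by (simp add: clinear_map_def)
qed (simp add: clinear_map_def)

lemma Tlist_psd: "\<omega> \<in> space P \<Longrightarrow> psd X \<Longrightarrow> psd (Tlist T \<theta> w \<omega> X)"
proof (induction w arbitrary: \<omega> X)
  case (Cons a w)
  show ?case unfolding Tlist.simps
    by (rule Cons.IH[OF \<theta>_space[OF Cons.prems(1)] psd_preserving[OF T_cp[OF \<theta>_space[OF Cons.prems(1)]] Cons.prems(2)]])
qed simp

text \<open>Stated over an arbitrary \<open>N\<close>, since it is used also for the sigma-algebra
  generated by the instruments at selected times; only those instruments that the word reads are
  assumed measurable.\<close>

lemma Tlist_measurable_gen:
  fixes g :: "'t \<Rightarrow> 's"
  assumes g: "\<And>\<omega>. \<omega> \<in> space N \<Longrightarrow> g \<omega> \<in> space P"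
    and T: "\<And>i a X. 1 \<le> i \<Longrightarrow> i \<le> length w \<Longrightarrow> (\<lambda>\<omega>. T a ((\<theta> ^^ i) (g \<omega>)) X) \<in> borel_measurable N"
    and \<rho>: "\<rho> \<in> borel_measurable N"
  shows "(\<lambda>\<omega>. Tlist T \<theta> w (g \<omega>) (\<rho> \<omega>)) \<in> borel_measurable N"
  using g T \<rho>
proof (induction w arbitrary: g \<rho>)
  case (Cons a w)
  have "(\<lambda>\<omega>. T a (\<theta> (g \<omega>)) (\<rho> \<omega>)) \<in> borel_measurable N"
  proof (rule clinear_map_apply_measurable[where f = "\<lambda>\<omega>. T a (\<theta> (g \<omega>))"])
    show "(\<lambda>\<omega>. T a (\<theta> (g \<omega>)) X) \<in> borel_measurable N" for X
      using Cons.prems(2)[of 1 a X] by simp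
    show "clinear_map (T a (\<theta> (g \<omega>)))" if "\<omega> \<in> space N" for \<omega>
      using that by (intro completely_positive_clinear T_cp \<theta>_space Cons.prems(1))
  qed (rule Cons.prems(3))
  moreover have "(\<lambda>\<omega>. T b ((\<theta> ^^ i) (\<theta> (g \<omega>))) X) \<in> borel_measurable N" if "1 \<le> i" "i \<le> length w" for i b X
    using Cons.prems(2)[of "Suc i" b X] that by (simp add: funpow_swap1)
  ultimately show ?case
    unfolding Tlist.simps by (intro Cons.IH \<theta>_space Cons.prems(1))
qed simp

lemma Tlist_measurable:
  assumes "\<rho> \<in> borel_measurable P" "g \<in> measurable P P"
  shows "(\<lambda>\<omega>. Tlist T \<theta> w (g \<omega>) (\<rho> \<omega>)) \<in> borel_measurable P"
proof (rule Tlist_measurable_gen[OF _ _ assms(1)])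
  show "(\<lambda>\<omega>. T a ((\<theta> ^^ i) (g \<omega>)) X) \<in> borel_measurable P" for i a X
    by (rule measurable_compose[OF _ T_meas[of a X]], rule measurable_compose[OF assms(2) \<theta>n_meas])
qed (use assms(2) in \<open>auto dest: measurable_space\<close>)

lemma Phin_eq_sum: "\<omega> \<in> space P \<Longrightarrow> Phin T \<theta> n \<omega> X = (\<Sum>w\<in>words n. Tlist T \<theta> w \<omega> X)"
proof (induction n)
  case (Suc n)
  have lin: "clinear_map (T a ((\<theta> ^^ Suc n) \<omega>))" for a
    by (intro completely_positive_clinear T_cp \<theta>n_space Suc.prems)
  have "Phin T \<theta> (Suc n) \<omega> X = (\<Sum>a\<in>UNIV. \<Sum>w\<in>words n. T a ((\<theta> ^^ Suc n) \<omega>) (Tlist T \<theta> w \<omega> X))"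
    using Suc by (simp only: Phin.simps comp_apply Phi_def clinear_map_sum[OF lin])
  also have "\<dots> = (\<Sum>w\<in>words n. \<Sum>a\<in>UNIV. Tlist T \<theta> (w @ [a]) \<omega> X)"
    by (subst sum.swap) (auto simp: Tlist_append words_def intro!: sum.cong)
  finally show ?case by (simp only: sum_words_Suc)
qed simp

lemma Phin_measurable:
  assumes "\<rho> \<in> borel_measurable P" "g \<in> measurable P P"
  shows "(\<lambda>\<omega>. Phin T \<theta> n (g \<omega>) (\<rho> \<omega>)) \<in> borel_measurable P"
proof -
  have "(\<lambda>\<omega>. \<Sum>w\<in>words n. Tlist T \<theta> w (g \<omega>) (\<rho> \<omega>)) \<in> borel_measurable P"
    by (intro borel_measurable_sum Tlist_measurable assms)
  then show ?thesis
    by (subst measurable_cong) (use assms(2) in \<open>auto simp: Phin_eq_sum dest: measurable_space\<close>)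
qed

lemma Phin_psd: "\<omega> \<in> space P \<Longrightarrow> psd X \<Longrightarrow> psd (Phin T \<theta> n \<omega> X)"
  by (simp add: Phin_eq_sum psd_sum Tlist_psd)

lemma Phin_clinear: "\<omega> \<in> space P \<Longrightarrow> clinear_map (Phin T \<theta> n \<omega>)"
proof -
  assume \<omega>: "\<omega> \<in> space P"
  have "cscale c (sum f A) = (\<Sum>x\<in>A. cscale c (f x))" for c A and f :: "'a list \<Rightarrow> 'd cmat"
    by (induction A rule: infinite_finite_induct) (auto simp: cscale_def vec_eq_iff algebra_simps)
  then show ?thesis
    using Tlist_clinear[OF \<omega>] unfolding clinear_map_def by (simp add: Phin_eq_sum[OF \<omega>] sum.distrib)
qed

section \<open>Trace preservation along orbits and quenched expectations\<close>

text \<open>Almost sure trace preservation is required along the whole forward orbit at once, which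
  makes the event stable under \<theta>.\<close>

definition good :: "'s \<Rightarrow> bool" where
  "good \<omega> \<longleftrightarrow> \<omega> \<in> space P \<and> (\<forall>k. trace_preserving (\<lambda>X. \<Sum>a\<in>UNIV. T a ((\<theta> ^^ k) \<omega>) X))"

lemma AE_good: "AE \<omega> in P. good \<omega>"
proof -
  have "AE \<omega> in P. trace_preserving (\<lambda>X. \<Sum>a\<in>UNIV. T a \<omega> X)"
    using instr by (simp add: random_instrument_def)
  from AE_\<theta>n[OF this] have "AE \<omega> in P. \<forall>k. trace_preserving (\<lambda>X. \<Sum>a\<in>UNIV. T a ((\<theta> ^^ k) \<omega>) X)"
    by (subst AE_all_countable) auto
  then show ?thesis unfolding good_def by auto
qed

lemma good_space: "good \<omega> \<Longrightarrow> \<omega> \<in> space P"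
  by (simp add: good_def)

lemma good_\<theta>n: "good \<omega> \<Longrightarrow> good ((\<theta> ^^ n) \<omega>)"
  unfolding good_def using \<theta>n_space by (metis comp_apply funpow_add)

lemma good_trace_snoc:
  assumes "good \<omega>"
  shows "(\<Sum>a\<in>UNIV. trace (Tlist T \<theta> (w @ [a]) \<omega> X)) = trace (Tlist T \<theta> w \<omega> X)"
proof -
  have "trace_preserving (\<lambda>X. \<Sum>a\<in>UNIV. T a ((\<theta> ^^ Suc (length w)) \<omega>) X)"
    using assms unfolding good_def by blast
  then show ?thesis by (simp add: trace_preserving_def trace_sum Tlist_append)
qed

lemma good_trace_words: "good \<omega> \<Longrightarrow> (\<Sum>w\<in>words n. trace (Tlist T \<theta> w \<omega> X)) = trace X"
  by (induction n) (simp_all add: sum_words_Suc good_trace_snoc)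

lemma good_trace_Phin: "good \<omega> \<Longrightarrow> trace (Phin T \<theta> n \<omega> X) = trace X"
  by (simp add: Phin_eq_sum good_space trace_sum good_trace_words)

text \<open>For a density matrix \<open>X\<close> and a good environment this is the quenched
  expectation of \<open>g\<close> of the first \<open>n\<close> outcomes. The formula is linear in
  \<open>X\<close> and is used also for unnormalised states and for differences of states.\<close>

definition wexp :: "nat \<Rightarrow> ('a list \<Rightarrow> real) \<Rightarrow> 's \<Rightarrow> 'd cmat \<Rightarrow> real" where
  "wexp n g \<omega> X = (\<Sum>w\<in>words n. g w * Re (trace (Tlist T \<theta> w \<omega> X)))"

lemma wexp_add: "\<omega> \<in> space P \<Longrightarrow> wexp n g \<omega> (X + Y) = wexp n g \<omega> X + wexp n g \<omega> Y"
  by (simp add: wexp_def clinear_map_add[OF Tlist_clinear] trace_add sum.distrib algebra_simps)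

lemma wexp_diff: "\<omega> \<in> space P \<Longrightarrow> wexp n g \<omega> (X - Y) = wexp n g \<omega> X - wexp n g \<omega> Y"
  by (simp add: wexp_def clinear_map_diff[OF Tlist_clinear] trace_sub sum_subtractf algebra_simps)

lemma wexp_scaleR: "\<omega> \<in> space P \<Longrightarrow> wexp n g \<omega> (c *\<^sub>R X) = c * wexp n g \<omega> X"
  by (simp add: wexp_def clinear_map_scaleR[OF Tlist_clinear] trace_scaleR sum_distrib_left mult_ac)

lemma wexp_sum: "\<omega> \<in> space P \<Longrightarrow> wexp n g \<omega> (\<Sum>i\<in>I. f i) = (\<Sum>i\<in>I. wexp n g \<omega> (f i))"
proof (induction I rule: infinite_finite_induct)
  case empty then show ?case using wexp_scaleR[of \<omega> n g 0 0] by simp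
next
  case (infinite A) then show ?case using wexp_scaleR[of \<omega> n g 0 0] by simp
qed (simp add: wexp_add)

lemma wexp_psd_bound:
  assumes "good \<omega>" "psd X" "\<And>w. \<bar>g w\<bar> \<le> 1"
  shows "\<bar>wexp n g \<omega> X\<bar> \<le> Re (trace X)"
proof -
  have tr: "0 \<le> Re (trace (Tlist T \<theta> w \<omega> X))" for w
    using assms by (intro psd_trace Tlist_psd good_space)
  have "\<bar>wexp n g \<omega> X\<bar> \<le> (\<Sum>w\<in>words n. 1 * Re (trace (Tlist T \<theta> w \<omega> X)))"
    unfolding wexp_def
  proof (rule order_trans[OF sum_abs], rule sum_mono)
    show "\<bar>g w * Re (trace (Tlist T \<theta> w \<omega> X))\<bar> \<le> 1 * Re (trace (Tlist T \<theta> w \<omega> X))" for w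
      using mult_right_mono[OF assms(3) tr] by (simp add: abs_mult tr)
  qed
  also have "\<dots> = Re (trace X)" using good_trace_words[OF assms(1), where n=n and X=X] by (simp flip: Re_sum)
  finally show ?thesis .
qed

lemma wexp_nonneg:
  assumes "\<omega> \<in> space P" "psd X" "\<And>w. 0 \<le> g w" shows "0 \<le> wexp n g \<omega> X"
  unfolding wexp_def using assms by (intro sum_nonneg mult_nonneg_nonneg psd_trace Tlist_psd)

text \<open>Write X = (c 1 + X) - c 1 with c the norm of \<open>X\<close>. Each of the two positive
  parts contributes its trace, where c 1 has trace c CARD('d) and \<open>X\<close> at most that;
  this gives the factor 3.\<close>

lemma wexp_hermitian_bound:
  assumes \<omega>: "good \<omega>" and X: "adj X = X" and g: "\<And>w. \<bar>g w\<bar> \<le> 1"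
  shows "\<bar>wexp n g \<omega> X\<bar> \<le> 3 * real CARD('d) * norm X"
proof -
  define I where "I = norm X *\<^sub>R (mat 1 :: 'd cmat)"
  have I: "psd I" "Re (trace I) = real CARD('d) * norm X"
    by (auto simp: I_def psd_scaleR trace_scaleR trace_I)
  have XI: "psd (I + X)" unfolding I_def by (rule hermitian_add_norm_psd[OF X order_refl])
  have "wexp n g \<omega> X = wexp n g \<omega> (I + X) - wexp n g \<omega> I"
    by (simp add: wexp_add good_space \<omega>)
  moreover have "\<bar>wexp n g \<omega> (I + X)\<bar> \<le> Re (trace I) + Re (trace X)"
    using wexp_psd_bound[OF \<omega> XI g] by (simp add: trace_add)
  moreover have "\<bar>wexp n g \<omega> I\<bar> \<le> Re (trace I)" by (rule wexp_psd_bound[OF \<omega> I(1) g])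
  moreover have "Re (trace X) \<le> real CARD('d) * norm X"
    using trace_le_norm[of X] complex_Re_le_cmod[of "trace X"] by linarith
  ultimately show ?thesis using I(2) by linarith
qed

text \<open>Markov property: after the letters \<open>u\<close> the rest is governed by the shifted
  environment and the unnormalised state, whose trace carries the probability of
  \<open>u\<close>.\<close>

lemma wexp_split:
  "wexp (n + k) (\<lambda>w. f (take n w) * g (drop n w)) \<omega> X
    = (\<Sum>u\<in>words n. f u * wexp k g ((\<theta> ^^ n) \<omega>) (Tlist T \<theta> u \<omega> X))"
  unfolding wexp_def sum_words_add
  by (intro sum.cong) (auto simp: words_def Tlist_append sum_distrib_left mult_ac)

lemma wexp_measurable:
  assumes "\<rho> \<in> borel_measurable P" "h \<in> measurable P P"
  shows "(\<lambda>\<omega>. wexp n g (h \<omega>) (\<rho> \<omega>)) \<in> borel_measurable P"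
  unfolding wexp_def
proof (intro borel_measurable_sum borel_measurable_times borel_measurable_const)
  fix w show "(\<lambda>\<omega>. Re (trace (Tlist T \<theta> w (h \<omega>) (\<rho> \<omega>)))) \<in> borel_measurable P"
    by (rule borel_measurable_continuous_on[OF _ Tlist_measurable[OF assms]]) (intro continuous_intros)
qed

lemma random_state_measurable: "random_state P \<psi> \<Longrightarrow> \<psi> \<in> borel_measurable P"
  by (simp add: random_state_def)

text \<open>For a good environment the traces are consistent weights. Existence by extension and
  uniqueness on prefixes then make the \<open>THE\<close> in \<open>quenched\<close>
  meaningful.\<close>

lemma quenched_good:
  assumes "good \<omega>" "density_matrix \<rho>"
  shows "sets (quenched T \<theta> \<rho> \<omega>) = sets seq_space" "prob_space (quenched T \<theta> \<rho> \<omega>)"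
    "measure (quenched T \<theta> \<rho> \<omega>) {y. prefix_word n y = prefix_word n x} = Re (trace (Tlist T \<theta> (prefix_word n x) \<omega> \<rho>))"
proof -
  have \<rho>: "psd \<rho>" "trace \<rho> = 1" using assms(2) by (auto simp: density_matrix_def)
  define p where "p w = Re (trace (Tlist T \<theta> w \<omega> \<rho>))" for w
  have tr: "trace (Tlist T \<theta> w \<omega> \<rho>) = of_real (p w)" for w
    using psd_trace[OF Tlist_psd[OF good_space[OF assms(1)] \<rho>(1)], of w] by (simp add: p_def complex_eq_iff)
  have "consistent_weights p"
    unfolding consistent_weights_def
  proof (intro conjI allI)
    show "0 \<le> p w" for w unfolding p_def by (intro psd_trace Tlist_psd good_space assms \<rho>)
    show "(\<Sum>a\<in>UNIV. p (w @ [a])) = p w" for w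
      using good_trace_snoc[OF assms(1), of w \<rho>] by (simp add: p_def flip: Re_sum)
  qed (simp add: p_def \<rho>)
  then obtain Q where Q: "sets Q = sets seq_space" "prob_space Q"
    "\<And>n x. measure Q {y \<in> space seq_space. prefix_word n y = prefix_word n x} = p (prefix_word n x)"
    using sequence_measure_exists by blast
  let ?C = "\<lambda>Q. sets Q = sets seq_space \<and> prob_space Q \<and>
      (\<forall>n x. complex_of_real (measure Q {y \<in> space seq_space. \<forall>i<n. y i = x i}) = trace (Tword T \<theta> x n \<omega> \<rho>))"
  have C: "?C Q' \<longleftrightarrow> sets Q' = sets seq_space \<and> prob_space Q' \<and>
      (\<forall>n x. measure Q' {y. prefix_word n y = prefix_word n x} = p (prefix_word n x))" for Q'
    by (simp add: Tword_eq_Tlist tr prefix_word_eq_iff)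
  have "?C (quenched T \<theta> \<rho> \<omega>)"
    unfolding quenched_def
  proof (rule theI)
    show "?C Q" unfolding C using Q by simp
    show "Q' = Q" if "?C Q'" for Q'
      using that Q unfolding C by (intro sequence_measure_eqI) auto
  qed
  then show "sets (quenched T \<theta> \<rho> \<omega>) = sets seq_space" "prob_space (quenched T \<theta> \<rho> \<omega>)"
    "measure (quenched T \<theta> \<rho> \<omega>) {y. prefix_word n y = prefix_word n x} = Re (trace (Tlist T \<theta> (prefix_word n x) \<omega> \<rho>))"
    unfolding C p_def by auto
qed

end

section \<open>A central limit theorem for weakly dependent bounded variables\<close>

lemma cesaro_mean:
  fixes g :: "nat \<Rightarrow> real"
  assumes "g \<longlonglongrightarrow> L" shows "(\<lambda>n. (\<Sum>k<n. g k) / real n) \<longlonglongrightarrow> L"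
proof (rule LIMSEQ_I)
  fix e :: real assume e: "0 < e"
  obtain N where N: "\<And>n. n \<ge> N \<Longrightarrow> \<bar>g n - L\<bar> < e/2"
    using LIMSEQ_D[OF assms, of "e/2"] e by auto
  define C where "C = (\<Sum>k<N. \<bar>g k - L\<bar>)"
  have C: "C \<ge> 0" by (simp add: C_def sum_nonneg)
  obtain K where K: "real K > 2 * C / e" using reals_Archimedean2 by blast
  show "\<exists>no. \<forall>n\<ge>no. norm ((\<Sum>k<n. g k) / real n - L) < e"
  proof (intro exI allI impI)
    fix n assume n: "n \<ge> max (Suc N) K"
    then have n0: "real n > 0" by simp
    have "\<bar>(\<Sum>k<n. g k) - real n * L\<bar> = \<bar>\<Sum>k<n. g k - L\<bar>" by (simp add: sum_subtractf)
    also have "\<dots> \<le> (\<Sum>k<n. \<bar>g k - L\<bar>)" by (rule sum_abs)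
    also have "\<dots> = C + (\<Sum>k\<in>{N..<n}. \<bar>g k - L\<bar>)"
      using n unfolding C_def lessThan_atLeast0 by (simp add: sum.atLeastLessThan_concat)
    also have "(\<Sum>k\<in>{N..<n}. \<bar>g k - L\<bar>) \<le> (\<Sum>k\<in>{N..<n}. e/2)"
      using N by (intro sum_mono) (auto intro: less_imp_le)
    also have "\<dots> \<le> real n * (e/2)" using e by (simp add: mult_right_mono)
    also have "C < real n * (e/2)"
    proof -
      have "2 * C / e < real n" using K n by linarith
      then show ?thesis using e by (simp add: field_simps)
    qed
    finally have "\<bar>(\<Sum>k<n. g k) - real n * L\<bar> < e * real n" by (simp add: field_simps)
    moreover have "(\<Sum>k<n. g k) / real n - L = ((\<Sum>k<n. g k) - real n * L) / real n"
      using n0 by (simp add: field_simps)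
    ultimately show "norm ((\<Sum>k<n. g k) / real n - L) < e"
      using n0 by (simp add: abs_divide pos_divide_less_eq)
  qed
qed

lemma char_gauss_law:
  assumes "0 \<le> v" shows "char (gauss_law v) t = of_real (exp (- (t\<^sup>2 * v / 2)))"
proof (cases "v = 0")
  case True
  then show ?thesis by (simp add: gauss_law_def char_def integral_return)
next
  case False
  then have v: "v > 0" using assms by simp
  interpret N: prob_space std_normal_distribution
    using real_dist_normal_dist by (rule real_distribution.axioms)
  have "distributed std_normal_distribution lborel (\<lambda>x. x) std_normal_density"
    unfolding distributed_def by (auto intro!: measure_eqI simp: emeasure_distr emeasure_density)
  then have "distributed std_normal_distribution lborel (\<lambda>x. (sqrt v * x - 0) / sqrt v) std_normal_density"
    using v by simp
  then have "distributed std_normal_distribution lborel (\<lambda>x. sqrt v * x) (normal_density 0 (sqrt v))"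
    using v by (subst N.normal_standard_normal_convert) auto
  then have "gauss_law v = distr std_normal_distribution lborel (\<lambda>x. sqrt v * x)"
    using v by (auto simp: gauss_law_def dest: distributed_distr_eq_density)
  then have "char (gauss_law v) t = char std_normal_distribution (t * sqrt v)"
    unfolding char_def by (simp add: integral_distr mult_ac)
  then show ?thesis using v by (simp add: char_std_normal_distribution power_mult_distrib)
qed

lemma real_distribution_gauss_law: "0 \<le> v \<Longrightarrow> real_distribution (gauss_law v)"
proof (cases "v = 0")
  case False
  assume "0 \<le> v"
  then show ?thesis using False prob_space_normal_density[of "sqrt v" 0]
    by (auto simp: gauss_law_def real_distribution_def real_distribution_axioms_def)
qed (auto simp: gauss_law_def real_distribution_def real_distribution_axioms_def prob_space_return)

text \<open>Errors are added but never amplified because |q| is at most one. The first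
  \<open>N\<close> steps are given a weaker bound, since early indices have no room for a
  gap.\<close>

lemma linear_recursion_approx:
  fixes \<phi> :: "nat \<Rightarrow> complex" and q :: real
  assumes "\<bar>q\<bar> \<le> 1" "\<phi> 0 = 1" "0 \<le> e0" "0 \<le> e1"
    and crude: "\<And>k. cmod (\<phi> (Suc k) - q * \<phi> k) \<le> e0"
    and fine: "\<And>k. k \<ge> N \<Longrightarrow> cmod (\<phi> (Suc k) - q * \<phi> k) \<le> e1"
  shows "cmod (\<phi> n - of_real (q ^ n)) \<le> real N * e0 + real n * e1"
proof -
  have "cmod (\<phi> n - of_real (q ^ n)) \<le> (\<Sum>k<n. if k < N then e0 else e1)"
  proof (induction n)
    case (Suc n)
    have "\<phi> (Suc n) - of_real (q ^ Suc n) = (\<phi> (Suc n) - q * \<phi> n) + of_real q * (\<phi> n - of_real (q ^ n))"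
      by (simp add: algebra_simps)
    also have "cmod \<dots> \<le> cmod (\<phi> (Suc n) - q * \<phi> n) + \<bar>q\<bar> * cmod (\<phi> n - of_real (q ^ n))"
      by (metis norm_triangle_ineq norm_mult norm_of_real)
    also have "\<bar>q\<bar> * cmod (\<phi> n - of_real (q ^ n)) \<le> cmod (\<phi> n - of_real (q ^ n))"
      using assms(1) by (simp add: mult_left_le_one_le)
    finally show ?case using Suc crude[of n] fine[of n] by auto
  qed (simp add: assms)
  also have "\<dots> \<le> (\<Sum>k<n. (if k < N then e0 else 0) + e1)"
    using assms by (intro sum_mono) auto
  also have "\<dots> = (\<Sum>k\<in>{..<n} \<inter> {..<N}. e0) + real n * e1"
    by (simp add: sum.distrib sum.If_cases lessThan_def Int_def)
  also have "(\<Sum>k\<in>{..<n} \<inter> {..<N}. e0) \<le> real N * e0"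
    using assms(3) card_mono[of "{..<N}" "{..<n} \<inter> {..<N}"] by (simp add: mult_right_mono)
  finally show ?thesis by simp
qed

section \<open>Characteristic functions of sums of weakly dependent variables\<close>

text \<open>\<open>Fi p\<close> knows X 0, ..., X (p - 1), so \<open>n\<close> = 0 in the mixing
  assumptions refers to the very next variable. In \<open>mix2\<close> the bound is uniform in
  \<open>j\<close>: only the distance from \<open>F\<close> to the first of the two factors
  counts.\<close>

locale weakly_dependent = prob_space M for M :: "'z measure" +
  fixes X :: "nat \<Rightarrow> 'z \<Rightarrow> real" and Fi :: "nat \<Rightarrow> 'z measure" and a c :: "nat \<Rightarrow> real"
  assumes Fi_sub: "subalgebra M (Fi k)"
    and Fi_mono: "k \<le> l \<Longrightarrow> sets (Fi k) \<subseteq> sets (Fi l)"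
    and X_Fi: "X k \<in> borel_measurable (Fi (Suc k))"
    and X_bound: "\<bar>X k z\<bar> \<le> 1"
    and X_mean: "expectation (X k) = 0"
    and X_cov: "expectation (\<lambda>z. X k z * X (k + j) z) = c j"
    and a_summable: "summable a"
    and mix1: "F \<in> borel_measurable (Fi p) \<Longrightarrow> (\<And>z. \<bar>F z\<bar> \<le> 1) \<Longrightarrow>
      \<bar>expectation (\<lambda>z. F z * X (p + n) z)\<bar> \<le> a n"
    and mix2: "F \<in> borel_measurable (Fi p) \<Longrightarrow> (\<And>z. \<bar>F z\<bar> \<le> 1) \<Longrightarrow>
      \<bar>expectation (\<lambda>z. F z * (X (p + n) z * X (p + n + j) z)) - expectation F * c j\<bar> \<le> a n"
begin

lemma Fi_meas: "f \<in> measurable (Fi p) N \<Longrightarrow> f \<in> measurable M N"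
  using measurable_from_subalg[OF Fi_sub] .

lemma Fi_meas_mono: "f \<in> measurable (Fi p) N \<Longrightarrow> p \<le> q \<Longrightarrow> f \<in> measurable (Fi q) N"
  by (rule measurable_from_subalg[of "Fi q" "Fi p"])
     (use Fi_mono Fi_sub in \<open>auto simp: subalgebra_def\<close>)

lemma X_meas [measurable]: "X k \<in> borel_measurable M"
  by (rule Fi_meas[OF X_Fi])

lemma X_prod_bound: "\<bar>X i z * X j z\<bar> \<le> 1"
  unfolding abs_mult by (intro mult_le_one X_bound) auto

lemma integrable_bdd:
  fixes f :: "'z \<Rightarrow> 'e::{banach, second_countable_topology}"
  assumes "f \<in> borel_measurable M" "\<And>z. norm (f z) \<le> B"
  shows "integrable M f"
  using assms by (intro integrable_const_bound[of _ B]) auto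

lemma norm_expectation_le:
  fixes f :: "'z \<Rightarrow> 'e::{banach, second_countable_topology}"
  assumes "f \<in> borel_measurable M" "\<And>z. norm (f z) \<le> B"
  shows "norm (expectation f) \<le> B"
proof -
  have "norm (expectation f) \<le> expectation (\<lambda>z. norm (f z))" by simp
  also have "\<dots> \<le> expectation (\<lambda>z. B)"
    using assms by (intro integral_mono integrable_norm integrable_bdd[of f B]) auto
  finally show ?thesis by (simp add: prob_space)
qed

lemma c_bound: "\<bar>c j\<bar> \<le> 1"
proof -
  have "norm (expectation (\<lambda>z. X 0 z * X (0 + j) z)) \<le> 1"
    by (rule norm_expectation_le) (auto simp: abs_mult intro!: mult_le_one X_bound)
  then show ?thesis unfolding X_cov by simp
qed

lemma c_decay: "\<bar>c (Suc n)\<bar> \<le> a n"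
proof -
  \<comment> \<open>\<open>X 0\<close> belongs to \<open>Fi 1\<close>, hence lag
    \<open>Suc n\<close> is a gap of only \<open>n\<close>.\<close>
  have "\<bar>expectation (\<lambda>z. X 0 z * X (1 + n) z)\<bar> \<le> a n"
    using X_Fi[of 0] by (intro mix1) (auto simp: X_bound)
  then show ?thesis using X_cov[of 0 "Suc n"] by simp
qed

lemma c_summable: "summable (\<lambda>k. \<bar>c (Suc k)\<bar>)"
  by (rule summable_comparison_test'[OF a_summable, of 0]) (simp add: c_decay)

definition \<sigma>2 :: real where "\<sigma>2 = c 0 + 2 * (\<Sum>k. c (Suc k))"

text \<open>Real and imaginary parts are treated separately, after scaling by the bound
  \<open>B\<close>; this is the factor 2.\<close>

lemma complex_mix:
  fixes F :: "'z \<Rightarrow> complex"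
  assumes mix: "\<And>F. F \<in> borel_measurable (Fi p) \<Longrightarrow> (\<And>z. \<bar>F z\<bar> \<le> 1) \<Longrightarrow>
      \<bar>expectation (\<lambda>z. F z * W z) - expectation F * w\<bar> \<le> e"
    and W: "W \<in> borel_measurable M" "\<And>z. \<bar>W z\<bar> \<le> 1"
    and F: "F \<in> borel_measurable (Fi p)" "\<And>z. cmod (F z) \<le> B" and B: "B > 0"
  shows "cmod (expectation (\<lambda>z. F z * of_real (W z)) - expectation F * of_real w) \<le> 2 * B * e"
proof -
  note Fm = Fi_meas[OF F(1)]
  have iF: "integrable M F" using Fm F(2) by (rule integrable_bdd)
  have iFW: "integrable M (\<lambda>z. F z * of_real (W z))"
  proof (rule integrable_bdd)
    show "cmod (F z * of_real (W z)) \<le> B * 1" for z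
      unfolding norm_mult norm_of_real using F(2) W(2) B by (intro mult_mono) auto
  qed (use Fm W in measurable)
  have part: "\<bar>expectation (\<lambda>z. G z * W z) - expectation G * w\<bar> \<le> B * e"
    if G: "G \<in> borel_measurable (Fi p)" "\<And>z. \<bar>G z\<bar> \<le> B" for G
  proof -
    have "\<bar>expectation (\<lambda>z. G z / B * W z) - expectation (\<lambda>z. G z / B) * w\<bar> \<le> e"
      using G B by (intro mix) (auto simp: abs_divide)
    also have "expectation (\<lambda>z. G z / B * W z) - expectation (\<lambda>z. G z / B) * w
        = (expectation (\<lambda>z. G z * W z) - expectation G * w) / B"
      using B by (simp add: field_simps)
    finally show ?thesis using B by (simp add: abs_divide field_simps)
  qed
  have "\<bar>Re (expectation (\<lambda>z. F z * of_real (W z)) - expectation F * of_real w)\<bar> \<le> B * e"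
    using part[of "\<lambda>z. Re (F z)"] F order_trans[OF abs_Re_le_cmod F(2)]
    by (simp add: integral_Re[OF iF, symmetric] integral_Re[OF iFW, symmetric])
  moreover have "\<bar>Im (expectation (\<lambda>z. F z * of_real (W z)) - expectation F * of_real w)\<bar> \<le> B * e"
    using part[of "\<lambda>z. Im (F z)"] F order_trans[OF abs_Im_le_cmod F(2)]
    by (simp add: integral_Im[OF iF, symmetric] integral_Im[OF iFW, symmetric])
  ultimately show ?thesis
    using cmod_le[of "expectation (\<lambda>z. F z * of_real (W z)) - expectation F * of_real w"] by linarith
qed

lemma complex_mix1:
  fixes F :: "'z \<Rightarrow> complex"
  assumes "F \<in> borel_measurable (Fi p)" "\<And>z. cmod (F z) \<le> B" "B > 0"
  shows "cmod (expectation (\<lambda>z. F z * of_real (X (p + n) z))) \<le> 2 * B * a n"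
  using complex_mix[of p "X (p + n)" 0 "a n" F B] mix1[of _ p n] assms X_bound by simp

lemma complex_mix2:
  fixes F :: "'z \<Rightarrow> complex"
  assumes "F \<in> borel_measurable (Fi p)" "\<And>z. cmod (F z) \<le> B" "B > 0"
  shows "cmod (expectation (\<lambda>z. F z * of_real (X (p + n) z * X (p + n + j) z)) - expectation F * of_real (c j))
    \<le> 2 * B * a n"
  using mix2[of _ p n j] assms X_bound
  by (intro complex_mix) (auto simp: abs_mult intro!: mult_le_one)

definition S :: "nat \<Rightarrow> 'z \<Rightarrow> real" where "S n z = (\<Sum>k<n. X k z)"

definition Z :: "real \<Rightarrow> nat \<Rightarrow> 'z \<Rightarrow> complex" where "Z u n z = iexp (u * S n z)"

lemma S_Fi: "S n \<in> borel_measurable (Fi n)"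
  unfolding S_def
proof (rule borel_measurable_sum)
  fix i assume "i \<in> {..<n}"
  then show "(\<lambda>z. X i z) \<in> borel_measurable (Fi n)" by (intro Fi_meas_mono[OF X_Fi]) auto
qed

lemma S_meas [measurable]: "S n \<in> borel_measurable M"
  by (rule Fi_meas[OF S_Fi])

lemma Z_Fi: "Z u n \<in> borel_measurable (Fi n)"
  unfolding Z_def using S_Fi[of n] by measurable

lemma Z_meas [measurable]: "Z u n \<in> borel_measurable M"
  by (rule Fi_meas[OF Z_Fi])

lemma Z_0 [simp]: "Z u 0 = (\<lambda>_. 1)" "Z 0 n = (\<lambda>_. 1)"
  by (auto simp: Z_def S_def)

lemma norm_Z [simp]: "cmod (Z u n z) = 1"
  by (simp add: Z_def)

lemma Z_Suc: "Z u (Suc n) z = Z u n z * iexp (u * X n z)"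
  by (simp add: Z_def S_def algebra_simps exp_add[symmetric])

lemma iexp_bounds:
  fixes y u :: real assumes "\<bar>y\<bar> \<le> 1"
  shows "cmod (iexp (u * y) - 1) \<le> \<bar>u\<bar>"
    and "cmod (iexp (u * y) - 1 - \<i> * u * y) \<le> u\<^sup>2 / 2"
    and "cmod (iexp (u * y) - 1 - \<i> * u * y + u\<^sup>2 / 2 * (y * y)) \<le> \<bar>u\<bar>^3 / 6"
proof -
  have uy: "\<bar>u * y\<bar> \<le> \<bar>u\<bar>" using assms by (simp add: abs_mult mult_left_le)
  show "cmod (iexp (u * y) - 1) \<le> \<bar>u\<bar>"
    using iexp_approx1[of "u * y" 0] uy by simp
  have "cmod (iexp (u * y) - 1 - \<i> * u * y) \<le> \<bar>u * y\<bar>^2 / 2"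
    using iexp_approx1[of "u * y" 1] by (simp add: numeral_2_eq_2 algebra_simps del: power_abs)
  also have "\<dots> \<le> \<bar>u\<bar>^2 / 2" using power_mono[OF uy, of 2] by simp
  finally show "cmod (iexp (u * y) - 1 - \<i> * u * y) \<le> u\<^sup>2 / 2" by simp
  have "(\<Sum>k\<le>2. (\<i> * of_real (u * y))^k / fact k) = 1 + \<i> * u * y - u\<^sup>2 / 2 * (y * y)"
    by (simp add: numeral_2_eq_2 power2_eq_square algebra_simps)
  then have "cmod (iexp (u * y) - 1 - \<i> * u * y + u\<^sup>2 / 2 * (y * y)) \<le> \<bar>u * y\<bar>^3 / 6"
  proof -
    have eq: "iexp (u * y) - 1 - \<i> * u * y + u\<^sup>2 / 2 * (y * y) = iexp (u * y) - (1 + \<i> * u * y - u\<^sup>2 / 2 * (y * y))"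
      by simp
    show ?thesis unfolding eq
      using iexp_approx1[of "u * y" 2] \<open>(\<Sum>k\<le>2. _) = _\<close> by (simp add: fact_numeral eval_nat_numeral(3)[symmetric])
  qed
  also have "\<dots> \<le> \<bar>u\<bar>^3 / 6" using power_mono[OF uy, of 3] by simp
  finally show "cmod (iexp (u * y) - 1 - \<i> * u * y + u\<^sup>2 / 2 * (y * y)) \<le> \<bar>u\<bar>^3 / 6" .
qed

lemma Z_step: "cmod (Z u (Suc n) z - Z u n z) \<le> \<bar>u\<bar>"
proof -
  have "Z u (Suc n) z - Z u n z = Z u n z * (iexp (u * X n z) - 1)" by (simp add: Z_Suc algebra_simps)
  then show ?thesis using iexp_bounds(1)[OF X_bound] by (simp add: norm_mult)
qed

lemma Z_steps: "cmod (Z u (n + k) z - Z u n z) \<le> \<bar>u\<bar> * k"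
proof (induction k)
  case (Suc k)
  have "cmod (Z u (n + Suc k) z - Z u n z) \<le> cmod (Z u (Suc (n + k)) z - Z u (n + k) z) + cmod (Z u (n + k) z - Z u n z)"
    using norm_triangle_ineq[of "Z u (Suc (n + k)) z - Z u (n + k) z" "Z u (n + k) z - Z u n z"] by simp
  then show ?case using Suc Z_step[of u "n + k" z] by (simp add: algebra_simps)
qed simp

lemma integrable_ZW:
  assumes "W \<in> borel_measurable M" "\<And>z. \<bar>W z\<bar> \<le> 1"
  shows "integrable M (\<lambda>z. Z u n z * of_real (W z))"
  using assms by (intro integrable_bdd[of _ 1]) (auto simp: norm_mult)

lemma integrable_Z: "integrable M (Z u n)"
  by (intro integrable_bdd[of _ 1]) auto

text \<open>Moving \<open>Z\<close> back to an earlier time costs \<open>O(u)\<close> per step and opens the gap that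
  \<open>complex_mix2\<close> needs.\<close>
lemma Z_product_approx:
  assumes "q \<le> j" "q \<le> k" "j - q \<le> N" "k - q \<le> N"
  shows "cmod (expectation (\<lambda>z. Z u j z * of_real (X j z * X (j + i) z)) - of_real (c i) * expectation (Z u k))
    \<le> 2 * \<bar>u\<bar> * N + 2 * a (j - q)"
proof -
  have XX: "(\<lambda>z. X j z * X (j + i) z) \<in> borel_measurable M" "\<bar>X j z * X (j + i) z\<bar> \<le> 1" for z
    by (measurable, rule X_prod_bound)
  have st: "cmod (Z u n z - Z u q z) \<le> \<bar>u\<bar> * N" if "q \<le> n" "n - q \<le> N" for n z
  proof -
    have "cmod (Z u n z - Z u q z) \<le> \<bar>u\<bar> * real (n - q)" using Z_steps[of u q "n - q" z] that by simp
    also have "\<dots> \<le> \<bar>u\<bar> * real N" using that by (intro mult_left_mono) auto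
    finally show ?thesis .
  qed
  let ?E1 = "expectation (\<lambda>z. Z u j z * of_real (X j z * X (j + i) z))"
  let ?E2 = "expectation (\<lambda>z. Z u q z * of_real (X j z * X (j + i) z))"
  have "?E1 - ?E2 = expectation (\<lambda>z. (Z u j z - Z u q z) * of_real (X j z * X (j + i) z))"
    unfolding left_diff_distrib by (rule Bochner_Integration.integral_diff[symmetric]; intro integrable_ZW XX)
  also have "cmod \<dots> \<le> \<bar>u\<bar> * N"
  proof (rule norm_expectation_le)
    show "cmod ((Z u j z - Z u q z) * of_real (X j z * X (j + i) z)) \<le> \<bar>u\<bar> * N" for z
      using mult_mono[OF st[of j z] XX(2)[of z]] assms by (simp add: norm_mult abs_mult)
  qed measurable
  finally have 1: "cmod (?E1 - ?E2) \<le> \<bar>u\<bar> * N" .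
  have 2: "cmod (?E2 - expectation (Z u q) * of_real (c i)) \<le> 2 * a (j - q)"
    using complex_mix2[OF Z_Fi[of u q], of 1 "j - q" i] assms by simp
  have "expectation (Z u q) - expectation (Z u k) = expectation (\<lambda>z. Z u q z - Z u k z)"
    by (simp add: integrable_Z)
  also have "cmod \<dots> \<le> \<bar>u\<bar> * N"
    using st assms by (intro norm_expectation_le) (auto simp: norm_minus_commute)
  finally have qk: "cmod (expectation (Z u q) - expectation (Z u k)) \<le> \<bar>u\<bar> * N" .
  have "expectation (Z u q) * of_real (c i) - of_real (c i) * expectation (Z u k)
     = (expectation (Z u q) - expectation (Z u k)) * of_real (c i)" by (simp only: algebra_simps)
  then have "cmod (expectation (Z u q) * of_real (c i) - of_real (c i) * expectation (Z u k))
     = cmod (expectation (Z u q) - expectation (Z u k)) * \<bar>c i\<bar>" by (simp only: norm_mult norm_of_real)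
  also have "\<dots> \<le> \<bar>u\<bar> * N * 1" by (intro mult_mono c_bound qk) auto
  finally have 3: "cmod (expectation (Z u q) * of_real (c i) - of_real (c i) * expectation (Z u k)) \<le> \<bar>u\<bar> * N"
    by simp
  have "?E1 - of_real (c i) * expectation (Z u k)
     = (?E1 - ?E2) + ((?E2 - expectation (Z u q) * of_real (c i))
        + (expectation (Z u q) * of_real (c i) - of_real (c i) * expectation (Z u k)))" by simp
  then have "cmod (?E1 - of_real (c i) * expectation (Z u k)) \<le> cmod (?E1 - ?E2) + (cmod (?E2 - expectation (Z u q) * of_real (c i))
        + cmod (expectation (Z u q) * of_real (c i) - of_real (c i) * expectation (Z u k)))"
    by (simp only:) (rule norm_triangle_le, rule add_left_mono, rule norm_triangle_ineq)
  also have "\<dots> \<le> \<bar>u\<bar> * N + (2 * a (j - q) + \<bar>u\<bar> * N)" by (intro add_mono 1 2 3)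
  finally show ?thesis by simp
qed

text \<open>The boundary term vanishes because \<open>Z u 0\<close> is constantly 1 and
  \<open>X k\<close> is centred.\<close>

lemma Z_X_telescope:
  "expectation (\<lambda>z. Z u k z * of_real (X k z))
    = (\<Sum>j<k. expectation (\<lambda>z. (Z u (Suc j) z - Z u j z) * of_real (X k z)))"
proof -
  have i: "integrable M (\<lambda>z. Z u j z * of_real (X k z))" for j
    by (intro integrable_ZW X_bound) auto
  have "expectation (\<lambda>z. (Z u (Suc j) z - Z u j z) * of_real (X k z)) =
     expectation (\<lambda>z. Z u (Suc j) z * of_real (X k z)) - expectation (\<lambda>z. Z u j z * of_real (X k z))" for j
    by (simp add: left_diff_distrib i)
  then have "(\<Sum>j<k. expectation (\<lambda>z. (Z u (Suc j) z - Z u j z) * of_real (X k z))) =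
    expectation (\<lambda>z. Z u k z * of_real (X k z)) - expectation (\<lambda>z. Z u 0 z * of_real (X k z))"
    by (simp only: sum_lessThan_telescope[of "\<lambda>j. expectation (\<lambda>z. Z u j z * of_real (X k z))"])
  also have "expectation (\<lambda>z. Z u 0 z * of_real (X k z)) = of_real (expectation (X k))"
    by (simp add: Z_def S_def)
  finally show ?thesis by (simp add: X_mean)
qed

text \<open>Linearising the increment of \<open>Z\<close> costs at most half of u squared. What
  remains is \<open>Z\<close> times a product of two variables, evaluated by
  \<open>Z_product_approx\<close>.\<close>

lemma char_increment_near:
  fixes k l m :: nat and u \<eta> :: real
  assumes k: "k \<ge> m + l" and i: "i < m" and \<eta>: "\<And>n. n \<ge> l \<Longrightarrow> a n \<le> \<eta>"
  shows "cmod (expectation (\<lambda>z. (Z u (Suc (k - 1 - i)) z - Z u (k - 1 - i) z) * of_real (X k z))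
      - \<i> * u * of_real (c (Suc i)) * expectation (Z u k)) \<le> u\<^sup>2 / 2 + \<bar>u\<bar> * (2 * \<bar>u\<bar> * (m + l) + 2 * \<eta>)"
proof -
  define j where "j = k - 1 - i"
  have jk: "k = j + Suc i" using k i by (simp add: j_def)
  have XX: "(\<lambda>z. X j z * X (j + Suc i) z) \<in> borel_measurable M" "\<bar>X j z * X (j + Suc i) z\<bar> \<le> 1" for z
    by (measurable, rule X_prod_bound)
  let ?L = "expectation (\<lambda>z. (Z u (Suc j) z - Z u j z) * of_real (X k z))"
  let ?E = "expectation (\<lambda>z. Z u j z * of_real (X j z * X (j + Suc i) z))"
  have "?L - \<i> * u * ?E = expectation (\<lambda>z. (Z u (Suc j) z - Z u j z) * of_real (X k z)
        - \<i> * u * (Z u j z * of_real (X j z * X (j + Suc i) z)))"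
  proof (subst Bochner_Integration.integral_diff)
    show "integrable M (\<lambda>z. (Z u (Suc j) z - Z u j z) * of_real (X k z))"
      unfolding left_diff_distrib by (intro Bochner_Integration.integrable_diff integrable_ZW X_bound X_meas)
    show "integrable M (\<lambda>z. \<i> * u * (Z u j z * of_real (X j z * X (j + Suc i) z)))"
      by (intro integrable_mult_right integrable_ZW XX)
  qed simp
  also have "\<dots> = expectation (\<lambda>z. Z u j z * of_real (X k z) * (iexp (u * X j z) - 1 - \<i> * u * X j z))"
    by (intro Bochner_Integration.integral_cong) (auto simp: Z_Suc jk algebra_simps)
  also have "cmod \<dots> \<le> u\<^sup>2 / 2"
  proof (rule norm_expectation_le)
    show "cmod (Z u j z * of_real (X k z) * (iexp (u * X j z) - 1 - \<i> * u * X j z)) \<le> u\<^sup>2 / 2" for z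
      using mult_mono[OF X_bound[of k z] iexp_bounds(2)[OF X_bound[of j z], of u]] by (simp add: norm_mult)
  qed measurable
  finally have 1: "cmod (?L - \<i> * u * ?E) \<le> u\<^sup>2 / 2" .
  \<comment> \<open>The reference time is k - (m + l). Both \<open>j\<close> and \<open>k\<close>
    come at most m + l later, and \<open>j\<close> at least \<open>l\<close> later because i < m, so
    the decorrelation error there is at most \<eta>.\<close>
  have "cmod (?E - of_real (c (Suc i)) * expectation (Z u k)) \<le> 2 * \<bar>u\<bar> * (m + l) + 2 * a (j - (k - (m + l)))"
    using k i by (intro Z_product_approx) (auto simp: j_def)
  also have "a (j - (k - (m + l))) \<le> \<eta>" using k i by (intro \<eta>) (auto simp: j_def)
  finally have "\<bar>u\<bar> * cmod (?E - of_real (c (Suc i)) * expectation (Z u k)) \<le> \<bar>u\<bar> * (2 * \<bar>u\<bar> * (m + l) + 2 * \<eta>)"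
    by (intro mult_left_mono) auto
  then have 2: "cmod (\<i> * u * ?E - \<i> * u * of_real (c (Suc i)) * expectation (Z u k)) \<le> \<bar>u\<bar> * (2 * \<bar>u\<bar> * (m + l) + 2 * \<eta>)"
  proof -
    have "\<i> * u * ?E - \<i> * u * of_real (c (Suc i)) * expectation (Z u k)
       = \<i> * u * (?E - of_real (c (Suc i)) * expectation (Z u k))" by (simp only: algebra_simps)
    then have "cmod (\<i> * u * ?E - \<i> * u * of_real (c (Suc i)) * expectation (Z u k))
       = \<bar>u\<bar> * cmod (?E - of_real (c (Suc i)) * expectation (Z u k))" by (simp only: norm_mult) simp
    then show ?thesis using \<open>\<bar>u\<bar> * cmod _ \<le> _\<close> by simp
  qed
  have "?L - \<i> * u * of_real (c (Suc i)) * expectation (Z u k)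
    = (?L - \<i> * u * ?E) + (\<i> * u * ?E - \<i> * u * of_real (c (Suc i)) * expectation (Z u k))" by simp
  then have "cmod (?L - \<i> * u * of_real (c (Suc i)) * expectation (Z u k))
    \<le> cmod (?L - \<i> * u * ?E) + cmod (\<i> * u * ?E - \<i> * u * of_real (c (Suc i)) * expectation (Z u k))"
    by (simp only:) (rule norm_triangle_ineq)
  also have "\<dots> \<le> u\<^sup>2 / 2 + \<bar>u\<bar> * (2 * \<bar>u\<bar> * (m + l) + 2 * \<eta>)" by (intro add_mono 1 2)
  finally show ?thesis unfolding j_def .
qed

text \<open>The increment is bounded by |u| and known at time k - i, so it sees \<open>X k\<close>
  across a gap of \<open>i\<close>.\<close>

lemma char_increment_far:
  assumes u: "u \<noteq> 0" and i: "i < k"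
  shows "cmod (expectation (\<lambda>z. (Z u (Suc (k - 1 - i)) z - Z u (k - 1 - i) z) * of_real (X k z))) \<le> 2 * \<bar>u\<bar> * a i"
proof -
  define j where "j = k - 1 - i"
  have "(\<lambda>z. Z u (Suc j) z - Z u j z) \<in> borel_measurable (Fi (Suc j))"
    by (intro borel_measurable_diff Z_Fi Fi_meas_mono[OF Z_Fi]) auto
  from complex_mix1[OF this Z_step, of i] u i show ?thesis by (simp add: j_def)
qed

lemma char_increment:
  fixes k l m :: nat and u \<eta> \<epsilon> :: real
  assumes u: "u \<noteq> 0" and k: "k \<ge> m + l" and \<eta>: "\<And>n. n \<ge> l \<Longrightarrow> a n \<le> \<eta>"
    and \<epsilon>: "\<And>n. sum a {m..<n} \<le> \<epsilon>"
  shows "cmod (expectation (\<lambda>z. Z u k z * of_real (X k z))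
      - \<i> * u * of_real (\<Sum>i<m. c (Suc i)) * expectation (Z u k))
    \<le> 2 * \<bar>u\<bar> * \<epsilon> + m * (u\<^sup>2 / 2 + \<bar>u\<bar> * (2 * \<bar>u\<bar> * (m + l) + 2 * \<eta>))"
proof -
  define h where "h i = expectation (\<lambda>z. (Z u (Suc (k - 1 - i)) z - Z u (k - 1 - i) z) * of_real (X k z))" for i
  have "expectation (\<lambda>z. Z u k z * of_real (X k z)) = (\<Sum>i<k. h i)"
    unfolding Z_X_telescope h_def
    by (rule sum.reindex_bij_witness[of _ "\<lambda>i. k - 1 - i" "\<lambda>i. k - 1 - i"]) auto
  also have "\<dots> = (\<Sum>i<m. h i) + (\<Sum>i\<in>{m..<k}. h i)"
    using k unfolding lessThan_atLeast0 by (simp add: sum.atLeastLessThan_concat)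
  finally have "expectation (\<lambda>z. Z u k z * of_real (X k z)) - \<i> * u * of_real (\<Sum>i<m. c (Suc i)) * expectation (Z u k)
     = (\<Sum>i<m. h i - \<i> * u * of_real (c (Suc i)) * expectation (Z u k)) + (\<Sum>i\<in>{m..<k}. h i)"
    by (simp add: sum_subtractf sum_distrib_left sum_distrib_right)
  also have "cmod \<dots> \<le> (\<Sum>i<m. u\<^sup>2 / 2 + \<bar>u\<bar> * (2 * \<bar>u\<bar> * (m + l) + 2 * \<eta>)) + (\<Sum>i\<in>{m..<k}. 2 * \<bar>u\<bar> * a i)"
  proof (rule norm_triangle_le, rule add_mono)
    show "cmod (\<Sum>i<m. h i - \<i> * u * of_real (c (Suc i)) * expectation (Z u k))
      \<le> (\<Sum>i<m. u\<^sup>2 / 2 + \<bar>u\<bar> * (2 * \<bar>u\<bar> * (m + l) + 2 * \<eta>))"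
      unfolding h_def by (rule sum_norm_le, rule char_increment_near) (use k \<eta> in auto)
    show "cmod (sum h {m..<k}) \<le> (\<Sum>i\<in>{m..<k}. 2 * \<bar>u\<bar> * a i)"
      unfolding h_def by (rule sum_norm_le, rule char_increment_far) (use u in auto)
  qed
  also have "(\<Sum>i\<in>{m..<k}. 2 * \<bar>u\<bar> * a i) \<le> 2 * \<bar>u\<bar> * \<epsilon>"
    unfolding sum_distrib_left[symmetric] by (intro mult_left_mono \<epsilon>) auto
  finally show ?thesis by simp
qed

text \<open>In the factor of the square of u, two \<epsilon> come from the far lags and one from
  cutting the covariance series; 2 m \<eta> comes from the near lags and \<eta> from the variance
  term. The cubic term has a large constant but is negligible for small u.\<close>

lemma char_step:
  fixes k l m :: nat and u \<eta> \<epsilon> :: real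
  assumes u: "u \<noteq> 0" and k: "k \<ge> m + l" and \<eta>: "\<And>n. n \<ge> l \<Longrightarrow> a n \<le> \<eta>"
    and \<epsilon>: "\<And>n. sum a {m..<n} \<le> \<epsilon>"
    and tail: "\<bar>(\<Sum>k. c (Suc k)) - (\<Sum>i<m. c (Suc i))\<bar> \<le> \<epsilon>"
  shows "cmod (expectation (Z u (Suc k)) - of_real (1 - u\<^sup>2 * \<sigma>2 / 2) * expectation (Z u k))
    \<le> u\<^sup>2 * (3 * \<epsilon> + (2 * m + 1) * \<eta>) + \<bar>u\<bar>^3 * (1/6 + m / 2 + (2 * m + 1) * (m + l))"
proof -
  define s where "s = (\<Sum>i<m. c (Suc i))"
  define \<phi> where "\<phi> = expectation (Z u k)"
  define E1 where "E1 = expectation (\<lambda>z. Z u k z * of_real (X k z))"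
  define E2 where "E2 = expectation (\<lambda>z. Z u k z * of_real (X k z * X (k + 0) z))"
  have \<phi>1: "cmod \<phi> \<le> 1" unfolding \<phi>_def by (rule norm_expectation_le) auto
  have XX: "(\<lambda>z. X k z * X (k + 0) z) \<in> borel_measurable M" "\<bar>X k z * X (k + 0) z\<bar> \<le> 1" for z
    by (measurable, rule X_prod_bound)
  have 1: "cmod (E1 - \<i> * u * of_real s * \<phi>) \<le> 2 * \<bar>u\<bar> * \<epsilon> + m * (u\<^sup>2 / 2 + \<bar>u\<bar> * (2 * \<bar>u\<bar> * (m + l) + 2 * \<eta>))"
    unfolding E1_def s_def \<phi>_def by (rule char_increment[OF u k \<eta> \<epsilon>])
  have "cmod (E2 - of_real (c 0) * \<phi>) \<le> 2 * \<bar>u\<bar> * (m + l) + 2 * a (k - (k - (m + l)))"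
    unfolding E2_def \<phi>_def by (rule Z_product_approx) auto
  also have "a (k - (k - (m + l))) \<le> \<eta>" using k by (intro \<eta>) auto
  finally have 2: "cmod (E2 - of_real (c 0) * \<phi>) \<le> 2 * \<bar>u\<bar> * (m + l) + 2 * \<eta>" by simp
  have "expectation (Z u (Suc k)) - \<phi> - \<i> * u * E1 + u\<^sup>2 / 2 * E2 =
     expectation (\<lambda>z. Z u (Suc k) z - Z u k z - \<i> * u * (Z u k z * of_real (X k z)) + u\<^sup>2 / 2 * (Z u k z * of_real (X k z * X (k + 0) z)))"
    unfolding \<phi>_def E1_def E2_def using integrable_Z integrable_ZW[OF XX] integrable_ZW[OF X_meas X_bound]
    by (subst Bochner_Integration.integral_add Bochner_Integration.integral_diff;
        (intro Bochner_Integration.integrable_diff integrable_mult_right)?; simp)+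
  also have "\<dots> = expectation (\<lambda>z. Z u k z * (iexp (u * X k z) - 1 - \<i> * u * X k z + u\<^sup>2 / 2 * (X k z * X k z)))"
    by (intro Bochner_Integration.integral_cong) (auto simp: Z_Suc algebra_simps)
  also have "cmod \<dots> \<le> \<bar>u\<bar>^3 / 6"
  proof (rule norm_expectation_le)
    show "cmod (Z u k z * (iexp (u * X k z) - 1 - \<i> * u * X k z + u\<^sup>2 / 2 * (X k z * X k z))) \<le> \<bar>u\<bar>^3 / 6" for z
      using iexp_bounds(3)[OF X_bound[of k z], of u] by (simp add: norm_mult)
  qed measurable
  finally have 3: "cmod (expectation (Z u (Suc k)) - \<phi> - \<i> * u * E1 + u\<^sup>2 / 2 * E2) \<le> \<bar>u\<bar>^3 / 6" .
  \<comment> \<open>The first-order term of the exponential, with the near lags inserted, produces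
    minus the square of u times the covariance sum; the second-order term produces half the
    variance. Together they are the factor with \<open>\<sigma>2\<close>, and the last summand
    restores the tail of the series.\<close>
  have eq: "expectation (Z u (Suc k)) - of_real (1 - u\<^sup>2 * \<sigma>2 / 2) * \<phi> =
     (expectation (Z u (Suc k)) - \<phi> - \<i> * u * E1 + u\<^sup>2 / 2 * E2)
     + (\<i> * u) * (E1 - \<i> * u * of_real s * \<phi>) - of_real (u\<^sup>2 / 2) * (E2 - of_real (c 0) * \<phi>)
     + of_real (u\<^sup>2) * (of_real ((\<Sum>k. c (Suc k)) - s) * \<phi>)"
    by (simp add: \<sigma>2_def s_def[symmetric] field_simps power2_eq_square)
  have tri: "cmod (w + x - y + z) \<le> cmod w + cmod x + cmod y + cmod z" for w x y z
    by (smt (verit) norm_triangle_ineq norm_triangle_ineq4)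
  have "cmod (expectation (Z u (Suc k)) - of_real (1 - u\<^sup>2 * \<sigma>2 / 2) * \<phi>)
     \<le> \<bar>u\<bar>^3 / 6 + \<bar>u\<bar> * (2 * \<bar>u\<bar> * \<epsilon> + m * (u\<^sup>2 / 2 + \<bar>u\<bar> * (2 * \<bar>u\<bar> * (m + l) + 2 * \<eta>)))
        + u\<^sup>2 / 2 * (2 * \<bar>u\<bar> * (m + l) + 2 * \<eta>) + u\<^sup>2 * (\<epsilon> * 1)"
    unfolding eq
  proof (rule order_trans[OF tri], intro add_mono 3)
    show "cmod (\<i> * u * (E1 - \<i> * u * of_real s * \<phi>)) \<le> \<bar>u\<bar> * (2 * \<bar>u\<bar> * \<epsilon> + m * (u\<^sup>2 / 2 + \<bar>u\<bar> * (2 * \<bar>u\<bar> * (m + l) + 2 * \<eta>)))"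
      using mult_left_mono[OF 1, of "\<bar>u\<bar>"] by (simp only: norm_mult) simp
    show "cmod (of_real (u\<^sup>2 / 2) * (E2 - of_real (c 0) * \<phi>)) \<le> u\<^sup>2 / 2 * (2 * \<bar>u\<bar> * (m + l) + 2 * \<eta>)"
      using mult_left_mono[OF 2, of "u\<^sup>2 / 2"] by (simp only: norm_mult norm_of_real) simp
    have "\<bar>(\<Sum>k. c (Suc k)) - s\<bar> * cmod \<phi> \<le> \<epsilon> * 1"
      using tail \<phi>1 by (intro mult_mono) (auto simp: s_def)
    then show "cmod (of_real (u\<^sup>2) * (of_real ((\<Sum>k. c (Suc k)) - s) * \<phi>)) \<le> u\<^sup>2 * (\<epsilon> * 1)"
      using mult_left_mono[of _ "\<epsilon> * 1" "u\<^sup>2"] by (simp only: norm_mult norm_of_real) simp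
  qed
  also have "\<dots> = u\<^sup>2 * (3 * \<epsilon> + (2 * m + 1) * \<eta>) + \<bar>u\<bar>^3 * (1/6 + m / 2 + (2 * m + 1) * (m + l))"
  proof -
    have "w^3 / 6 + w * (2 * w * \<epsilon> + m * (w\<^sup>2 / 2 + w * (2 * w * (m + l) + 2 * \<eta>)))
        + w\<^sup>2 / 2 * (2 * w * (m + l) + 2 * \<eta>) + w\<^sup>2 * (\<epsilon> * 1)
      = w\<^sup>2 * (3 * \<epsilon> + (2 * m + 1) * \<eta>) + w^3 * (1/6 + m / 2 + (2 * m + 1) * (m + l))" for w :: real
      by (simp add: algebra_simps power2_eq_square power3_eq_cube)
    from this[of "\<bar>u\<bar>"] show ?thesis by (simp only: power2_abs)
  qed
  finally show ?thesis by (simp add: \<phi>_def)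
qed

text \<open>Serves the first m + l indices, which cannot be moved back far enough. They are
  boundedly many, so an error of order |u| each is affordable.\<close>

lemma char_step_crude:
  "cmod (expectation (Z u (Suc k)) - of_real (1 - u\<^sup>2 * \<sigma>2 / 2) * expectation (Z u k)) \<le> \<bar>u\<bar> + u\<^sup>2 * \<bar>\<sigma>2\<bar> / 2"
proof -
  have "expectation (Z u (Suc k)) - of_real (1 - u\<^sup>2 * \<sigma>2 / 2) * expectation (Z u k)
     = expectation (\<lambda>z. Z u (Suc k) z - Z u k z) + of_real (u\<^sup>2 * \<sigma>2 / 2) * expectation (Z u k)"
    by (simp add: integrable_Z algebra_simps)
  also have "cmod \<dots> \<le> \<bar>u\<bar> + \<bar>u\<^sup>2 * \<sigma>2 / 2\<bar> * 1"
  proof (rule norm_triangle_le, rule add_mono)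
    show "cmod (expectation (\<lambda>z. Z u (Suc k) z - Z u k z)) \<le> \<bar>u\<bar>"
      by (rule norm_expectation_le) (auto intro: Z_step)
    show "cmod (of_real (u\<^sup>2 * \<sigma>2 / 2) * expectation (Z u k)) \<le> \<bar>u\<^sup>2 * \<sigma>2 / 2\<bar> * 1"
      unfolding norm_mult[of "of_real _"] norm_of_real
      by (rule mult_left_mono, rule norm_expectation_le) auto
  qed
  finally show ?thesis by (simp add: abs_mult)
qed

lemma char_limit:
  assumes s0: "0 \<le> \<sigma>2"
  shows "(\<lambda>n. expectation (Z (t / sqrt n) n)) \<longlonglongrightarrow> of_real (exp (- (t\<^sup>2 * \<sigma>2 / 2)))"
proof (cases "t = 0")
  case True
  then show ?thesis by (simp add: prob_space)
next
  case False
  let ?\<phi> = "\<lambda>n. expectation (Z (t / sqrt n) n)"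
  let ?q = "\<lambda>n. 1 - (t / sqrt (real n))\<^sup>2 * \<sigma>2 / 2"
  have q: "?q n = 1 + (- (t\<^sup>2 * \<sigma>2 / 2)) / real n" for n
    by (simp add: power_divide)
  have "(\<lambda>n. ?q n ^ n) \<longlonglongrightarrow> exp (- (t\<^sup>2 * \<sigma>2 / 2))"
    unfolding q by (rule tendsto_exp_limit_sequentially)
  then have lim: "(\<lambda>n. complex_of_real (?q n ^ n)) \<longlonglongrightarrow> of_real (exp (- (t\<^sup>2 * \<sigma>2 / 2)))"
    by (rule tendsto_of_real)
  have "(\<lambda>n. ?\<phi> n - of_real (?q n ^ n)) \<longlonglongrightarrow> 0"
  proof (rule LIMSEQ_I)
    fix r :: real assume r: "0 < r"
    \<comment> \<open>The n steps accumulate 4 \<epsilon> times the square of t, which is 2/5 of r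
      and so below r / 2.\<close>
    define \<epsilon> where "\<epsilon> = r / (10 * t\<^sup>2)"
    have \<epsilon>: "\<epsilon> > 0" using r False by (simp add: \<epsilon>_def)
    have sc: "summable (\<lambda>k. c (Suc k))" using c_summable by (rule summable_rabs_cancel)
    obtain m1 where m1: "\<And>m n. m \<ge> m1 \<Longrightarrow> norm (sum a {m..<n}) < \<epsilon>"
      using a_summable \<epsilon> unfolding summable_Cauchy by blast
    obtain m2 where m2: "\<And>m. m \<ge> m2 \<Longrightarrow> norm ((\<Sum>i<m. c (Suc i)) - (\<Sum>k. c (Suc k))) < \<epsilon>"
      using LIMSEQ_D[OF summable_LIMSEQ[OF sc] \<epsilon>] by blast
    define m where "m = max m1 m2"
    have tail_a: "sum a {m..<n} \<le> \<epsilon>" for n using m1[of m n] by (auto simp: m_def)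
    have tail_c: "\<bar>(\<Sum>k. c (Suc k)) - (\<Sum>i<m. c (Suc i))\<bar> \<le> \<epsilon>"
      using m2[of m] by (simp add: m_def abs_minus_commute)
    \<comment> \<open>Makes (2 m + 1) \<eta> equal to \<epsilon>, so the quadratic error per step is
      4 \<epsilon>. The gap \<open>l\<close> is chosen after \<open>m\<close>, and both before
      \<open>n\<close>.\<close>
    define \<eta> where "\<eta> = \<epsilon> / (2 * m + 1)"
    have \<eta>: "\<eta> > 0" using \<epsilon> by (simp add: \<eta>_def)
    obtain l where l: "\<And>n. n \<ge> l \<Longrightarrow> a n \<le> \<eta>"
      using LIMSEQ_D[OF summable_LIMSEQ_zero[OF a_summable] \<eta>] by (auto dest: less_imp_le abs_le_D1)
    define K where "K = 1/6 + m / 2 + (2 * m + 1) * real (m + l)"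
    define u where "u n = t / sqrt (real n)" for n
    \<comment> \<open>Collects what vanishes for fixed \<open>m\<close> and \<open>l\<close>: the
      cost of the early steps and the accumulated cubic errors.\<close>
    define B where "B n = real (m + l) * (\<bar>u n\<bar> + (u n)\<^sup>2 * \<bar>\<sigma>2\<bar> / 2) + \<bar>t\<bar>^3 * K / sqrt n" for n
    have "B \<longlonglongrightarrow> 0"
    proof -
      have s: "(\<lambda>n. inverse (sqrt (real n))) \<longlonglongrightarrow> 0"
        using filterlim_compose[OF sqrt_at_top filterlim_real_sequentially] by (rule tendsto_inverse_0_at_top)
      have "B n = real (m + l) * (\<bar>t\<bar> * inverse (sqrt n) + (t * inverse (sqrt n))\<^sup>2 * \<bar>\<sigma>2\<bar> / 2) + \<bar>t\<bar>^3 * K * inverse (sqrt n)" for n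
        unfolding B_def u_def divide_inverse by (simp add: abs_mult)
      then have "B = (\<lambda>n. real (m + l) * (\<bar>t\<bar> * inverse (sqrt n) + (t * inverse (sqrt n))\<^sup>2 * \<bar>\<sigma>2\<bar> / 2) + \<bar>t\<bar>^3 * K * inverse (sqrt n))"
        by (rule ext)
      also have "\<dots> \<longlonglongrightarrow> real (m + l) * (\<bar>t\<bar> * 0 + (t * 0)\<^sup>2 * \<bar>\<sigma>2\<bar> / 2) + \<bar>t\<bar>^3 * K * 0"
        by (intro tendsto_add tendsto_mult tendsto_divide tendsto_power tendsto_const s) auto
      finally show ?thesis by simp
    qed
    then obtain N1 where N1: "\<And>n. n \<ge> N1 \<Longrightarrow> norm (B n - 0) < r / 2"
      using LIMSEQ_D[of B 0 "r/2"] r by auto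
    \<comment> \<open>Beyond N2 the subtracted part of the factor lies in [0, 2], so the factor has
      modulus at most one.\<close>
    obtain N2 where N2: "real N2 > t\<^sup>2 * \<sigma>2 / 4" using reals_Archimedean2 by blast
    show "\<exists>no. \<forall>n\<ge>no. norm (?\<phi> n - of_real (?q n ^ n) - 0) < r"
    proof (intro exI allI impI)
      fix n assume n: "n \<ge> max (Suc N1) N2"
      then have n0: "real n > 0" by simp
      have u0: "u n \<noteq> 0" using n0 False by (simp add: u_def)
      have u2: "(u n)\<^sup>2 = t\<^sup>2 / n" by (simp add: u_def power_divide)
      have "t\<^sup>2 * \<sigma>2 / 4 \<le> real n" using N2 n by linarith
      then have "(u n)\<^sup>2 * \<sigma>2 / 2 \<le> 2" using n0 unfolding u2 by (simp add: field_simps)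
      moreover have "0 \<le> (u n)\<^sup>2 * \<sigma>2 / 2" using s0 by simp
      ultimately have q1: "\<bar>1 - (u n)\<^sup>2 * \<sigma>2 / 2\<bar> \<le> 1" by linarith
      define e1 where "e1 = (u n)\<^sup>2 * (4 * \<epsilon>) + \<bar>u n\<bar>^3 * K"
      have K0: "K \<ge> 0" by (simp add: K_def)
      have "cmod (expectation (Z (u n) n) - of_real ((1 - (u n)\<^sup>2 * \<sigma>2 / 2) ^ n))
          \<le> real (m + l) * (\<bar>u n\<bar> + (u n)\<^sup>2 * \<bar>\<sigma>2\<bar> / 2) + real n * e1"
      proof (rule linear_recursion_approx[where \<phi> = "\<lambda>k. expectation (Z (u n) k)"])
        show "expectation (Z (u n) 0) = 1" by (simp add: prob_space)
        show "0 \<le> e1" using \<epsilon> K0 by (simp add: e1_def)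
        fix k assume k: "m + l \<le> k"
        have "(2 * m + 1) * \<eta> = \<epsilon>" by (simp add: \<eta>_def field_simps)
        then have "(u n)\<^sup>2 * (3 * \<epsilon> + (2 * m + 1) * \<eta>) + \<bar>u n\<bar>^3 * K = e1" by (simp add: e1_def)
        then show "cmod (expectation (Z (u n) (Suc k)) - of_real (1 - (u n)\<^sup>2 * \<sigma>2 / 2) * expectation (Z (u n) k)) \<le> e1"
          using char_step[OF u0 k l tail_a tail_c]
          by (simp only: K_def of_nat_add of_nat_mult of_nat_numeral of_nat_1)
      qed (use q1 char_step_crude in auto)
      also have "\<dots> = B n + 4 * \<epsilon> * t\<^sup>2"
      proof -
        have "\<bar>u n\<bar>^3 = \<bar>u n\<bar> * (u n)\<^sup>2" by (simp add: power3_eq_cube power2_eq_square)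
        also have "\<dots> = \<bar>t\<bar>^3 / (sqrt n * n)" unfolding u2 by (simp add: u_def abs_divide power3_eq_cube power2_eq_square)
        finally have "real n * e1 = 4 * \<epsilon> * t\<^sup>2 + \<bar>t\<bar>^3 * K / sqrt n"
          using n0 unfolding e1_def u2 by (simp add: field_simps)
        then show ?thesis by (simp add: B_def)
      qed
      also have "\<dots> < r / 2 + r / 2"
        using N1[of n] n False r by (intro add_less_le_mono) (auto simp: \<epsilon>_def)
      finally show "norm (?\<phi> n - of_real (?q n ^ n) - 0) < r" by (simp add: u_def)
    qed
  qed
  from tendsto_add[OF this lim] show ?thesis by simp
qed

text \<open>Passing from n to n + 1 adds to the second moment the variance and twice the covariances
  up to lag n, a quantity tending to \<open>\<sigma>2\<close>; its Cesaro means are the normalised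
  moments. Nonnegativity of \<open>\<sigma>2\<close> and the degenerate case both follow from
  this.\<close>

lemma S_square_limit: "(\<lambda>n. expectation (\<lambda>z. (S n z / sqrt n)\<^sup>2)) \<longlonglongrightarrow> \<sigma>2"
proof -
  define g where "g n = c 0 + 2 * (\<Sum>i<n. c (Suc i))" for n
  have iXX: "integrable M (\<lambda>z. X i z * X j z)" for i j
    by (intro integrable_bdd[of _ 1]) (auto intro: X_prod_bound)
  have "expectation (\<lambda>z. (S n z)\<^sup>2) = (\<Sum>k<n. g k) \<and> integrable M (\<lambda>z. (S n z)\<^sup>2)" for n
  proof (induction n)
    case (Suc n)
    have eq: "(S (Suc n) z)\<^sup>2 = (S n z)\<^sup>2 + 2 * (\<Sum>i<n. X i z * X n z) + X n z * X n z" for z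
      by (simp add: S_def power2_eq_square algebra_simps sum_distrib_left sum_distrib_right)
    have iS: "integrable M (\<lambda>z. 2 * (\<Sum>i<n. X i z * X n z))" by (intro integrable_mult_right Bochner_Integration.integrable_sum iXX)
    have "expectation (\<lambda>z. (S (Suc n) z)\<^sup>2) = (\<Sum>k<n. g k) + 2 * (\<Sum>i<n. expectation (\<lambda>z. X i z * X n z)) + expectation (\<lambda>z. X n z * X n z)"
      unfolding eq using Suc iS iXX
      by (simp add: Bochner_Integration.integral_add Bochner_Integration.integrable_add Bochner_Integration.integral_sum)
    also have "(\<Sum>i<n. expectation (\<lambda>z. X i z * X n z)) = (\<Sum>i<n. c (n - i))"
      using X_cov[of _ "n - _"] by (intro sum.cong) (auto, metis X_cov le_add_diff_inverse less_imp_le)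
    also have "\<dots> = (\<Sum>i<n. c (Suc i))"
      by (rule sum.reindex_bij_witness[of _ "\<lambda>i. n - 1 - i" "\<lambda>i. n - 1 - i"]) (auto simp: Suc_diff_Suc)
    also have "expectation (\<lambda>z. X n z * X n z) = c 0" using X_cov[of n 0] by simp
    finally have "expectation (\<lambda>z. (S (Suc n) z)\<^sup>2) = (\<Sum>k<Suc n. g k)" by (simp add: g_def)
    moreover have "integrable M (\<lambda>z. (S (Suc n) z)\<^sup>2)"
      unfolding eq using Suc iS iXX by (intro Bochner_Integration.integrable_add) auto
    ultimately show ?case ..
  qed (simp add: S_def)
  then have eq: "(\<lambda>n. expectation (\<lambda>z. (S n z / sqrt n)\<^sup>2)) = (\<lambda>n. (\<Sum>k<n. g k) / n)"
    by (simp add: power_divide)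
  have sc: "summable (\<lambda>k. c (Suc k))" using c_summable by (rule summable_rabs_cancel)
  have "g \<longlonglongrightarrow> \<sigma>2" unfolding g_def \<sigma>2_def by (intro tendsto_intros summable_LIMSEQ sc)
  then show ?thesis unfolding eq by (rule cesaro_mean)
qed

lemma \<sigma>2_nonneg: "0 \<le> \<sigma>2"
  by (rule LIMSEQ_le_const[OF S_square_limit]) (auto intro!: Bochner_Integration.integral_nonneg)

lemma central_limit: "weak_conv_m (\<lambda>n. distr M borel (\<lambda>z. S n z / sqrt n)) (gauss_law \<sigma>2)"
proof (rule levy_continuity)
  fix t
  have "char (distr M borel (\<lambda>z. S n z / sqrt n)) t = expectation (Z (t / sqrt n) n)" for n
    unfolding char_def by (subst integral_distr) (auto simp: Z_def[abs_def])
  then show "(\<lambda>n. char (distr M borel (\<lambda>z. S n z / sqrt n)) t) \<longlonglongrightarrow> char (gauss_law \<sigma>2) t"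
    using char_limit[OF \<sigma>2_nonneg, of t] by (simp add: char_gauss_law[OF \<sigma>2_nonneg])
qed (auto intro: real_distribution_gauss_law \<sigma>2_nonneg)

lemma degenerate_limit:
  assumes "\<sigma>2 = 0" "\<epsilon> > 0"
  shows "(\<lambda>n. prob {z \<in> space M. \<epsilon> < \<bar>S n z / sqrt n\<bar>}) \<longlonglongrightarrow> 0"
proof (rule tendsto_sandwich[where f = "\<lambda>_. 0" and h = "\<lambda>n. expectation (\<lambda>z. (S n z / sqrt n)\<^sup>2) / \<epsilon>\<^sup>2"])
  have "prob {z \<in> space M. \<epsilon> < \<bar>S n z / sqrt n\<bar>} \<le> expectation (\<lambda>z. (S n z / sqrt n)\<^sup>2) / \<epsilon>\<^sup>2" for n
  proof -
    have "\<bar>S n z\<bar> \<le> real n" for z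
      unfolding S_def using sum_norm_le[of "{..<n}" "\<lambda>k. X k z" "\<lambda>_. 1"] X_bound by simp
    then have "\<bar>S n z / sqrt n\<bar> \<le> real n / sqrt n" for z by (simp add: abs_divide divide_right_mono)
    then have "(S n z / sqrt n)\<^sup>2 \<le> (real n / sqrt n)\<^sup>2" for z using abs_le_square_iff by fastforce
    then have int: "integrable M (\<lambda>z. (S n z / sqrt n)\<^sup>2)"
      by (intro integrable_bdd[of _ "(real n / sqrt n)\<^sup>2"]) auto
    have "prob {z \<in> space M. \<epsilon> < \<bar>S n z / sqrt n\<bar>} \<le> prob {z \<in> space M. \<epsilon>\<^sup>2 \<le> (S n z / sqrt n)\<^sup>2}"
      using assms(2) by (intro finite_measure_mono) (auto simp: abs_le_square_iff[symmetric] less_imp_le)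
    also have "\<dots> \<le> expectation (\<lambda>z. (S n z / sqrt n)\<^sup>2) / \<epsilon>\<^sup>2"
      using assms(2) int by (intro integral_Markov_inequality_measure[where A="{}"]) auto
    finally show ?thesis .
  qed
  then show "\<forall>\<^sub>F n in sequentially. prob {z \<in> space M. \<epsilon> < \<bar>S n z / sqrt n\<bar>} \<le> expectation (\<lambda>z. (S n z / sqrt n)\<^sup>2) / \<epsilon>\<^sup>2"
    by simp
  show "(\<lambda>n. expectation (\<lambda>z. (S n z / sqrt n)\<^sup>2) / \<epsilon>\<^sup>2) \<longlonglongrightarrow> 0"
    using tendsto_divide[OF S_square_limit tendsto_const, of "\<epsilon>\<^sup>2"] assms by simp
qed auto

end

section \<open>The annealed law and its decorrelation\<close>

context instrument_system begin

text \<open>\<open>annealed\<close> is a bare \<open>measure_of\<close>, so its set function has to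
  be recognised as a measure. It agrees with that of a monadic bind over a probability kernel that
  equals the quenched law off a null set.\<close>

lemma annealed_cylinder:
  assumes \<psi>: "random_state P \<psi>"
  shows "prob_space (annealed P T \<theta> \<psi>) \<and> sets (annealed P T \<theta> \<psi>) = sets (P \<Otimes>\<^sub>M seq_space) \<and>
    (\<forall>n. \<forall>w\<in>words n. measure (annealed P T \<theta> \<psi>) {z \<in> space (annealed P T \<theta> \<psi>). prefix_word n (snd z) = w}
      = (\<integral>\<omega>. Re (trace (Tlist T \<theta> w \<omega> (\<psi> \<omega>))) \<partial>P))"
proof -
  let ?S = "seq_space :: (nat \<Rightarrow> 'a) measure"
  obtain N where N: "{\<omega> \<in> space P. \<not> good \<omega>} \<subseteq> N" "emeasure P N = 0" "N \<in> sets P"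
    by (rule AE_E[OF AE_good])
  \<comment> \<open>Off the null set \<open>N\<close> the quenched law is well defined; on \<open>N\<close> it may be the junk value
    of \<open>THE\<close>.\<close>
  define K where "K \<omega> = (if \<omega> \<in> N then return ?S (\<lambda>_. undefined) else quenched T \<theta> (\<psi> \<omega>) \<omega>)" for \<omega>
  have dens: "density_matrix (\<psi> \<omega>)" if "\<omega> \<in> space P" for \<omega> using \<psi> that unfolding random_state_def by blast
  have notN: "good \<omega>" if "\<omega> \<in> space P" "\<omega> \<notin> N" for \<omega> using N(1) that by blast
  have Kp: "prob_space (K \<omega>)" "sets (K \<omega>) = sets ?S" if "\<omega> \<in> space P" for \<omega>
    using quenched_good(1,2)[OF notN[OF that] dens[OF that]] prob_space_return[of _ ?S]
    by (cases "\<omega> \<in> N"; simp add: K_def)+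
  have Kw: "measure (K \<omega>) {y. prefix_word n y = prefix_word n x}
      = (if \<omega> \<in> N then measure (return ?S (\<lambda>_. undefined)) {y. prefix_word n y = prefix_word n x}
         else Re (trace (Tlist T \<theta> (prefix_word n x) \<omega> (\<psi> \<omega>))))" if "\<omega> \<in> space P" for \<omega> n x
    using quenched_good(3)[OF notN[OF that] dens[OF that]] by (simp add: K_def)
  have trm: "(\<lambda>\<omega>. Re (trace (Tlist T \<theta> w \<omega> (\<psi> \<omega>)))) \<in> borel_measurable P" for w
    by (rule borel_measurable_continuous_on[OF _ Tlist_measurable[OF random_state_measurable[OF \<psi>] measurable_ident_sets[OF refl]]])
       (intro continuous_intros)
  have Km: "K \<in> measurable P (prob_algebra ?S)"
  proof (rule sequence_kernel_measurable)
    fix n x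
    show "(\<lambda>\<omega>. measure (K \<omega>) {y. prefix_word n y = prefix_word n x}) \<in> borel_measurable P"
      by (subst measurable_cong[OF Kw]) (use trm N(3) in \<open>auto intro!: measurable_If_set\<close>)
  qed (use Kp in auto)
  have "(\<lambda>\<omega>. distr (K \<omega>) (P \<Otimes>\<^sub>M ?S) (Pair \<omega>)) \<in> measurable P (subprob_algebra (P \<Otimes>\<^sub>M ?S))"
    by (rule measurable_distr2[where M = ?S])
       (use measurable_prob_algebraD[OF Km] in \<open>auto simp: case_prod_beta\<close>)
  note Dm = this
  \<comment> \<open>The genuine measure: draw \<omega> from \<open>P\<close>, then the outcomes from
    the kernel, and keep the pair.\<close>
  define Q where "Q = P \<bind> (\<lambda>\<omega>. distr (K \<omega>) (P \<Otimes>\<^sub>M ?S) (Pair \<omega>))"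
  have Pm: "Pair \<omega> \<in> measurable (K \<omega>) (P \<Otimes>\<^sub>M ?S)" if "\<omega> \<in> space P" for \<omega>
    using that by (subst measurable_cong_sets[OF Kp(2)[OF that] refl]) simp
  have setsQ: "sets Q = sets (P \<Otimes>\<^sub>M ?S)"
    unfolding Q_def by (rule sets_bind) (auto simp: not_empty)
  have spaceQ: "space Q = space P \<times> UNIV"
    using sets_eq_imp_space_eq[OF setsQ] by (simp add: space_pair_measure)
  have Kspace: "space (K \<omega>) = UNIV" if "\<omega> \<in> space P" for \<omega>
    using sets_eq_imp_space_eq[OF Kp(2)[OF that]] by simp
  have emQ: "emeasure Q A = (\<integral>\<^sup>+\<omega>. emeasure (K \<omega>) (Pair \<omega> -` A) \<partial>P)" if A: "A \<in> sets (P \<Otimes>\<^sub>M ?S)" for A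
  proof -
    have "emeasure Q A = (\<integral>\<^sup>+\<omega>. emeasure (distr (K \<omega>) (P \<Otimes>\<^sub>M ?S) (Pair \<omega>)) A \<partial>P)"
      unfolding Q_def by (rule emeasure_bind[OF not_empty Dm A])
    also have "\<dots> = (\<integral>\<^sup>+\<omega>. emeasure (K \<omega>) (Pair \<omega> -` A) \<partial>P)"
      by (intro nn_integral_cong) (simp add: emeasure_distr[OF Pm A] Kspace)
    finally show ?thesis .
  qed
  have aeN: "AE \<omega> in P. \<omega> \<notin> N" using N by (intro AE_not_in) (auto simp: null_sets_def)
  have "annealed P T \<theta> \<psi> = measure_of (space Q) (sets Q) (emeasure Q)"
    unfolding annealed_def setsQ
  proof -
    have "space Q = space P \<times> space ?S" by (simp add: spaceQ)
    moreover have "measure_of (space P \<times> space ?S) (sets (P \<Otimes>\<^sub>M ?S))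
        (\<lambda>A. \<integral>\<^sup>+ \<omega>. emeasure (quenched T \<theta> (\<psi> \<omega>) \<omega>) (Pair \<omega> -` A) \<partial>P)
      = measure_of (space P \<times> space ?S) (sets (P \<Otimes>\<^sub>M ?S)) (emeasure Q)"
    proof (rule measure_of_eq)
      show "sets (P \<Otimes>\<^sub>M ?S) \<subseteq> Pow (space P \<times> space ?S)"
        using sets.space_closed[of "P \<Otimes>\<^sub>M ?S"] by (simp add: space_pair_measure)
      fix A assume "A \<in> sigma_sets (space P \<times> space ?S) (sets (P \<Otimes>\<^sub>M ?S))"
      then have A: "A \<in> sets (P \<Otimes>\<^sub>M ?S)"
        by (metis sets.sigma_sets_eq space_pair_measure)
      show "(\<integral>\<^sup>+ \<omega>. emeasure (quenched T \<theta> (\<psi> \<omega>) \<omega>) (Pair \<omega> -` A) \<partial>P) = emeasure Q A"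
        unfolding emQ[OF A] using aeN by (intro nn_integral_cong_AE) (auto simp: K_def)
    qed
    ultimately show "measure_of (space P \<times> space ?S) (sets (P \<Otimes>\<^sub>M ?S))
        (\<lambda>A. \<integral>\<^sup>+ \<omega>. emeasure (quenched T \<theta> (\<psi> \<omega>) \<omega>) (Pair \<omega> -` A) \<partial>P)
      = measure_of (space Q) (sets (P \<Otimes>\<^sub>M ?S)) (emeasure Q)" by simp
  qed
  then have annQ: "annealed P T \<theta> \<psi> = Q" by (simp add: measure_of_of_measure)
  have "prob_space Q"
  proof (rule prob_spaceI)
    have "space Q \<in> sets (P \<Otimes>\<^sub>M ?S)" using setsQ by auto
    from emQ[OF this] have "emeasure Q (space Q) = (\<integral>\<^sup>+\<omega>. 1 \<partial>P)"
    proof (rule trans, intro nn_integral_cong)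
      fix \<omega> assume \<omega>: "\<omega> \<in> space P"
      then have "Pair \<omega> -` space Q = space (K \<omega>)" by (auto simp: spaceQ Kspace)
      then show "emeasure (K \<omega>) (Pair \<omega> -` space Q) = 1"
        using prob_space.emeasure_space_1[OF Kp(1)[OF \<omega>]] by simp
    qed
    then show "emeasure Q (space Q) = 1" by (simp add: emeasure_space_1)
  qed
  moreover have "measure Q {z \<in> space Q. prefix_word n (snd z) = w} = (\<integral>\<omega>. Re (trace (Tlist T \<theta> w \<omega> (\<psi> \<omega>))) \<partial>P)"
    if w: "w \<in> words n" for n w
  proof -
    obtain x where x: "prefix_word n x = w" using prefix_word_exists[OF w] by auto
    have "(\<lambda>z. prefix_word n (snd z)) \<in> measurable (P \<Otimes>\<^sub>M ?S) (count_space UNIV)"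
      by measurable
    from measurable_sets[OF this, of "{w}"]
    have A: "{z \<in> space Q. prefix_word n (snd z) = w} \<in> sets (P \<Otimes>\<^sub>M ?S)"
      by (simp add: sets_eq_imp_space_eq[OF setsQ] vimage_def Int_def conj_commute)
    have nn: "0 \<le> Re (trace (Tlist T \<theta> w \<omega> (\<psi> \<omega>)))" if "\<omega> \<in> space P" for \<omega>
      using dens[OF that] that by (intro psd_trace Tlist_psd) (auto simp: density_matrix_def)
    have "emeasure Q {z \<in> space Q. prefix_word n (snd z) = w} = (\<integral>\<^sup>+\<omega>. ennreal (Re (trace (Tlist T \<theta> w \<omega> (\<psi> \<omega>)))) \<partial>P)"
      unfolding emQ[OF A]
    proof (rule nn_integral_cong_AE, rule AE_mp[OF aeN], rule AE_I2, rule impI)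
      fix \<omega> assume that: "\<omega> \<in> space P" and \<omega>: "\<omega> \<notin> N"
      show "emeasure (K \<omega>) (Pair \<omega> -` {z \<in> space Q. prefix_word n (snd z) = w}) = ennreal (Re (trace (Tlist T \<theta> w \<omega> (\<psi> \<omega>))))"
      proof -
        interpret K: prob_space "K \<omega>" by (rule Kp[OF that])
        have "Pair \<omega> -` {z \<in> space Q. prefix_word n (snd z) = w} = {y. prefix_word n y = prefix_word n x}"
          using that by (auto simp: spaceQ x)
        then show ?thesis using Kw[OF that, of n x] \<omega> by (simp add: K.emeasure_eq_measure x)
      qed
    qed
    then show ?thesis
      unfolding measure_def using nn trm[of w] by (subst integral_eq_nn_integral) auto
  qed
  ultimately show ?thesis unfolding annQ using setsQ by auto
qed

lemma annealed_expectation: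
  assumes \<psi>: "random_state P \<psi>"
  shows "(\<integral>z. g (prefix_word n (snd z)) \<partial>annealed P T \<theta> \<psi>) = (\<integral>\<omega>. wexp n g \<omega> (\<psi> \<omega>) \<partial>P)"
proof -
  let ?Q = "annealed P T \<theta> \<psi>"
  let ?S = "seq_space :: (nat \<Rightarrow> 'a) measure"
  interpret Q: prob_space ?Q using annealed_cylinder[OF \<psi>] by blast
  have sets: "sets ?Q = sets (P \<Otimes>\<^sub>M ?S)" using annealed_cylinder[OF \<psi>] by blast
  have "(\<lambda>z. prefix_word n (snd z)) \<in> measurable (P \<Otimes>\<^sub>M ?S) (count_space UNIV)"
    by measurable
  then have pm [measurable]: "(\<lambda>z. prefix_word n (snd z)) \<in> measurable ?Q (count_space UNIV)"
    using measurable_cong_sets[OF sets refl] by blast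
  have int: "integrable P (\<lambda>\<omega>. Re (trace (Tlist T \<theta> w \<omega> (\<psi> \<omega>))))" if "w \<in> words n" for w
  proof (rule integrable_const_bound[where B = 1])
    show "(\<lambda>\<omega>. Re (trace (Tlist T \<theta> w \<omega> (\<psi> \<omega>)))) \<in> borel_measurable P"
      by (rule borel_measurable_continuous_on[OF _ Tlist_measurable[OF random_state_measurable[OF \<psi>] measurable_ident_sets[OF refl]]])
         (intro continuous_intros)
    show "AE \<omega> in P. norm (Re (trace (Tlist T \<theta> w \<omega> (\<psi> \<omega>)))) \<le> 1"
    proof (rule AE_mp[OF AE_good], rule AE_I2, rule impI)
      fix \<omega> assume g: "good \<omega>"
      have d: "psd (\<psi> \<omega>)" "trace (\<psi> \<omega>) = 1"
        using \<psi> good_space[OF g] unfolding random_state_def density_matrix_def by blast+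
      have "wexp n (\<lambda>v. if v = w then 1 else 0) \<omega> (\<psi> \<omega>) = Re (trace (Tlist T \<theta> w \<omega> (\<psi> \<omega>)))"
      proof -
        have "wexp n (\<lambda>v. if v = w then 1 else 0) \<omega> (\<psi> \<omega>)
            = (\<Sum>v\<in>words n. if v = w then Re (trace (Tlist T \<theta> v \<omega> (\<psi> \<omega>))) else 0)"
          unfolding wexp_def by (intro sum.cong) auto
        then show ?thesis using that by simp
      qed
      then show "norm (Re (trace (Tlist T \<theta> w \<omega> (\<psi> \<omega>)))) \<le> 1"
        using wexp_psd_bound[OF g d(1), of "\<lambda>v. if v = w then 1 else 0" n] d(2) by (simp del: prefix_word_in_words)
    qed
  qed
  have "(\<integral>z. g (prefix_word n (snd z)) \<partial>?Q)
     = (\<integral>z. (\<Sum>w\<in>words n. g w * indicator {z \<in> space ?Q. prefix_word n (snd z) = w} z) \<partial>?Q)"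
  proof (intro Bochner_Integration.integral_cong refl)
    fix z assume z: "z \<in> space ?Q"
    have "(\<Sum>w\<in>words n. g w * indicator {z \<in> space ?Q. prefix_word n (snd z) = w} z)
       = (\<Sum>w\<in>words n. if w = prefix_word n (snd z) then g w else 0)"
      using z by (intro sum.cong) (auto simp: indicator_def)
    then show "g (prefix_word n (snd z)) = (\<Sum>w\<in>words n. g w * indicator {z \<in> space ?Q. prefix_word n (snd z) = w} z)"
      by simp
  qed
  also have "\<dots> = (\<Sum>w\<in>words n. g w * measure ?Q {z \<in> space ?Q. prefix_word n (snd z) = w})"
    by (subst Bochner_Integration.integral_sum) (auto intro!: integrable_real_indicator simp: Q.emeasure_eq_measure)
  also have "\<dots> = (\<Sum>w\<in>words n. g w * (\<integral>\<omega>. Re (trace (Tlist T \<theta> w \<omega> (\<psi> \<omega>))) \<partial>P))"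
    using annealed_cylinder[OF \<psi>] by (intro sum.cong) auto
  also have "\<dots> = (\<integral>\<omega>. wexp n g \<omega> (\<psi> \<omega>) \<partial>P)"
    unfolding wexp_def using int by (subst Bochner_Integration.integral_sum) auto
  finally show ?thesis .
qed

end

section \<open>Covariances of bounded random variables\<close>

lemma abs_mult_diff_le:
  fixes u v u' v' :: real
  assumes "\<bar>u\<bar> \<le> 1" "\<bar>v'\<bar> \<le> 1"
  shows "\<bar>u * v - u' * v'\<bar> \<le> \<bar>u - u'\<bar> + \<bar>v - v'\<bar>"
proof -
  have "u * v - u' * v' = u * (v - v') + (u - u') * v'" by (simp add: algebra_simps)
  also have "\<bar>\<dots>\<bar> \<le> \<bar>u\<bar> * \<bar>v - v'\<bar> + \<bar>u - u'\<bar> * \<bar>v'\<bar>" by (metis abs_mult abs_triangle_ineq)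
  also have "\<dots> \<le> 1 * \<bar>v - v'\<bar> + \<bar>u - u'\<bar> * 1" using assms by (intro add_mono mult_mono) auto
  finally show ?thesis by simp
qed

context prob_space
begin

lemma AE_bounded_expectation:
  fixes f :: "'a \<Rightarrow> real"
  assumes "f \<in> borel_measurable M" "AE x in M. \<bar>f x\<bar> \<le> B"
  shows "integrable M f" "expectation f \<le> B" "\<bar>expectation f\<bar> \<le> B"
proof -
  show i: "integrable M f" using assms by (intro integrable_const_bound[where B = B]) auto
  have "\<bar>expectation f\<bar> \<le> expectation (\<lambda>x. \<bar>f x\<bar>)" by (rule integral_abs_bound)
  also have "\<dots> \<le> expectation (\<lambda>_. B)" using i assms(2) by (intro integral_mono_AE) auto
  finally show "\<bar>expectation f\<bar> \<le> B" by (simp add: prob_space)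
  then show "expectation f \<le> B" by simp
qed

text \<open>Replacing both variables moves the mean of the product by at most e1 + e2 and the
  product of the means by as much again, whence the factors 2.\<close>

lemma covariance_perturb:
  fixes u v u' v' :: "'a \<Rightarrow> real"
  assumes m [measurable]: "u \<in> borel_measurable M" "v \<in> borel_measurable M" "u' \<in> borel_measurable M" "v' \<in> borel_measurable M"
    and bd: "AE x in M. \<bar>u x\<bar> \<le> 1" "AE x in M. \<bar>v x\<bar> \<le> 1" "AE x in M. \<bar>u' x\<bar> \<le> 1" "AE x in M. \<bar>v' x\<bar> \<le> 1"
    and e: "expectation (\<lambda>x. \<bar>u x - u' x\<bar>) \<le> e1" "expectation (\<lambda>x. \<bar>v x - v' x\<bar>) \<le> e2"
    and cov: "\<bar>expectation (\<lambda>x. u' x * v' x) - expectation u' * expectation v'\<bar> \<le> \<alpha>"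
  shows "\<bar>expectation (\<lambda>x. u x * v x) - expectation u * expectation v\<bar> \<le> \<alpha> + 2 * e1 + 2 * e2"
proof -
  note iu = AE_bounded_expectation(1)[OF m(1) bd(1)] AE_bounded_expectation(1)[OF m(2) bd(2)]
    AE_bounded_expectation(1)[OF m(3) bd(3)] AE_bounded_expectation(1)[OF m(4) bd(4)]
  have "AE x in M. \<bar>u x * v x\<bar> \<le> 1" using bd(1,2) by eventually_elim (simp add: abs_mult mult_le_one)
  then have iuv: "integrable M (\<lambda>x. u x * v x)" by (intro AE_bounded_expectation(1)) auto
  have "AE x in M. \<bar>u' x * v' x\<bar> \<le> 1" using bd(3,4) by eventually_elim (simp add: abs_mult mult_le_one)
  then have iuv': "integrable M (\<lambda>x. u' x * v' x)" by (intro AE_bounded_expectation(1)) auto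
  have "\<bar>expectation (\<lambda>x. u x * v x) - expectation (\<lambda>x. u' x * v' x)\<bar> = \<bar>expectation (\<lambda>x. u x * v x - u' x * v' x)\<bar>"
    using iuv iuv' by simp
  also have "\<dots> \<le> expectation (\<lambda>x. \<bar>u x * v x - u' x * v' x\<bar>)" by (rule integral_abs_bound)
  also have "\<dots> \<le> expectation (\<lambda>x. \<bar>u x - u' x\<bar> + \<bar>v x - v' x\<bar>)"
  proof (rule integral_mono_AE)
    show "AE x in M. \<bar>u x * v x - u' x * v' x\<bar> \<le> \<bar>u x - u' x\<bar> + \<bar>v x - v' x\<bar>"
      using bd(1,4) by eventually_elim (rule abs_mult_diff_le)
  qed (use iuv iuv' iu in auto)
  also have "\<dots> \<le> e1 + e2" using e iu by simp
  finally have 1: "\<bar>expectation (\<lambda>x. u x * v x) - expectation (\<lambda>x. u' x * v' x)\<bar> \<le> e1 + e2" .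
  have "\<bar>expectation u - expectation u'\<bar> \<le> e1" "\<bar>expectation v - expectation v'\<bar> \<le> e2"
    using e integral_abs_bound[of M "\<lambda>x. u x - u' x"] integral_abs_bound[of M "\<lambda>x. v x - v' x"] iu by auto
  moreover have "\<bar>expectation u * expectation v - expectation u' * expectation v'\<bar>
      \<le> \<bar>expectation u - expectation u'\<bar> + \<bar>expectation v - expectation v'\<bar>"
    by (intro abs_mult_diff_le AE_bounded_expectation(3) m bd)
  ultimately show ?thesis using 1 cov by linarith
qed

text \<open>A discretised layer-cake formula: a variable with values in [0,1] is, up to 1/N, the
  average of the indicators of \<open>N\<close> of its level sets, and the covariance of two
  averages is the average of the level-set covariances. No constant is lost in passing from events
  to variables.\<close>

lemma covariance_le_of_level_sets:
  fixes U V :: "'a \<Rightarrow> real"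
  assumes U [measurable]: "U \<in> borel_measurable M" and V [measurable]: "V \<in> borel_measurable M"
    and U01: "AE x in M. 0 \<le> U x \<and> U x \<le> 1" and V01: "AE x in M. 0 \<le> V x \<and> V x \<le> 1"
    and lev: "\<And>a b. \<bar>prob ({x \<in> space M. a \<le> U x} \<inter> {x \<in> space M. b \<le> V x})
       - prob {x \<in> space M. a \<le> U x} * prob {x \<in> space M. b \<le> V x}\<bar> \<le> \<alpha>"
  shows "\<bar>expectation (\<lambda>x. U x * V x) - expectation U * expectation V\<bar> \<le> \<alpha>"
proof -
  define A where "A W N = (\<lambda>x. (\<Sum>j\<in>{1..N}. indicator {x \<in> space M. real j / real N \<le> W x} x) / real N)"
    for W :: "'a \<Rightarrow> real" and N :: nat
  have Am [measurable]: "A W N \<in> borel_measurable M" if [measurable]: "W \<in> borel_measurable M" for W N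
    unfolding A_def by measurable
  have A1: "\<bar>A W N x\<bar> \<le> 1" if N: "N > 0" for W N x
  proof -
    have "(\<Sum>j\<in>{1..N}. indicator {x \<in> space M. real j / real N \<le> W x} x) \<le> (\<Sum>j\<in>{1..N}. 1 :: real)"
      by (intro sum_mono) (simp add: indicator_def)
    moreover have "0 \<le> (\<Sum>j\<in>{1..N}. indicator {x \<in> space M. real j / real N \<le> W x} x :: real)"
      by (intro sum_nonneg) (simp add: indicator_def)
    ultimately show ?thesis unfolding A_def abs_divide using N by (simp add: divide_le_eq)
  qed
  have approx: "\<bar>W x - A W N x\<bar> \<le> 1 / real N" if N: "N > 0" and x: "x \<in> space M" and W: "0 \<le> W x" "W x \<le> 1" for W N x
  proof -
    \<comment> \<open>The number of levels j / N reached at x, so the average of the indicators is k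
      / N.\<close>
    define k where "k = nat \<lfloor>real N * W x\<rfloor>"
    have k: "real k \<le> real N * W x" "real N * W x < real k + 1"
      using W N by (auto simp: k_def intro: of_nat_floor)
    have kN: "k \<le> N" using k(1) W N by (metis mult.right_neutral mult_left_mono of_nat_0_le_iff of_nat_le_iff order_trans)
    have "(\<Sum>j\<in>{1..N}. indicator {x \<in> space M. real j / real N \<le> W x} x) = (\<Sum>j\<in>{1..N}. if j \<in> {1..k} then 1 else (0::real))"
    proof (intro sum.cong refl)
      fix j assume "j \<in> {1..N}"
      have "real j / real N \<le> W x \<longleftrightarrow> real j \<le> real N * W x" using N by (simp add: field_simps)
      also have "\<dots> \<longleftrightarrow> j \<le> k" using k by linarith
      finally show "indicator {x \<in> space M. real j / real N \<le> W x} x = (if j \<in> {1..k} then 1 else (0::real))"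
        using x \<open>j \<in> _\<close> by (simp add: indicator_def)
    qed
    also have "\<dots> = real k"
    proof -
      have "{j \<in> {1..N}. j \<in> {1..k}} = {1..k}" using kN by auto
      then show ?thesis by (simp add: sum.inter_filter[symmetric] del: atLeastAtMost_iff)
    qed
    finally have "A W N x = real k / real N" by (simp add: A_def)
    then have "W x - A W N x = (real N * W x - real k) / real N" using N by (simp add: field_simps)
    then show ?thesis using k N by (simp add: divide_right_mono)
  qed
  have bound: "\<bar>expectation (\<lambda>x. U x * V x) - expectation U * expectation V\<bar> \<le> \<alpha> + 2 * (1 / real N) + 2 * (1 / real N)"
    if N: "N > 0" for N
  proof (rule covariance_perturb)
    show "AE x in M. \<bar>U x\<bar> \<le> 1" "AE x in M. \<bar>V x\<bar> \<le> 1"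
      using U01 V01 by (eventually_elim, auto)+
    have L1: "expectation (\<lambda>x. \<bar>W x - A W N x\<bar>) \<le> 1 / real N"
      if [measurable]: "W \<in> borel_measurable M" and W: "AE x in M. 0 \<le> W x \<and> W x \<le> 1" for W
    proof (rule AE_bounded_expectation(2))
      show "AE x in M. \<bar>\<bar>W x - A W N x\<bar>\<bar> \<le> 1 / real N"
        using W AE_space by eventually_elim (use approx[OF N] in auto)
    qed measurable
    show "expectation (\<lambda>x. \<bar>U x - A U N x\<bar>) \<le> 1 / real N" "expectation (\<lambda>x. \<bar>V x - A V N x\<bar>) \<le> 1 / real N"
      by (intro L1 U V U01 V01)+
    let ?u = "\<lambda>j. {x \<in> space M. real j / real N \<le> U x}" and ?v = "\<lambda>j. {x \<in> space M. real j / real N \<le> V x}"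
    have "A U N x * A V N x = (\<Sum>i\<in>{1..N}. \<Sum>j\<in>{1..N}. indicator (?u i \<inter> ?v j) x) / (real N * real N)" for x
      by (simp add: A_def sum_product indicator_inter_arith)
    then have "expectation (\<lambda>x. A U N x * A V N x) = (\<Sum>i\<in>{1..N}. \<Sum>j\<in>{1..N}. prob (?u i \<inter> ?v j)) / (real N * real N)"
      by (simp add: Bochner_Integration.integral_sum less_top[symmetric])
    moreover have "expectation (A U N) = (\<Sum>i\<in>{1..N}. prob (?u i)) / real N"
      "expectation (A V N) = (\<Sum>i\<in>{1..N}. prob (?v i)) / real N"
      unfolding A_def by (simp_all add: Bochner_Integration.integral_sum less_top[symmetric])
    ultimately have "expectation (\<lambda>x. A U N x * A V N x) - expectation (A U N) * expectation (A V N)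
       = (\<Sum>i\<in>{1..N}. \<Sum>j\<in>{1..N}. prob (?u i \<inter> ?v j) - prob (?u i) * prob (?v j)) / (real N * real N)"
      by (simp add: sum_product sum_subtractf diff_divide_distrib)
    also have "\<bar>\<dots>\<bar> \<le> (\<Sum>i\<in>{1..N}. \<Sum>j\<in>{1..N}. \<alpha>) / (real N * real N)"
      unfolding abs_divide abs_mult abs_of_nat
      by (rule divide_right_mono, rule order_trans[OF sum_abs], rule sum_mono, rule order_trans[OF sum_abs],
          rule sum_mono, rule lev) simp
    also have "\<dots> = \<alpha>" using N by simp
    finally show "\<bar>expectation (\<lambda>x. A U N x * A V N x) - expectation (A U N) * expectation (A V N)\<bar> \<le> \<alpha>" .
  qed (use A1[OF N] in auto)
  show ?thesis
  proof (rule field_le_epsilon)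
    fix e :: real assume e: "0 < e"
    obtain n where "inverse (real (Suc n)) < e / 4" using reals_Archimedean[of "e/4"] e by auto
    then show "\<bar>expectation (\<lambda>x. U x * V x) - expectation U * expectation V\<bar> \<le> \<alpha> + e"
      using bound[of "Suc n"] by (simp add: inverse_eq_divide)
  qed
qed

end

section \<open>Convergence to the stationary state and decorrelation\<close>

locale mixing_instrument_system = instrument_system P T \<theta>
  for P :: "'s measure" and T :: "'a::finite \<Rightarrow> 's \<Rightarrow> 'd::finite cmat \<Rightarrow> 'd cmat" and \<theta> :: "'s \<Rightarrow> 's" +
  fixes \<theta>i :: "'s \<Rightarrow> 's" and s :: "'s \<Rightarrow> 'd cmat" and r :: "nat \<Rightarrow> real"
  assumes \<theta>i_meas [measurable]: "\<theta>i \<in> measurable P P"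
    and inv1: "\<omega> \<in> space P \<Longrightarrow> \<theta>i (\<theta> \<omega>) = \<omega>" and inv2: "\<omega> \<in> space P \<Longrightarrow> \<theta> (\<theta>i \<omega>) = \<omega>"
    and s_state: "random_state P s" and s_stat: "dyn_stationary P T \<theta> s"
    and conv: "random_state P \<psi> \<Longrightarrow> 1 \<le> n \<Longrightarrow>
        (\<integral>\<omega>. trnorm (Phin T \<theta> n \<omega> (\<psi> \<omega>) - s ((\<theta> ^^ n) \<omega>)) \<partial>P) \<le> r n"
begin

lemma \<theta>in_meas [measurable]: "(\<theta>i ^^ n) \<in> measurable P P"
  by (induction n) (auto intro: measurable_comp)

lemma \<theta>in_space: "\<omega> \<in> space P \<Longrightarrow> (\<theta>i ^^ n) \<omega> \<in> space P"
  using \<theta>in_meas by (rule measurable_space)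

lemma \<theta>n_\<theta>in: "\<omega> \<in> space P \<Longrightarrow> (\<theta> ^^ n) ((\<theta>i ^^ n) \<omega>) = \<omega>"
proof (induction n)
  case (Suc n)
  have "(\<theta> ^^ Suc n) ((\<theta>i ^^ Suc n) \<omega>) = (\<theta> ^^ n) (\<theta> (\<theta>i ((\<theta>i ^^ n) \<omega>)))"
    by (simp add: funpow_swap1)
  then show ?case using Suc inv2[OF \<theta>in_space[OF Suc.prems]] by simp
qed simp

lemma \<theta>in_\<theta>n: "\<omega> \<in> space P \<Longrightarrow> (\<theta>i ^^ n) ((\<theta> ^^ n) \<omega>) = \<omega>"
proof (induction n)
  case (Suc n)
  have "(\<theta>i ^^ Suc n) ((\<theta> ^^ Suc n) \<omega>) = (\<theta>i ^^ n) (\<theta>i (\<theta> ((\<theta> ^^ n) \<omega>)))"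
    by (simp add: funpow_swap1)
  then show ?case using Suc inv1[OF \<theta>n_space[OF Suc.prems]] by simp
qed simp

text \<open>Places the instruments read along an orbit begun \<open>M\<close> steps in the past on
  the two-sided time axis by which \<open>gen_sigma\<close> is indexed.\<close>

lemma zpow_shift:
  assumes "\<omega> \<in> space P" shows "(\<theta> ^^ i) ((\<theta>i ^^ M) \<omega>) = zpow \<theta> \<theta>i (int i - int M) \<omega>"
proof (cases "M \<le> i")
  case True
  then have "(\<theta> ^^ i) ((\<theta>i ^^ M) \<omega>) = (\<theta> ^^ (i - M)) ((\<theta> ^^ M) ((\<theta>i ^^ M) \<omega>))"
    by (metis comp_apply funpow_add le_add_diff_inverse2)
  moreover have "nat (int i - int M) = i - M" by simp
  ultimately show ?thesis using True by (simp only: \<theta>n_\<theta>in[OF assms] zpow_def) simp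
next
  case False
  then have "(\<theta>i ^^ M) \<omega> = (\<theta>i ^^ i) ((\<theta>i ^^ (M - i)) \<omega>)"
    by (metis comp_apply funpow_add le_add_diff_inverse nat_le_linear)
  moreover have "nat (- (int i - int M)) = M - i" "\<not> 0 \<le> int i - int M" using False by auto
  ultimately show ?thesis by (simp only: \<theta>n_\<theta>in[OF \<theta>in_space[OF assms]] zpow_def if_False)
qed

lemma s_density: "\<omega> \<in> space P \<Longrightarrow> density_matrix (s \<omega>)"
  using s_state by (simp add: random_state_def)

lemma s_meas: "s \<in> borel_measurable P"
  using s_state by (simp add: random_state_def)

abbreviation stationary_at :: "'s \<Rightarrow> bool" where
  "stationary_at \<omega> \<equiv> \<forall>n p. Phin T \<theta> n ((\<theta> ^^ p) \<omega>) (s ((\<theta> ^^ p) \<omega>)) = s ((\<theta> ^^ (p + n)) \<omega>)"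

lemma AE_stationary: "AE \<omega> in P. stationary_at \<omega>"
proof -
  have "AE \<omega> in P. \<forall>n. Phin T \<theta> n ((\<theta> ^^ p) \<omega>) (s ((\<theta> ^^ p) \<omega>)) = s ((\<theta> ^^ n) ((\<theta> ^^ p) \<omega>))" for p
    using AE_\<theta>n[OF s_stat[unfolded dyn_stationary_def], of p] .
  then have "AE \<omega> in P. \<forall>p n. Phin T \<theta> n ((\<theta> ^^ p) \<omega>) (s ((\<theta> ^^ p) \<omega>)) = s ((\<theta> ^^ n) ((\<theta> ^^ p) \<omega>))"
    by (subst AE_all_countable) auto
  then show ?thesis
  proof (rule AE_mp, intro AE_I2 impI allI)
    fix \<omega> n p assume "\<forall>p n. Phin T \<theta> n ((\<theta> ^^ p) \<omega>) (s ((\<theta> ^^ p) \<omega>)) = s ((\<theta> ^^ n) ((\<theta> ^^ p) \<omega>))"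
    then show "Phin T \<theta> n ((\<theta> ^^ p) \<omega>) (s ((\<theta> ^^ p) \<omega>)) = s ((\<theta> ^^ (p + n)) \<omega>)"
      by (simp add: funpow_add[of n p, THEN fun_cong, unfolded comp_apply, symmetric] add.commute)
  qed
qed

definition D :: real where "D = real CARD('d)"

lemma D_pos: "0 < D"
  by (simp add: D_def)

abbreviation wexp_s :: "nat \<Rightarrow> ('a list \<Rightarrow> real) \<Rightarrow> nat \<Rightarrow> 's \<Rightarrow> real" where
  "wexp_s q g n \<omega> \<equiv> wexp q g ((\<theta> ^^ n) \<omega>) (s ((\<theta> ^^ n) \<omega>))"

text \<open>One factor \<open>D\<close> and the 3 come from the Hermitian bound, the second
  \<open>D\<close> from passing from \<open>norm\<close> to \<open>trnorm\<close>.\<close>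

lemma wexp_trnorm_bound:
  assumes "good \<omega>" "adj X = X" "\<And>w. \<bar>g w\<bar> \<le> 1"
  shows "\<bar>wexp n g \<omega> X\<bar> \<le> 3 * D\<^sup>2 * trnorm X"
proof -
  have "\<bar>wexp n g \<omega> X\<bar> \<le> 3 * D * norm X" unfolding D_def by (rule wexp_hermitian_bound[OF assms])
  also have "\<dots> \<le> 3 * D * (D * trnorm X)" using norm_le_trnorm[of X] by (intro mult_left_mono) (auto simp: D_def)
  finally show ?thesis by (simp add: power2_eq_square mult_ac)
qed

lemma trnorm_diff_integrable:
  fixes X Y :: "'s \<Rightarrow> 'd cmat"
  assumes X: "X \<in> borel_measurable P" and Y: "Y \<in> borel_measurable P"
    and d: "AE \<omega> in P. density_matrix (X \<omega>) \<and> density_matrix (Y \<omega>)"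
  shows "integrable P (\<lambda>\<omega>. trnorm (X \<omega> - Y \<omega>))"
proof (rule integrable_const_bound)
  show "AE \<omega> in P. norm (trnorm (X \<omega> - Y \<omega>)) \<le> D * (D + D)"
  proof (rule AE_mp[OF d], rule AE_I2, rule impI)
    fix \<omega> assume dm: "density_matrix (X \<omega>) \<and> density_matrix (Y \<omega>)"
    have "norm (trnorm (X \<omega> - Y \<omega>)) \<le> D * norm (X \<omega> - Y \<omega>)"
      using trnorm_le_norm[of "X \<omega> - Y \<omega>"] trnorm_nonneg[of "X \<omega> - Y \<omega>"] by (simp add: D_def)
    also have "\<dots> \<le> D * (norm (X \<omega>) + norm (Y \<omega>))"
      using D_pos by (intro mult_left_mono norm_triangle_ineq4) auto
    also have "\<dots> \<le> D * (D + D)"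
      using dm density_matrix_norm_le[of "X \<omega>"] density_matrix_norm_le[of "Y \<omega>"] unfolding D_def by (intro mult_left_mono add_mono) auto
    finally show "norm (trnorm (X \<omega> - Y \<omega>)) \<le> D * (D + D)" .
  qed
  show "(\<lambda>\<omega>. trnorm (X \<omega> - Y \<omega>)) \<in> borel_measurable P"
    using measurable_compose[OF borel_measurable_diff[OF X Y] trnorm_measurable] by simp
qed

lemma Phin_density: "good \<omega> \<Longrightarrow> density_matrix \<rho> \<Longrightarrow> density_matrix (Phin T \<theta> n \<omega> \<rho>)"
  by (simp add: density_matrix_def Phin_psd good_space good_trace_Phin)

lemma density_diff_hermitian: "density_matrix X \<Longrightarrow> density_matrix Y \<Longrightarrow> adj (X - Y) = X - Y"
  by (simp add: adj_diff density_matrix_def psd_hermitian)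

lemma random_state_at_\<theta>n:
  assumes "random_state P \<psi>" shows "(\<lambda>\<omega>. \<psi> ((\<theta> ^^ p) \<omega>)) \<in> borel_measurable P"
  using assms by (intro measurable_compose[OF \<theta>n_meas]) (simp add: random_state_def)

lemma conv_shift:
  fixes p :: nat
  assumes \<psi>: "random_state P \<psi>" and n: "1 \<le> n"
  defines "h \<equiv> \<lambda>\<omega>. trnorm (Phin T \<theta> n ((\<theta> ^^ p) \<omega>) (\<psi> ((\<theta> ^^ p) \<omega>)) - s ((\<theta> ^^ (p + n)) \<omega>))"
  shows "integrable P h" "(\<integral>\<omega>. h \<omega> \<partial>P) \<le> r n"
proof -
  have \<psi>m: "\<psi> \<in> borel_measurable P" using \<psi> by (simp add: random_state_def)
  have m: "(\<lambda>\<omega>. Phin T \<theta> n \<omega> (\<psi> \<omega>)) \<in> borel_measurable P"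
    by (rule Phin_measurable[OF \<psi>m measurable_ident_sets[OF refl]])
  have sm: "(\<lambda>\<omega>. s ((\<theta> ^^ n) \<omega>)) \<in> borel_measurable P" for n
    by (rule random_state_at_\<theta>n[OF s_state])
  have f: "(\<lambda>\<omega>. trnorm (Phin T \<theta> n \<omega> (\<psi> \<omega>) - s ((\<theta> ^^ n) \<omega>))) \<in> borel_measurable P"
    using measurable_compose[OF borel_measurable_diff[OF m sm] trnorm_measurable] .
  have e: "(\<theta> ^^ n) ((\<theta> ^^ p) \<omega>) = (\<theta> ^^ (p + n)) \<omega>" for \<omega>
    by (metis add.commute comp_apply funpow_add)
  show "(\<integral>\<omega>. h \<omega> \<partial>P) \<le> r n"
    using integral_\<theta>n[OF f, of p] conv[OF \<psi> n] by (simp add: h_def e)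
  show "integrable P h"
    unfolding h_def
  proof (rule trnorm_diff_integrable)
    show "(\<lambda>\<omega>. Phin T \<theta> n ((\<theta> ^^ p) \<omega>) (\<psi> ((\<theta> ^^ p) \<omega>))) \<in> borel_measurable P"
      by (rule Phin_measurable[OF random_state_at_\<theta>n[OF \<psi>] \<theta>n_meas])
    show "AE \<omega> in P. density_matrix (Phin T \<theta> n ((\<theta> ^^ p) \<omega>) (\<psi> ((\<theta> ^^ p) \<omega>))) \<and> density_matrix (s ((\<theta> ^^ (p + n)) \<omega>))"
    proof (rule AE_mp[OF AE_good], rule AE_I2, rule impI)
      fix \<omega> assume g: "good \<omega>"
      have "density_matrix (\<psi> ((\<theta> ^^ p) \<omega>))"
        using \<psi> \<theta>n_space[OF good_space[OF g]] unfolding random_state_def by blast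
      then show "density_matrix (Phin T \<theta> n ((\<theta> ^^ p) \<omega>) (\<psi> ((\<theta> ^^ p) \<omega>))) \<and> density_matrix (s ((\<theta> ^^ (p + n)) \<omega>))"
        using Phin_density[OF good_\<theta>n[OF g]] s_density[OF \<theta>n_space[OF good_space[OF g]]] by blast
    qed
  qed (rule sm)
qed

lemma integral_abs_le:
  fixes f h :: "'s \<Rightarrow> real"
  assumes "f \<in> borel_measurable P" "integrable P h" "AE \<omega> in P. \<bar>f \<omega>\<bar> \<le> c * h \<omega>"
  shows "integrable P f" "\<bar>\<integral>\<omega>. f \<omega> \<partial>P\<bar> \<le> c * (\<integral>\<omega>. h \<omega> \<partial>P)"
proof -
  have i: "integrable P (\<lambda>\<omega>. c * h \<omega>)" using assms(2) by simp
  show fi: "integrable P f"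
    by (rule Bochner_Integration.integrable_bound[OF i assms(1)])
       (rule AE_mp[OF assms(3)], auto)
  have "\<bar>\<integral>\<omega>. f \<omega> \<partial>P\<bar> \<le> (\<integral>\<omega>. \<bar>f \<omega>\<bar> \<partial>P)" by (rule integral_abs_bound)
  also have "\<dots> \<le> (\<integral>\<omega>. c * h \<omega> \<partial>P)" using fi i assms(3) by (intro integral_mono_AE) auto
  finally show "\<bar>\<integral>\<omega>. f \<omega> \<partial>P\<bar> \<le> c * (\<integral>\<omega>. h \<omega> \<partial>P)" by simp
qed

text \<open>Ignoring the first \<open>n\<close> outcomes sums over them, which propagates the state
  by \<open>Phin\<close>.\<close>

lemma wexp_delay:
  assumes "\<omega> \<in> space P"
  shows "wexp (n + q) (\<lambda>v. g (drop n v)) \<omega> X = wexp q g ((\<theta> ^^ n) \<omega>) (Phin T \<theta> n \<omega> X)"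
  using wexp_split[of n q "\<lambda>_. 1" g \<omega> X] assms by (simp add: Phin_eq_sum wexp_sum[OF \<theta>n_space])

definition weighted :: "nat \<Rightarrow> ('a list \<Rightarrow> real) \<Rightarrow> 's \<Rightarrow> 'd cmat \<Rightarrow> 'd cmat" where
  "weighted p f \<omega> X = (\<Sum>u\<in>words p. f u *\<^sub>R Tlist T \<theta> u \<omega> X)"

lemma trace_weighted: "Re (trace (weighted p f \<omega> X)) = wexp p f \<omega> X"
  by (simp add: weighted_def wexp_def trace_sum trace_scaleR)

lemma weighted_psd: "\<omega> \<in> space P \<Longrightarrow> psd X \<Longrightarrow> (\<And>w. 0 \<le> f w) \<Longrightarrow> psd (weighted p f \<omega> X)"
  unfolding weighted_def by (intro psd_sum psd_scaleR Tlist_psd)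

lemma weighted_measurable:
  assumes "\<rho> \<in> borel_measurable P" "h \<in> measurable P P"
  shows "(\<lambda>\<omega>. weighted p f (h \<omega>) (\<rho> \<omega>)) \<in> borel_measurable P"
  unfolding weighted_def
  by (intro borel_measurable_sum borel_measurable_scaleR borel_measurable_const Tlist_measurable assms)

lemma wexp_split_delay:
  assumes \<omega>: "\<omega> \<in> space P"
  shows "wexp (p + (n + q)) (\<lambda>w. f (take p w) * g (drop n (drop p w))) \<omega> X
    = wexp q g ((\<theta> ^^ (p + n)) \<omega>) (Phin T \<theta> n ((\<theta> ^^ p) \<omega>) (weighted p f \<omega> X))"
proof -
  have e: "(\<theta> ^^ n) ((\<theta> ^^ p) \<omega>) = (\<theta> ^^ (p + n)) \<omega>"
    by (metis add.commute comp_apply funpow_add)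
  have sp: "(\<theta> ^^ p) \<omega> \<in> space P" "(\<theta> ^^ (p + n)) \<omega> \<in> space P" using \<theta>n_space[OF \<omega>] by auto
  have "wexp (p + (n + q)) (\<lambda>w. f (take p w) * g (drop n (drop p w))) \<omega> X
     = (\<Sum>u\<in>words p. f u * wexp q g ((\<theta> ^^ (p + n)) \<omega>) (Phin T \<theta> n ((\<theta> ^^ p) \<omega>) (Tlist T \<theta> u \<omega> X)))"
    unfolding wexp_split[of p "n + q" f "\<lambda>v. g (drop n v)"] by (simp only: wexp_delay[OF sp(1)] e)
  also have "\<dots> = wexp q g ((\<theta> ^^ (p + n)) \<omega>) (Phin T \<theta> n ((\<theta> ^^ p) \<omega>) (weighted p f \<omega> X))"
    unfolding weighted_def
    by (simp only: clinear_map_sum[OF Phin_clinear[OF sp(1)]] clinear_map_scaleR[OF Phin_clinear[OF sp(1)]]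
        wexp_sum[OF sp(2)] wexp_scaleR[OF sp(2)])
  finally show ?thesis .
qed

text \<open>The random state to which \<open>conv\<close> is applied is the weighted post-measurement state completed
  to trace one by \<open>s\<close>. Almost surely its trace before completion is at most one; on the exceptional
  set it is replaced by \<open>s\<close>, since a random state is required to be a density matrix everywhere.\<close>
lemma decorrelate_state:
  assumes f: "\<And>w. 0 \<le> f w" "\<And>w. f w \<le> 1" and g: "\<And>w. \<bar>g w\<bar> \<le> 1" and n: "1 \<le> n"
  shows "\<bar>(\<integral>\<omega>. wexp (p + (n + q)) (\<lambda>w. f (take p w) * g (drop n (drop p w))) \<omega> (s \<omega>) \<partial>P)
     - (\<integral>\<omega>. wexp p f \<omega> (s \<omega>) * wexp_s q g (p + n) \<omega> \<partial>P)\<bar> \<le> 3 * D\<^sup>2 * r n"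
proof -
  \<comment> \<open>A random state is a function of the environment at its own starting time, while
    the weighted state is made \<open>p\<close> steps earlier; the inverse of \<theta> moves it
    there. At the environment shifted by \<open>p\<close> the pullback cancels.\<close>
  define \<psi> where "\<psi> \<omega> = (if Re (trace (weighted p f ((\<theta>i ^^ p) \<omega>) (s ((\<theta>i ^^ p) \<omega>)))) \<le> 1
     then weighted p f ((\<theta>i ^^ p) \<omega>) (s ((\<theta>i ^^ p) \<omega>))
        + (1 - Re (trace (weighted p f ((\<theta>i ^^ p) \<omega>) (s ((\<theta>i ^^ p) \<omega>))))) *\<^sub>R s \<omega> else s \<omega>)" for \<omega>
  have wm: "(\<lambda>\<omega>. weighted p f ((\<theta>i ^^ p) \<omega>) (s ((\<theta>i ^^ p) \<omega>))) \<in> borel_measurable P"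
    by (intro weighted_measurable measurable_compose[OF \<theta>in_meas s_meas] \<theta>in_meas)
  have tm: "(\<lambda>\<omega>. Re (trace (weighted p f ((\<theta>i ^^ p) \<omega>) (s ((\<theta>i ^^ p) \<omega>))))) \<in> borel_measurable P"
    by (rule borel_measurable_continuous_on[OF _ wm]) (intro continuous_intros)
  have \<psi>: "random_state P \<psi>"
    unfolding random_state_def
  proof
    show "\<psi> \<in> borel_measurable P"
      unfolding \<psi>_def using wm tm s_meas
      by (intro measurable_If borel_measurable_add borel_measurable_scaleR borel_measurable_diff borel_measurable_const)
         (auto intro: borel_measurable_le)
    show "\<forall>\<omega>\<in>space P. density_matrix (\<psi> \<omega>)"
    proof
      fix \<omega> assume \<omega>: "\<omega> \<in> space P"
      define X where "X = weighted p f ((\<theta>i ^^ p) \<omega>) (s ((\<theta>i ^^ p) \<omega>))"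
      have X: "psd X" unfolding X_def using s_density[OF \<theta>in_space[OF \<omega>]] f
        by (intro weighted_psd \<theta>in_space \<omega>) (auto simp: density_matrix_def)
      have s: "psd (s \<omega>)" "trace (s \<omega>) = 1" using s_density[OF \<omega>] by (auto simp: density_matrix_def)
      show "density_matrix (\<psi> \<omega>)"
      proof (cases "Re (trace X) \<le> 1")
        case True
        have "psd (X + (1 - Re (trace X)) *\<^sub>R s \<omega>)" using True by (intro psd_add psd_scaleR X s) simp
        moreover have "trace (X + (1 - Re (trace X)) *\<^sub>R s \<omega>) = 1"
          using psd_trace(2)[OF X] by (simp only: trace_add trace_scaleR s complex_eq_iff) simp
        ultimately show ?thesis using True by (simp add: \<psi>_def X_def[symmetric] density_matrix_def)
      next
        case False
        then show ?thesis using s by (simp add: \<psi>_def X_def[symmetric] density_matrix_def)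
      qed
    qed
  qed
  define h where "h \<omega> = trnorm (Phin T \<theta> n ((\<theta> ^^ p) \<omega>) (\<psi> ((\<theta> ^^ p) \<omega>)) - s ((\<theta> ^^ (p + n)) \<omega>))" for \<omega>
  have h: "integrable P h" "(\<integral>\<omega>. h \<omega> \<partial>P) \<le> r n"
    unfolding h_def by (rule conv_shift[OF \<psi> n])+
  define E where "E \<omega> = wexp (p + (n + q)) (\<lambda>w. f (take p w) * g (drop n (drop p w))) \<omega> (s \<omega>)" for \<omega>
  define UV where "UV \<omega> = wexp p f \<omega> (s \<omega>) * wexp_s q g (p + n) \<omega>" for \<omega>
  have Em: "E \<in> borel_measurable P" unfolding E_def
    by (rule wexp_measurable[OF s_meas measurable_ident_sets[OF refl]])
  have UVm: "UV \<in> borel_measurable P" unfolding UV_def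
    by (intro borel_measurable_times wexp_measurable[OF s_meas measurable_ident_sets[OF refl]]
        wexp_measurable[OF random_state_at_\<theta>n[OF s_state] \<theta>n_meas])
  have f1: "\<bar>f w\<bar> \<le> 1" for w using f[of w] by simp
  have bE: "AE \<omega> in P. \<bar>E \<omega>\<bar> \<le> 1"
  proof (rule AE_mp[OF AE_good], rule AE_I2, rule impI)
    fix \<omega> assume g': "good \<omega>"
    have fg: "\<bar>f (take p w) * g (drop n (drop p w))\<bar> \<le> 1" for w
      unfolding abs_mult by (intro mult_le_one f1 g) auto
    show "\<bar>E \<omega>\<bar> \<le> 1"
      using wexp_psd_bound[OF g' _ fg, of "s \<omega>"] s_density[OF good_space[OF g']]
      by (simp add: E_def density_matrix_def)
  qed
  have iE: "integrable P E" using bE by (intro integrable_const_bound[OF _ Em, of 1]) simp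
  have key: "AE \<omega> in P. \<bar>E \<omega> - UV \<omega>\<bar> \<le> 3 * D\<^sup>2 * h \<omega>"
  proof (rule AE_mp[OF AE_good], rule AE_mp[OF AE_stationary], rule AE_I2, intro impI)
    fix \<omega> assume st: "stationary_at \<omega>" and g': "good \<omega>"
    define X where "X = weighted p f \<omega> (s \<omega>)"
    define U where "U = wexp p f \<omega> (s \<omega>)"
    let ?\<omega>p = "(\<theta> ^^ p) \<omega>" and ?\<omega>n = "(\<theta> ^^ (p + n)) \<omega>"
    have \<omega>: "\<omega> \<in> space P" by (rule good_space[OF g'])
    note sp = \<theta>n_space[OF \<omega>]
    have U: "Re (trace X) = U" by (simp add: X_def U_def trace_weighted)
    have "U \<le> 1"
      using wexp_psd_bound[OF g', of "s \<omega>" f p] f1 s_density[OF \<omega>] by (simp add: U_def density_matrix_def)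
    then have \<psi>_eq: "\<psi> ?\<omega>p = X + (1 - U) *\<^sub>R s ?\<omega>p"
      unfolding \<psi>_def \<theta>in_\<theta>n[OF \<omega>] X_def[symmetric] U by simp
    have "Phin T \<theta> n ?\<omega>p (\<psi> ?\<omega>p) = Phin T \<theta> n ?\<omega>p X + (1 - U) *\<^sub>R s ?\<omega>n"
      unfolding \<psi>_eq
      by (simp only: clinear_map_add[OF Phin_clinear[OF sp]] clinear_map_scaleR[OF Phin_clinear[OF sp]] st[rule_format])
    \<comment> \<open>By stationarity the completing part is carried to (1 - U) s, and subtracting s
      leaves -U s: the error controlled by (H3) is exactly the decorrelation error.\<close>
    then have "Phin T \<theta> n ?\<omega>p (\<psi> ?\<omega>p) - s ?\<omega>n = Phin T \<theta> n ?\<omega>p X - U *\<^sub>R s ?\<omega>n"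
      by (simp add: scaleR_diff_left)
    moreover have "E \<omega> = wexp q g ?\<omega>n (Phin T \<theta> n ?\<omega>p X)"
      unfolding E_def X_def by (rule wexp_split_delay[OF \<omega>])
    ultimately have "E \<omega> - UV \<omega> = wexp q g ?\<omega>n (Phin T \<theta> n ?\<omega>p (\<psi> ?\<omega>p) - s ?\<omega>n)"
      by (simp add: UV_def U_def[symmetric] wexp_diff[OF sp] wexp_scaleR[OF sp])
    also have "\<bar>\<dots>\<bar> \<le> 3 * D\<^sup>2 * h \<omega>"
      unfolding h_def
    proof (rule wexp_trnorm_bound[OF good_\<theta>n[OF g'] density_diff_hermitian g])
      show "density_matrix (Phin T \<theta> n ?\<omega>p (\<psi> ?\<omega>p))"
        using \<psi> sp by (intro Phin_density good_\<theta>n g') (simp add: random_state_def)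
    qed (rule s_density[OF sp])
    finally show "\<bar>E \<omega> - UV \<omega>\<bar> \<le> 3 * D\<^sup>2 * h \<omega>" .
  qed
  note ab = integral_abs_le[OF borel_measurable_diff[OF Em UVm] h(1) key]
  have iUV: "integrable P UV"
    using Bochner_Integration.integrable_diff[OF iE ab(1)] by simp
  have "\<bar>(\<integral>\<omega>. E \<omega> \<partial>P) - (\<integral>\<omega>. UV \<omega> \<partial>P)\<bar> \<le> 3 * D\<^sup>2 * (\<integral>\<omega>. h \<omega> \<partial>P)"
    using ab(2) iE iUV by simp
  also have "\<dots> \<le> 3 * D\<^sup>2 * r n" using h(2) by (intro mult_left_mono) auto
  finally show ?thesis unfolding E_def UV_def .
qed

text \<open>The maximally mixed state, used as the deterministic start of the propagation, so that
  the propagated state depends on the instruments only.\<close>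

definition \<rho>0 :: "'d cmat" where "\<rho>0 = (1 / D) *\<^sub>R mat 1"

lemma \<rho>0_density: "density_matrix \<rho>0"
proof -
  have "psd \<rho>0" unfolding \<rho>0_def using D_pos by (intro psd_scaleR psd_mat_1) simp
  moreover have "trace \<rho>0 = 1"
    unfolding \<rho>0_def trace_scaleR trace_I by (simp add: D_def scaleR_conv_of_real)
  ultimately show ?thesis by (simp add: density_matrix_def)
qed

lemma \<rho>0_random: "random_state P (\<lambda>_. \<rho>0)"
  by (simp add: random_state_def \<rho>0_density)

lemma future_approx:
  assumes g: "\<And>w. \<bar>g w\<bar> \<le> 1" and n: "1 \<le> n"
  shows "(\<integral>\<omega>. \<bar>wexp_s q g (k + n) \<omega>
      - wexp (n + q) (\<lambda>v. g (drop n v)) ((\<theta> ^^ k) \<omega>) \<rho>0\<bar> \<partial>P) \<le> 3 * D\<^sup>2 * r n"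
proof -
  note c = conv_shift[OF \<rho>0_random n, of k]
  have e: "(\<theta> ^^ n) ((\<theta> ^^ k) \<omega>) = (\<theta> ^^ (k + n)) \<omega>" for \<omega>
    by (metis add.commute comp_apply funpow_add)
  let ?f = "\<lambda>\<omega>. \<bar>wexp_s q g (k + n) \<omega> - wexp (n + q) (\<lambda>v. g (drop n v)) ((\<theta> ^^ k) \<omega>) \<rho>0\<bar>"
  have "\<bar>\<integral>\<omega>. ?f \<omega> \<partial>P\<bar> \<le> 3 * D\<^sup>2 * (\<integral>\<omega>. trnorm (Phin T \<theta> n ((\<theta> ^^ k) \<omega>) \<rho>0 - s ((\<theta> ^^ (k + n)) \<omega>)) \<partial>P)"
  proof (rule integral_abs_le(2)[OF _ c(1)])
    show "?f \<in> borel_measurable P"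
      by (intro borel_measurable_abs borel_measurable_diff wexp_measurable[OF random_state_at_\<theta>n[OF s_state] \<theta>n_meas]
          wexp_measurable[OF borel_measurable_const \<theta>n_meas])
    show "AE \<omega> in P. \<bar>?f \<omega>\<bar> \<le> 3 * D\<^sup>2 * trnorm (Phin T \<theta> n ((\<theta> ^^ k) \<omega>) \<rho>0 - s ((\<theta> ^^ (k + n)) \<omega>))"
    proof (rule AE_mp[OF AE_good], rule AE_I2, rule impI)
      fix \<omega> assume g': "good \<omega>"
      note sp = \<theta>n_space[OF good_space[OF g']]
      have "?f \<omega> = \<bar>wexp q g ((\<theta> ^^ (k + n)) \<omega>) (Phin T \<theta> n ((\<theta> ^^ k) \<omega>) \<rho>0 - s ((\<theta> ^^ (k + n)) \<omega>))\<bar>"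
        by (simp only: wexp_delay[OF sp] e wexp_diff[OF sp] abs_minus_commute)
      also have "\<dots> \<le> 3 * D\<^sup>2 * trnorm (Phin T \<theta> n ((\<theta> ^^ k) \<omega>) \<rho>0 - s ((\<theta> ^^ (k + n)) \<omega>))"
        by (intro wexp_trnorm_bound good_\<theta>n g' density_diff_hermitian g Phin_density \<rho>0_density s_density sp)
      finally show "\<bar>?f \<omega>\<bar> \<le> 3 * D\<^sup>2 * trnorm (Phin T \<theta> n ((\<theta> ^^ k) \<omega>) \<rho>0 - s ((\<theta> ^^ (k + n)) \<omega>))"
        by simp
    qed
  qed
  also have "\<dots> \<le> 3 * D\<^sup>2 * r n" using c(2) by (intro mult_left_mono) auto
  finally show ?thesis by simp
qed

text \<open>Restarting \<open>n\<close> steps before time zero becomes, after translation by the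
  invariant measure, restarting at time zero and looking at time \<open>n\<close>.\<close>

lemma past_approx:
  assumes g: "\<And>w. \<bar>g w\<bar> \<le> 1" and n: "1 \<le> n"
  shows "(\<integral>\<omega>. \<bar>wexp q g \<omega> (s \<omega>) - wexp (n + q) (\<lambda>v. g (drop n v)) ((\<theta>i ^^ n) \<omega>) \<rho>0\<bar> \<partial>P) \<le> 3 * D\<^sup>2 * r n"
proof -
  let ?f = "\<lambda>\<omega>. \<bar>wexp q g \<omega> (s \<omega>) - wexp (n + q) (\<lambda>v. g (drop n v)) ((\<theta>i ^^ n) \<omega>) \<rho>0\<bar>"
  have m: "?f \<in> borel_measurable P"
    by (intro borel_measurable_abs borel_measurable_diff wexp_measurable[OF s_meas measurable_ident_sets[OF refl]]
        wexp_measurable[OF borel_measurable_const \<theta>in_meas])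
  have "(\<integral>\<omega>. ?f \<omega> \<partial>P) = (\<integral>\<omega>. ?f ((\<theta> ^^ n) \<omega>) \<partial>P)"
    by (rule integral_\<theta>n[OF m, symmetric])
  also have "\<dots> = (\<integral>\<omega>. \<bar>wexp_s q g (0 + n) \<omega>
      - wexp (n + q) (\<lambda>v. g (drop n v)) ((\<theta> ^^ 0) \<omega>) \<rho>0\<bar> \<partial>P)"
    by (intro Bochner_Integration.integral_cong refl) (simp add: \<theta>in_\<theta>n)
  also have "\<dots> \<le> 3 * D\<^sup>2 * r n" by (rule future_approx[OF g n])
  finally show ?thesis .
qed

text \<open>\<open>J\<close> need only contain the times at which the orbit of \<open>h\<close>
  reads an instrument. With a deterministic initial state nothing else about the environment
  enters.\<close>

lemma wexp_level_set:
  assumes h: "h \<in> measurable P P"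
    and J: "\<And>i. 1 \<le> i \<Longrightarrow> i \<le> k \<Longrightarrow> \<exists>j\<in>J. \<forall>\<omega>\<in>space P. (\<theta> ^^ i) (h \<omega>) = zpow \<theta> \<theta>i j \<omega>"
  shows "{\<omega> \<in> space P. x \<le> wexp k f (h \<omega>) \<rho>0} \<in> gen_sigma P T \<theta> \<theta>i J"
proof -
  let ?G = "{(\<lambda>\<omega>. T a (zpow \<theta> \<theta>i j \<omega>) X) -` B \<inter> space P | a X j B. j \<in> J \<and> B \<in> sets borel}"
  define N where "N = sigma (space P) ?G"
  have G: "?G \<subseteq> Pow (space P)" by auto
  have N: "space N = space P" "sets N = gen_sigma P T \<theta> \<theta>i J"
    unfolding N_def gen_sigma_def using G by (simp_all add: space_measure_of sets_measure_of)
  have gen: "(\<lambda>\<omega>. T a (zpow \<theta> \<theta>i j \<omega>) X) \<in> borel_measurable N" if "j \<in> J" for a X j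
  proof (rule measurableI)
    fix B :: "'d cmat set" assume "B \<in> sets borel"
    then have "(\<lambda>\<omega>. T a (zpow \<theta> \<theta>i j \<omega>) X) -` B \<inter> space P \<in> ?G" using that by blast
    then show "(\<lambda>\<omega>. T a (zpow \<theta> \<theta>i j \<omega>) X) -` B \<inter> space N \<in> sets N"
      unfolding N gen_sigma_def by (rule sigma_sets.Basic)
  qed simp
  have T: "(\<lambda>\<omega>. T a ((\<theta> ^^ i) (h \<omega>)) X) \<in> borel_measurable N" if i: "1 \<le> i" "i \<le> k" for i a X
  proof -
    obtain j where j: "j \<in> J" "\<forall>\<omega>\<in>space P. (\<theta> ^^ i) (h \<omega>) = zpow \<theta> \<theta>i j \<omega>" using J[OF i] by blast
    have "(\<lambda>\<omega>. T a ((\<theta> ^^ i) (h \<omega>)) X) \<in> borel_measurable N \<longleftrightarrow> (\<lambda>\<omega>. T a (zpow \<theta> \<theta>i j \<omega>) X) \<in> borel_measurable N"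
      using j(2) N(1) by (intro measurable_cong) simp
    then show ?thesis using gen[OF j(1)] by blast
  qed
  have Tm: "(\<lambda>\<omega>. Tlist T \<theta> w (h \<omega>) \<rho>0) \<in> borel_measurable N" if "w \<in> words k" for w
    using that T measurable_space[OF h] by (intro Tlist_measurable_gen) (auto simp: N(1) words_def)
  have "(\<lambda>\<omega>. wexp k f (h \<omega>) \<rho>0) \<in> borel_measurable N"
    unfolding wexp_def
  proof (intro borel_measurable_sum borel_measurable_times borel_measurable_const)
    fix w :: "'a list" assume w: "w \<in> words k"
    show "(\<lambda>\<omega>. Re (trace (Tlist T \<theta> w (h \<omega>) \<rho>0))) \<in> borel_measurable N"
      by (rule borel_measurable_continuous_on[OF _ Tm[OF w]]) (intro continuous_intros)
  qed
  then have "{\<omega> \<in> space N. x \<le> wexp k f (h \<omega>) \<rho>0} \<in> sets N" by measurable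
  then show ?thesis by (simp add: N)
qed

text \<open>The covariance of two events is at most one, which bounds the sets in both suprema;
  without this a real supremum would carry no information.\<close>

lemma alpha_mix_bound:
  assumes "B \<in> gen_sigma P T \<theta> \<theta>i {j. j \<le> int k}" "C \<in> gen_sigma P T \<theta> \<theta>i {j. int k + int n \<le> j}"
  shows "\<bar>prob (B \<inter> C) - prob B * prob C\<bar> \<le> alpha_mix P T \<theta> \<theta>i n"
proof -
  have le1: "\<bar>prob (B \<inter> C) - prob B * prob C\<bar> \<le> 1" for B C
    using mult_le_one[of "prob B" "prob C"] prob_le_1[of "B \<inter> C"] measure_nonneg[of P]
    by (smt (verit) mult_nonneg_nonneg prob_le_1)
  have "\<bar>prob (B \<inter> C) - prob B * prob C\<bar>
     \<le> alpha_sets P (gen_sigma P T \<theta> \<theta>i {j. j \<le> int k}) (gen_sigma P T \<theta> \<theta>i {j. int k + int n \<le> j})"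
    unfolding alpha_sets_def
    by (rule cSUP_upper2[where x = "(B, C)"]) (use assms le1 in \<open>auto intro!: bdd_aboveI2[where M = 1]\<close>)
  also have "\<dots> \<le> alpha_mix P T \<theta> \<theta>i n"
    unfolding alpha_mix_def
  proof (rule cSUP_upper)
    show "bdd_above (range (\<lambda>k. alpha_sets P (gen_sigma P T \<theta> \<theta>i {j. j \<le> int k}) (gen_sigma P T \<theta> \<theta>i {j. int k + int n \<le> j})))"
    proof (rule bdd_aboveI2)
      fix k :: nat
      have "{} \<in> gen_sigma P T \<theta> \<theta>i J" for J unfolding gen_sigma_def by (rule sigma_sets.Empty)
      then show "alpha_sets P (gen_sigma P T \<theta> \<theta>i {j. j \<le> int k}) (gen_sigma P T \<theta> \<theta>i {j. int k + int n \<le> j}) \<le> 1"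
        unfolding alpha_sets_def using le1 by (intro cSUP_least) auto
    qed
  qed simp
  finally show ?thesis .
qed

lemma wexp_state_01:
  assumes "good \<omega>" "density_matrix X" "\<And>w. 0 \<le> g w" "\<And>w. g w \<le> 1"
  shows "0 \<le> wexp n g \<omega> X \<and> wexp n g \<omega> X \<le> 1"
proof -
  have "\<bar>g w\<bar> \<le> 1" for w using assms(3,4)[of w] by simp
  then show ?thesis
    using wexp_psd_bound[OF assms(1), of X g n] wexp_nonneg[OF good_space[OF assms(1)], of X g n] assms(2,3)
    by (simp add: density_matrix_def)
qed

text \<open>Both factors are replaced by functions of finitely many instruments. The first reads
  times up to \<open>p\<close>; the second restarts at p + k and reads times from p + k + 1 on. This
  leaves a mixing gap of \<open>Suc k\<close>, and \<open>l\<close> steps in which the start is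
  forgotten.\<close>

lemma decorrelate_environment:
  assumes f: "\<And>w. 0 \<le> f w" "\<And>w. f w \<le> 1" and g: "\<And>w. 0 \<le> g w" "\<And>w. g w \<le> 1"
    and l: "1 \<le> l" and r0: "r \<longlonglongrightarrow> 0"
  shows "\<bar>(\<integral>\<omega>. wexp p f \<omega> (s \<omega>) * wexp_s q g (p + k + l) \<omega> \<partial>P)
     - (\<integral>\<omega>. wexp p f \<omega> (s \<omega>) \<partial>P) * (\<integral>\<omega>. wexp_s q g (p + k + l) \<omega> \<partial>P)\<bar>
     \<le> 6 * D\<^sup>2 * r l + alpha_mix P T \<theta> \<theta>i (Suc k)"
proof -
  let ?c = "\<bar>(\<integral>\<omega>. wexp p f \<omega> (s \<omega>) * wexp_s q g (p + k + l) \<omega> \<partial>P)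
     - (\<integral>\<omega>. wexp p f \<omega> (s \<omega>) \<partial>P) * (\<integral>\<omega>. wexp_s q g (p + k + l) \<omega> \<partial>P)\<bar>"
  have abs1: "\<bar>f w\<bar> \<le> 1" "\<bar>g w\<bar> \<le> 1" for w using f[of w] g[of w] by auto
  \<comment> \<open>The past is restarted \<open>M\<close> steps back. \<open>M\<close> is free
    because the past sigma-algebra contains all negative times, so the term in r M is removed by a
    limit at the end.\<close>
  have M: "?c \<le> alpha_mix P T \<theta> \<theta>i (Suc k) + 2 * (3 * D\<^sup>2 * r M) + 2 * (3 * D\<^sup>2 * r l)" if M: "1 \<le> M" for M
  proof (rule covariance_perturb)
    let ?u' = "\<lambda>\<omega>. wexp (M + p) (\<lambda>v. f (drop M v)) ((\<theta>i ^^ M) \<omega>) \<rho>0"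
    let ?v' = "\<lambda>\<omega>. wexp (l + q) (\<lambda>v. g (drop l v)) ((\<theta> ^^ (p + k)) \<omega>) \<rho>0"
    show m1: "(\<lambda>\<omega>. wexp p f \<omega> (s \<omega>)) \<in> borel_measurable P"
      by (rule wexp_measurable[OF s_meas measurable_ident_sets[OF refl]])
    show "(\<lambda>\<omega>. wexp_s q g (p + k + l) \<omega>) \<in> borel_measurable P"
      by (rule wexp_measurable[OF random_state_at_\<theta>n[OF s_state] \<theta>n_meas])
    show u'm: "?u' \<in> borel_measurable P" by (rule wexp_measurable[OF borel_measurable_const \<theta>in_meas])
    show v'm: "?v' \<in> borel_measurable P" by (rule wexp_measurable[OF borel_measurable_const \<theta>n_meas])
    show "AE \<omega> in P. \<bar>wexp p f \<omega> (s \<omega>)\<bar> \<le> 1"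
      by (rule AE_mp[OF AE_good], rule AE_I2, rule impI)
         (use wexp_state_01[OF _ _ f] s_density good_space in fastforce)
    show "AE \<omega> in P. \<bar>wexp_s q g (p + k + l) \<omega>\<bar> \<le> 1"
      by (rule AE_mp[OF AE_good], rule AE_I2, rule impI)
         (use wexp_state_01[OF good_\<theta>n s_density[OF \<theta>n_space] g] in fastforce)
    \<comment> \<open>Backward orbits: the preimage of a null set under the inverse power is null,
      because the forward power preserves \<open>P\<close> and undoes it.\<close>
    have "AE \<omega> in P. good ((\<theta>i ^^ M) \<omega>)"
    proof -
      obtain N where N: "{\<omega> \<in> space P. \<not> good \<omega>} \<subseteq> N" "emeasure P N = 0" "N \<in> sets P"
        by (rule AE_E[OF AE_good])
      let ?N = "(\<theta>i ^^ M) -` N \<inter> space P"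
      have N': "?N \<in> sets P" using \<theta>in_meas N(3) by (rule measurable_sets)
      have "emeasure P ?N = emeasure (distr P P (\<theta> ^^ M)) ?N" by (simp add: distr_\<theta>n)
      also have "\<dots> = emeasure P ((\<theta> ^^ M) -` ?N \<inter> space P)" by (rule emeasure_distr[OF \<theta>n_meas N'])
      also have "(\<theta> ^^ M) -` ?N \<inter> space P = N"
        using \<theta>in_\<theta>n \<theta>n_space sets.sets_into_space[OF N(3)] by auto
      finally have "emeasure P ?N = 0" using N(2) by simp
      then show ?thesis using N' N(1) \<theta>in_space by (intro AE_I[of P _ ?N]) auto
    qed
    then have u01: "AE \<omega> in P. 0 \<le> ?u' \<omega> \<and> ?u' \<omega> \<le> 1"
      by (rule AE_mp, intro AE_I2 impI) (rule wexp_state_01[OF _ \<rho>0_density f])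
    have v01: "AE \<omega> in P. 0 \<le> ?v' \<omega> \<and> ?v' \<omega> \<le> 1"
      by (rule AE_mp[OF AE_good], rule AE_I2, rule impI) (rule wexp_state_01[OF good_\<theta>n \<rho>0_density g])
    show "AE \<omega> in P. \<bar>?u' \<omega>\<bar> \<le> 1" by (rule AE_mp[OF u01]) auto
    show "AE \<omega> in P. \<bar>?v' \<omega>\<bar> \<le> 1" by (rule AE_mp[OF v01]) auto
    show "(\<integral>\<omega>. \<bar>wexp p f \<omega> (s \<omega>) - ?u' \<omega>\<bar> \<partial>P) \<le> 3 * D\<^sup>2 * r M" by (rule past_approx[OF abs1(1) M])
    show "(\<integral>\<omega>. \<bar>wexp_s q g (p + k + l) \<omega> - ?v' \<omega>\<bar> \<partial>P) \<le> 3 * D\<^sup>2 * r l"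
      by (rule future_approx[OF abs1(2) l])
    show "\<bar>(\<integral>\<omega>. ?u' \<omega> * ?v' \<omega> \<partial>P) - (\<integral>\<omega>. ?u' \<omega> \<partial>P) * (\<integral>\<omega>. ?v' \<omega> \<partial>P)\<bar> \<le> alpha_mix P T \<theta> \<theta>i (Suc k)"
    proof (rule covariance_le_of_level_sets[OF u'm v'm u01 v01])
      fix x y
      show "\<bar>prob ({\<omega> \<in> space P. x \<le> ?u' \<omega>} \<inter> {\<omega> \<in> space P. y \<le> ?v' \<omega>})
         - prob {\<omega> \<in> space P. x \<le> ?u' \<omega>} * prob {\<omega> \<in> space P. y \<le> ?v' \<omega>}\<bar> \<le> alpha_mix P T \<theta> \<theta>i (Suc k)"
      proof (rule alpha_mix_bound[of _ p])
        show "{\<omega> \<in> space P. x \<le> ?u' \<omega>} \<in> gen_sigma P T \<theta> \<theta>i {j. j \<le> int p}"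
        proof (rule wexp_level_set[OF \<theta>in_meas])
          fix i :: nat assume "1 \<le> i" "i \<le> M + p"
          then show "\<exists>j\<in>{j. j \<le> int p}. \<forall>\<omega>\<in>space P. (\<theta> ^^ i) ((\<theta>i ^^ M) \<omega>) = zpow \<theta> \<theta>i j \<omega>"
            by (intro bexI[of _ "int i - int M"]) (auto simp: zpow_shift)
        qed
        show "{\<omega> \<in> space P. y \<le> ?v' \<omega>} \<in> gen_sigma P T \<theta> \<theta>i {j. int p + int (Suc k) \<le> j}"
        proof (rule wexp_level_set[OF \<theta>n_meas])
          fix i :: nat assume i: "1 \<le> i" "i \<le> l + q"
          have "(\<theta> ^^ i) ((\<theta> ^^ (p + k)) \<omega>) = zpow \<theta> \<theta>i (int (i + (p + k))) \<omega>" for \<omega>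
            by (simp only: zpow_def nat_int of_nat_0_le_iff if_True funpow_add comp_apply)
          then show "\<exists>j\<in>{j. int p + int (Suc k) \<le> j}. \<forall>\<omega>\<in>space P. (\<theta> ^^ i) ((\<theta> ^^ (p + k)) \<omega>) = zpow \<theta> \<theta>i j \<omega>"
            using i by (intro bexI[of _ "int (i + (p + k))"]) auto
        qed
      qed
    qed
  qed
  have "(\<lambda>M. alpha_mix P T \<theta> \<theta>i (Suc k) + 2 * (3 * D\<^sup>2 * r M) + 2 * (3 * D\<^sup>2 * r l))
     \<longlonglongrightarrow> alpha_mix P T \<theta> \<theta>i (Suc k) + 2 * (3 * D\<^sup>2 * 0) + 2 * (3 * D\<^sup>2 * r l)"
    by (intro tendsto_add tendsto_mult tendsto_const r0)
  then have "?c \<le> alpha_mix P T \<theta> \<theta>i (Suc k) + 2 * (3 * D\<^sup>2 * 0) + 2 * (3 * D\<^sup>2 * r l)"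
    by (rule LIMSEQ_le_const) (use M in blast)
  then show ?thesis by simp
qed

section \<open>Stationarity and decorrelation of the outcomes\<close>

abbreviation Q where "Q \<equiv> annealed P T \<theta> s"

lemma Q_prob: "prob_space Q"
  using annealed_cylinder[OF s_state] by blast

lemma Q_sets: "sets Q = sets (P \<Otimes>\<^sub>M seq_space)"
  using annealed_cylinder[OF s_state] by blast

lemma Q_expectation: "(\<integral>z. g (prefix_word n (snd z)) \<partial>Q) = (\<integral>\<omega>. wexp n g \<omega> (s \<omega>) \<partial>P)"
  by (rule annealed_expectation[OF s_state])

text \<open>Dropping \<open>k\<close> letters carries s to s at the shifted environment, and the
  shift preserves \<open>P\<close>.\<close>

lemma Q_stationary:
  fixes g :: "'a list \<Rightarrow> real"
  shows
  "(\<integral>z. g (drop k (prefix_word (k + q) (snd z))) \<partial>Q) = (\<integral>z. g (prefix_word q (snd z)) \<partial>Q)"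
proof -
  have "(\<integral>z. g (drop k (prefix_word (k + q) (snd z))) \<partial>Q) = (\<integral>\<omega>. wexp (k + q) (\<lambda>v. g (drop k v)) \<omega> (s \<omega>) \<partial>P)"
    by (rule Q_expectation)
  also have "\<dots> = (\<integral>\<omega>. wexp_s q g k \<omega> \<partial>P)"
  proof (rule integral_cong_AE)
    show "AE \<omega> in P. wexp (k + q) (\<lambda>v. g (drop k v)) \<omega> (s \<omega>) = wexp_s q g k \<omega>"
    proof (rule AE_mp[OF AE_stationary], rule AE_I2, rule impI)
      fix \<omega> assume \<omega>: "\<omega> \<in> space P" and st: "stationary_at \<omega>"
      from st[rule_format, of k 0] show "wexp (k + q) (\<lambda>v. g (drop k v)) \<omega> (s \<omega>) = wexp_s q g k \<omega>"
        by (simp add: wexp_delay[OF \<omega>])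
    qed
  qed (intro wexp_measurable[OF s_meas measurable_ident_sets[OF refl]] wexp_measurable[OF random_state_at_\<theta>n[OF s_state] \<theta>n_meas])+
  also have "\<dots> = (\<integral>\<omega>. wexp q g \<omega> (s \<omega>) \<partial>P)"
    by (rule integral_\<theta>n[OF wexp_measurable[OF s_meas measurable_ident_sets[OF refl]]])
  also have "\<dots> = (\<integral>z. g (prefix_word q (snd z)) \<partial>Q)" by (rule Q_expectation[symmetric])
  finally show ?thesis .
qed

text \<open>The outcomes are decorrelated across the whole gap k + l; the resulting covariance of
  environment functions then uses \<open>k\<close> for mixing and \<open>l\<close> for
  forgetting.\<close>

lemma Q_decorrelation_01:
  assumes f: "\<And>w. 0 \<le> f w" "\<And>w. f w \<le> 1" and g: "\<And>w. 0 \<le> g w" "\<And>w. g w \<le> 1"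
    and l: "1 \<le> l" and r0: "r \<longlonglongrightarrow> 0"
  shows "\<bar>(\<integral>z. f (take p (prefix_word (p + (k + l + q)) (snd z))) * g (drop (k + l) (drop p (prefix_word (p + (k + l + q)) (snd z)))) \<partial>Q)
     - (\<integral>z. f (prefix_word p (snd z)) \<partial>Q) * (\<integral>z. g (prefix_word q (snd z)) \<partial>Q)\<bar>
     \<le> 3 * D\<^sup>2 * r (k + l) + 6 * D\<^sup>2 * r l + alpha_mix P T \<theta> \<theta>i (Suc k)"
proof -
  have g1: "\<bar>g w\<bar> \<le> 1" for w using g[of w] by simp
  have V: "(\<integral>\<omega>. wexp_s q g (p + k + l) \<omega> \<partial>P) = (\<integral>z. g (prefix_word q (snd z)) \<partial>Q)"
    unfolding Q_expectation by (rule integral_\<theta>n[OF wexp_measurable[OF s_meas measurable_ident_sets[OF refl]]])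
  have "1 \<le> k + l" using l by simp
  from decorrelate_state[where f = f and g = g, OF f g1 this, where p = p and q = q]
    decorrelate_environment[where f = f and g = g, OF f g l r0, where p = p and q = q and k = k, unfolded V]
  show ?thesis
    unfolding Q_expectation[of "\<lambda>w. f (take p w) * g (drop (k + l) (drop p w))"] Q_expectation[of f]
    by (simp only: add.assoc)
qed

end

lemma summable_div_2:
  fixes f :: "nat \<Rightarrow> real"
  assumes "summable f" "\<And>n. 0 \<le> f n" shows "summable (\<lambda>n. f (n div 2))"
proof (rule summableI_nonneg_bounded)
  fix n
  have "(\<Sum>i<2 * n. f (i div 2)) = 2 * (\<Sum>i<n. f i)"
    by (induction n) (simp_all add: algebra_simps)
  then have "(\<Sum>i<n. f (i div 2)) \<le> 2 * (\<Sum>i<n. f i)"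
    using sum_mono2[of "{..<2 * n}" "{..<n}" "\<lambda>i. f (i div 2)"] assms(2) by simp
  also have "\<dots> \<le> 2 * suminf f" using assms by (simp add: sum_le_suminf)
  finally show "(\<Sum>i<n. f (i div 2)) \<le> 2 * suminf f" .
qed (rule assms(2))

text \<open>The terms are eventually at most one, where a power with exponent at most one is the
  larger number.\<close>

lemma summable_of_summable_powr:
  fixes f :: "nat \<Rightarrow> real"
  assumes f: "\<And>n. 0 \<le> f n" and \<kappa>: "0 < \<kappa>" "\<kappa> \<le> 1" and s: "summable (\<lambda>n. f n powr \<kappa>)"
  shows "summable f"
proof -
  obtain N where N: "\<And>n. n \<ge> N \<Longrightarrow> f n powr \<kappa> < 1"
    using LIMSEQ_D[OF summable_LIMSEQ_zero[OF s], of 1] by auto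
  show ?thesis
  proof (rule summable_comparison_test'[OF s])
    fix n assume n: "n \<ge> N"
    have le1: "f n \<le> 1" using N[OF n] ge_one_powr_ge_zero[of "f n" \<kappa>] \<kappa> by (cases "f n \<le> 1") auto
    show "norm (f n) \<le> f n powr \<kappa>"
    proof (cases "f n = 0")
      case False
      then have "f n powr 1 \<le> f n powr \<kappa>" using le1 f[of n] \<kappa> by (intro powr_mono') auto
      then show ?thesis using f[of n] False by simp
    qed simp
  qed
qed

lemma take_prefix_word: "n \<le> k \<Longrightarrow> take n (prefix_word k y) = prefix_word n y"
  by (simp add: prefix_word_def take_map take_upt)

lemma drop_prefix_word: "drop k (prefix_word (k + m) y) = prefix_word m (\<lambda>i. y (k + i))"
  by (rule nth_equalityI) (simp_all add: prefix_word_def)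

lemma dN_prefix_word: "dN b (Suc k) z = (if drop k (prefix_word (k + length b) (snd z)) = b then 1 else 0)"
  by (simp add: dN_def drop_prefix_word prefix_word_eq_word)

lemma drop_prefix_word_window:
  "drop (p + j) (prefix_word (p + j + m) y) = drop j (drop p (prefix_word (p + (j + m)) y))"
  "drop p (prefix_word (p + m) y) = take m (drop p (prefix_word (p + (j + m)) y))"
  by (simp_all add: add.commute add.left_commute take_drop take_prefix_word)

section \<open>Word counts as a weakly dependent sequence\<close>

context mixing_instrument_system
begin

lemma prefix_measurable_Q: "(\<lambda>z. prefix_word n (snd z)) \<in> measurable Q (count_space UNIV)"
proof -
  have "(\<lambda>z. prefix_word n (snd z)) \<in> measurable (P \<Otimes>\<^sub>M (seq_space :: (nat \<Rightarrow> 'a) measure)) (count_space UNIV)"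
    by measurable
  then show ?thesis using measurable_cong_sets[OF Q_sets refl] by blast
qed

lemma Q_integrable: "integrable Q (\<lambda>z. g (prefix_word n (snd z)) :: real)"
proof -
  interpret Q: prob_space Q by (rule Q_prob)
  have "(\<lambda>z. g (prefix_word n (snd z))) \<in> borel_measurable Q"
    by (rule measurable_compose[OF prefix_measurable_Q]) simp
  then show ?thesis
  proof (rule Q.integrable_const_bound[rotated])
    show "AE z in Q. norm (g (prefix_word n (snd z))) \<le> (\<Sum>w\<in>words n. \<bar>g w\<bar>)"
      by (auto intro!: AE_I2 member_le_sum)
  qed
qed

lemma alpha_mix_nonneg: "0 \<le> alpha_mix P T \<theta> \<theta>i n"
proof -
  have "{} \<in> gen_sigma P T \<theta> \<theta>i J" for J unfolding gen_sigma_def by (rule sigma_sets.Empty)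
  from alpha_mix_bound[of "{}" 0 "{}" n, OF this this] show ?thesis by simp
qed

text \<open>The gap is halved between forgetting and mixing. The 4 comes from mapping two functions
  from [-1,1] to [0,1] affinely: each contributes a factor 2 to the covariance.\<close>

definition mix_bound :: "nat \<Rightarrow> real" where
  "mix_bound n = 4 * (3 * D\<^sup>2 * r n + 6 * D\<^sup>2 * r (n div 2) + alpha_mix P T \<theta> \<theta>i (Suc (n - n div 2)))"

lemma Q_decorrelation:
  fixes f g :: "'a list \<Rightarrow> real"
  assumes f: "\<And>w. \<bar>f w\<bar> \<le> 1" and g: "\<And>w. \<bar>g w\<bar> \<le> 1" and n: "2 \<le> n" and r0: "r \<longlonglongrightarrow> 0"
  shows "\<bar>(\<integral>z. f (prefix_word p (snd z)) * g (drop (p + n) (prefix_word (p + n + q) (snd z))) \<partial>Q)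
     - (\<integral>z. f (prefix_word p (snd z)) \<partial>Q) * (\<integral>z. g (prefix_word q (snd z)) \<partial>Q)\<bar> \<le> mix_bound n"
proof -
  interpret Q: prob_space Q by (rule Q_prob)
  define l where "l = n div 2"
  define k where "k = n - n div 2"
  have kl: "k + l = n" "1 \<le> l" using n by (auto simp: k_def l_def)
  define f' where "f' w = (f w + 1) / 2" for w
  define g' where "g' w = (g w + 1) / 2" for w
  have f': "0 \<le> f' w" "f' w \<le> 1" and g': "0 \<le> g' w" "g' w \<le> 1" for w
    using f[of w] g[of w] by (auto simp: f'_def g'_def)
  have fg: "f w = 2 * f' w - 1" "g w = 2 * g' w - 1" for w by (simp_all add: f'_def g'_def add_divide_distrib)
  let ?F = "\<lambda>z::'s \<times> (nat \<Rightarrow> 'a). f' (prefix_word p (snd z))"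
  let ?G = "\<lambda>z::'s \<times> (nat \<Rightarrow> 'a). g' (drop (p + n) (prefix_word (p + n + q) (snd z)))"
  have win: "f' (take p (prefix_word (p + (n + q)) y)) = f' (prefix_word p y)"
    "g' (drop n (drop p (prefix_word (p + (n + q)) y))) = g' (drop (p + n) (prefix_word (p + n + q) y))" for y
    by (simp_all add: take_prefix_word add.commute add.left_commute)
  have cov: "\<bar>(\<integral>z. ?F z * ?G z \<partial>Q) - (\<integral>z. ?F z \<partial>Q) * (\<integral>z. g' (prefix_word q (snd z)) \<partial>Q)\<bar>
     \<le> 3 * D\<^sup>2 * r n + 6 * D\<^sup>2 * r l + alpha_mix P T \<theta> \<theta>i (Suc k)"
    using Q_decorrelation_01[where f = f' and g = g', OF f' g' kl(2) r0, where p = p and q = q and k = k]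
    unfolding kl(1) win .
  have iF: "integrable Q ?F" by (rule Q_integrable)
  have iG: "integrable Q ?G" by (rule Q_integrable[of "\<lambda>w. g' (drop (p + n) w)"])
  have iFG: "integrable Q (\<lambda>z. ?F z * ?G z)"
    using Q_integrable[of "\<lambda>w. f' (take p w) * g' (drop (p + n) w)" "p + n + q"] by (simp add: take_prefix_word)
  have st: "(\<integral>z. ?G z \<partial>Q) = (\<integral>z. g' (prefix_word q (snd z)) \<partial>Q)" by (rule Q_stationary)
  have "(\<integral>z. f (prefix_word p (snd z)) * g (drop (p + n) (prefix_word (p + n + q) (snd z))) \<partial>Q)
     = (\<integral>z. 4 * (?F z * ?G z) - 2 * ?F z - 2 * ?G z + 1 \<partial>Q)"
    by (intro Bochner_Integration.integral_cong) (auto simp: fg algebra_simps)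
  also have "\<dots> = 4 * (\<integral>z. ?F z * ?G z \<partial>Q) - 2 * (\<integral>z. ?F z \<partial>Q) - 2 * (\<integral>z. ?G z \<partial>Q) + 1"
    using iF iG iFG by (simp add: Q.prob_space)
  finally have efg: "(\<integral>z. f (prefix_word p (snd z)) * g (drop (p + n) (prefix_word (p + n + q) (snd z))) \<partial>Q)
     = 4 * (\<integral>z. ?F z * ?G z \<partial>Q) - 2 * (\<integral>z. ?F z \<partial>Q) - 2 * (\<integral>z. g' (prefix_word q (snd z)) \<partial>Q) + 1"
    unfolding st .
  have ef: "(\<integral>z. f (prefix_word p (snd z)) \<partial>Q) = 2 * (\<integral>z. ?F z \<partial>Q) - 1"
    unfolding fg using iF by (simp add: Q.prob_space)
  have eg: "(\<integral>z. g (prefix_word q (snd z)) \<partial>Q) = 2 * (\<integral>z. g' (prefix_word q (snd z)) \<partial>Q) - 1"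
    unfolding fg using Q_integrable[of g' q] by (simp add: Q.prob_space)
  have alg: "4 * E - 2 * u - 2 * v + 1 - (2 * u - 1) * (2 * v - 1) = 4 * (E - u * v)" for E u v :: real
    by (simp add: algebra_simps)
  show ?thesis
    unfolding efg ef eg alg mix_bound_def k_def[symmetric] abs_mult abs_numeral
    unfolding l_def[symmetric]
    by (rule mult_left_mono[OF cov]) simp
qed

text \<open>Only the letters are recorded, not the environment. The test functions of the limit
  theorem are built from outcomes, and a function measurable here is a function of a word, to which
  the decorrelation bounds apply.\<close>

definition past :: "nat \<Rightarrow> ('s \<times> (nat \<Rightarrow> 'a)) measure" where
  "past n = vimage_algebra (space Q) (\<lambda>z. prefix_word n (snd z)) (count_space UNIV)"

lemma past_subalgebra: "subalgebra Q (past n)"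
  unfolding subalgebra_def past_def
  using sets_image_in_sets[OF refl prefix_measurable_Q] by simp

lemma past_prefix_measurable: "k \<le> n \<Longrightarrow> (\<lambda>z. prefix_word k (snd z)) \<in> measurable (past n) (count_space UNIV)"
proof -
  assume k: "k \<le> n"
  have "(\<lambda>z. prefix_word n (snd z)) \<in> measurable (past n) (count_space UNIV)"
    unfolding past_def by (rule measurable_vimage_algebra1) auto
  from measurable_compose[OF this, of "take k" "count_space UNIV"] show ?thesis
    using k by (simp add: take_prefix_word)
qed

lemma past_mono: "k \<le> n \<Longrightarrow> sets (past k) \<subseteq> sets (past n)"
  unfolding past_def[of k]
  by (rule sets_image_in_sets[OF _ past_prefix_measurable]) (simp_all add: past_def)

text \<open>Each set {F = F z} is a preimage under the prefix map, so \<open>F\<close> is constant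
  on its fibres. For a word without a fibre the choice is arbitrary but still bounded, as
  \<open>F\<close> is bounded everywhere.\<close>

lemma past_factorization:
  fixes F :: "'s \<times> (nat \<Rightarrow> 'a) \<Rightarrow> real"
  assumes F: "F \<in> borel_measurable (past n)" and F1: "\<And>z. \<bar>F z\<bar> \<le> 1"
  obtains f where "\<And>z. z \<in> space Q \<Longrightarrow> F z = f (prefix_word n (snd z))" "\<And>w. \<bar>f w\<bar> \<le> 1"
proof -
  have eq: "F z = F z'" if z: "z \<in> space Q" "z' \<in> space Q" "prefix_word n (snd z) = prefix_word n (snd z')" for z z'
  proof -
    have "F -` {F z} \<inter> space (past n) \<in> sets (past n)" using F by (rule measurable_sets) simp
    then obtain A where A: "F -` {F z} \<inter> space Q = (\<lambda>z. prefix_word n (snd z)) -` A \<inter> space Q"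
      by (auto simp: past_def sets_vimage_algebra2)
    have "z \<in> F -` {F z} \<inter> space Q" using z by simp
    then have "z' \<in> F -` {F z} \<inter> space Q" unfolding A using z by auto
    then show ?thesis by simp
  qed
  define f where "f w = F (SOME z. z \<in> space Q \<and> prefix_word n (snd z) = w)" for w
  have "F z = f (prefix_word n (snd z))" if z: "z \<in> space Q" for z
  proof -
    have "\<exists>z'. z' \<in> space Q \<and> prefix_word n (snd z') = prefix_word n (snd z)" using z by blast
    note z' = someI_ex[OF this]
    show ?thesis unfolding f_def by (rule eq[OF z z'[THEN conjunct1] z'[THEN conjunct2, symmetric]])
  qed
  moreover have "\<bar>f w\<bar> \<le> 1" for w by (simp add: f_def F1)
  ultimately show ?thesis by (rule that)
qed

context
  fixes b :: "'a list"
begin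

definition \<mu> :: real where "\<mu> = (\<integral>z. dN b 1 z \<partial>Q)"

definition X :: "nat \<Rightarrow> 's \<times> (nat \<Rightarrow> 'a) \<Rightarrow> real" where "X k z = dN b (Suc k) z - \<mu>"

definition X_word :: "'a list \<Rightarrow> real" where "X_word v = (if v = b then 1 else 0) - \<mu>"

abbreviation m where "m \<equiv> length b"

lemma X_eq: "X k z = X_word (drop k (prefix_word (k + m) (snd z)))"
  by (simp add: X_def X_word_def dN_prefix_word)

lemma dN_1: "dN b 1 = (\<lambda>z. if prefix_word m (snd z) = b then 1 else 0)"
  by (rule ext) (simp only: One_nat_def dN_prefix_word add_0 drop_0)

lemma \<mu>_01: "0 \<le> \<mu>" "\<mu> \<le> 1"
proof -
  interpret Q: prob_space Q by (rule Q_prob)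
  have i: "integrable Q (dN b 1)"
    unfolding dN_1 by (rule Q_integrable)
  show "0 \<le> \<mu>" unfolding \<mu>_def by (rule Bochner_Integration.integral_nonneg) (simp add: dN_def)
  have "\<mu> \<le> (\<integral>z. 1 \<partial>Q)" unfolding \<mu>_def by (rule integral_mono[OF i]) (auto simp: dN_def)
  then show "\<mu> \<le> 1" by (simp add: Q.prob_space)
qed

lemma X_word_bound: "\<bar>X_word v\<bar> \<le> 1"
  using \<mu>_01 by (auto simp: X_word_def)

lemma X_word_mean: "(\<integral>z. X_word (prefix_word m (snd z)) \<partial>Q) = 0"
proof -
  interpret Q: prob_space Q by (rule Q_prob)
  have "(\<integral>z. X_word (prefix_word m (snd z)) \<partial>Q) = (\<integral>z. dN b 1 z - \<mu> \<partial>Q)"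
    unfolding dN_1 X_word_def ..
  also have "\<dots> = 0"
    unfolding dN_1 \<mu>_def using Q_integrable[of "\<lambda>v. if v = b then 1 else 0" m] by (simp add: Q.prob_space)
  finally show ?thesis .
qed

definition cov :: "nat \<Rightarrow> real" where "cov j = (\<integral>z. X 0 z * X j z \<partial>Q)"

text \<open>The window before index p ends after p + m - 1 letters, so a window begun at p + n is n
  + 1 - m letters away. Decorrelation needs a distance of at least 2; below that the trivial bound 2
  is taken.\<close>

definition gap :: "nat \<Rightarrow> real" where "gap n = (if n < m + 1 then 2 else mix_bound (n + 1 - m))"

lemma X_integrable_bound:
  fixes F :: "'s \<times> (nat \<Rightarrow> 'a) \<Rightarrow> real"
  assumes "F \<in> borel_measurable Q" "\<And>z. \<bar>F z\<bar> \<le> 1"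
  shows "integrable Q F" "\<bar>\<integral>z. F z \<partial>Q\<bar> \<le> 1"
proof -
  interpret Q: prob_space Q by (rule Q_prob)
  show "integrable Q F" "\<bar>\<integral>z. F z \<partial>Q\<bar> \<le> 1" using Q.AE_bounded_expectation[OF assms(1), of 1] assms(2) by auto
qed

definition XX_word :: "nat \<Rightarrow> 'a list \<Rightarrow> real" where
  "XX_word j v = X_word (take m v) * X_word (drop j v)"

lemma XX_eq: "X k z * X (k + j) z = XX_word j (drop k (prefix_word (k + (j + m)) (snd z)))"
  unfolding X_eq XX_word_def drop_prefix_word_window(1) drop_prefix_word_window(2)[of k m "snd z" j] ..

context
  assumes b: "b \<noteq> []" and r0: "r \<longlonglongrightarrow> 0"
    and r_sum: "summable r" and r_nonneg: "\<And>n. 0 \<le> r n"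
    and \<alpha>_sum: "summable (\<lambda>n. alpha_mix P T \<theta> \<theta>i (Suc n))"
begin

lemma gap_bound_summable: "summable gap"
proof -
  have "n - n div 2 = Suc n div 2" for n :: nat by presburger
  moreover have "summable (\<lambda>n. alpha_mix P T \<theta> \<theta>i (Suc (Suc n div 2)))"
    using summable_div_2[OF \<alpha>_sum alpha_mix_nonneg] by (subst summable_Suc_iff[of "\<lambda>n. alpha_mix P T \<theta> \<theta>i (Suc (n div 2))"])
  ultimately have "summable mix_bound"
    unfolding mix_bound_def[abs_def]
    by (intro summable_mult summable_add r_sum summable_div_2 r_nonneg) simp_all
  then have "summable (\<lambda>n. mix_bound (n + 2))" by (subst summable_iff_shift)
  also have "(\<lambda>n. mix_bound (n + 2)) = (\<lambda>n. gap (n + (m + 1)))" by (simp add: gap_def fun_eq_iff)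
  finally show ?thesis by (subst (asm) summable_iff_shift)
qed

lemma window_decorrelation:
  assumes F: "F \<in> borel_measurable (past (p + m - 1))" "\<And>z. \<bar>F z\<bar> \<le> 1" and g: "\<And>w. \<bar>g w\<bar> \<le> 1"
  shows "\<bar>(\<integral>z. F z * g (drop (p + n) (prefix_word (p + n + q) (snd z))) \<partial>Q)
     - (\<integral>z. F z \<partial>Q) * (\<integral>z. g (prefix_word q (snd z)) \<partial>Q)\<bar> \<le> gap n"
proof (cases "n < m + 1")
  case True
  have Fm: "F \<in> borel_measurable Q" using measurable_from_subalg[OF past_subalgebra F(1)] .
  have gm: "(\<lambda>z. g (h (prefix_word k (snd z)))) \<in> borel_measurable Q" for h k
    by (rule measurable_compose[OF prefix_measurable_Q]) simp
  have "\<bar>\<integral>z. F z * g (drop (p + n) (prefix_word (p + n + q) (snd z))) \<partial>Q\<bar> \<le> 1"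
    using F(2) g by (intro X_integrable_bound(2) borel_measurable_times Fm gm) (simp add: abs_mult mult_le_one)
  moreover have "\<bar>(\<integral>z. F z \<partial>Q) * (\<integral>z. g (prefix_word q (snd z)) \<partial>Q)\<bar> \<le> 1"
    unfolding abs_mult
    by (intro mult_le_one X_integrable_bound(2) Fm gm[of "\<lambda>w. w"] F(2) g abs_ge_zero)
  ultimately show ?thesis using True by (simp add: gap_def)
next
  case False
  obtain f where f: "\<And>z. z \<in> space Q \<Longrightarrow> F z = f (prefix_word (p + m - 1) (snd z))" "\<And>w. \<bar>f w\<bar> \<le> 1"
    using past_factorization[OF F] by blast
  have m1: "1 \<le> m" using b by (cases b) auto
  have e: "p + m - 1 + (n + 1 - m) = p + n" "2 \<le> n + 1 - m" using False m1 by auto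
  have "(\<integral>z. F z * g (drop (p + n) (prefix_word (p + n + q) (snd z))) \<partial>Q)
     = (\<integral>z. f (prefix_word (p + m - 1) (snd z)) * g (drop (p + n) (prefix_word (p + n + q) (snd z))) \<partial>Q)"
    "(\<integral>z. F z \<partial>Q) = (\<integral>z. f (prefix_word (p + m - 1) (snd z)) \<partial>Q)"
    by (auto intro!: Bochner_Integration.integral_cong simp: f(1))
  then show ?thesis
    using Q_decorrelation[where f = f and g = g, OF f(2) g e(2) r0, of "p + m - 1" q] False
    unfolding e(1) by (simp add: gap_def)
qed

text \<open>A product of two counts is a function of one longer window starting at the same letter
  as the first count. The distance to the past is therefore the same, and \<open>gap\<close> serves
  single counts and products of every lag.\<close>

lemma counts_weakly_dependent: "weakly_dependent Q X (\<lambda>k. past (k + m - 1)) gap cov"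
proof -
  interpret Q: prob_space Q by (rule Q_prob)
  have m1: "1 \<le> m" using b by (cases b) auto
  have XX1: "\<bar>XX_word j v\<bar> \<le> 1" for j v
    unfolding XX_word_def abs_mult by (intro mult_le_one X_word_bound) auto
  have cov: "cov j = (\<integral>z. XX_word j (prefix_word (j + m) (snd z)) \<partial>Q)" for j
    unfolding cov_def using XX_eq[of 0 _ j] by simp
  show ?thesis
  proof (unfold_locales)
    show "subalgebra Q (past (k + m - 1))" for k by (rule past_subalgebra)
    show "sets (past (k + m - 1)) \<subseteq> sets (past (l + m - 1))" if "k \<le> l" for k l
      using that by (intro past_mono) simp
    show "X k \<in> borel_measurable (past (Suc k + m - 1))" for k
    proof -
      have "(\<lambda>z. X_word (drop k (prefix_word (k + m) (snd z)))) \<in> borel_measurable (past (Suc k + m - 1))"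
        by (rule measurable_compose[OF past_prefix_measurable]) auto
      then show ?thesis by (simp add: X_eq[abs_def])
    qed
    show "\<bar>X k z\<bar> \<le> 1" for k z by (simp add: X_eq X_word_bound)
    show "Q.expectation (X k) = 0" for k
      using Q_stationary[of X_word k m] X_word_mean by (simp add: X_eq[abs_def])
    show "Q.expectation (\<lambda>z. X k z * X (k + j) z) = cov j" for k j
      unfolding XX_eq cov by (rule Q_stationary)
    show "summable gap" by (rule gap_bound_summable)
    show "\<bar>Q.expectation (\<lambda>z. F z * X (p + n) z)\<bar> \<le> gap n"
      if "F \<in> borel_measurable (past (p + m - 1))" "\<And>z. \<bar>F z\<bar> \<le> 1" for F p n
      using window_decorrelation[where F = F and g = X_word, OF that X_word_bound, of n m]
      by (simp add: X_eq X_word_mean)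
    show "\<bar>Q.expectation (\<lambda>z. F z * (X (p + n) z * X (p + n + j) z)) - Q.expectation F * cov j\<bar> \<le> gap n"
      if "F \<in> borel_measurable (past (p + m - 1))" "\<And>z. \<bar>F z\<bar> \<le> 1" for F p n j
      using window_decorrelation[where F = F and g = "XX_word j", OF that XX1, of n "j + m"]
      unfolding XX_eq cov .
  qed
qed

end

end

end

section \<open>The central limit theorem for word counts\<close>

theorem theorem2:
  fixes P :: "'s measure"
    and T :: "'a::finite \<Rightarrow> 's \<Rightarrow> complex^'d::finite^'d \<Rightarrow> complex^'d^'d"
    and \<theta> \<theta>i :: "'s \<Rightarrow> 's"
    and s :: "'s \<Rightarrow> complex^'d^'d"
    and \<delta> :: real and r :: "nat \<Rightarrow> real"
    and b :: "'a list"
  assumes P: "prob_space P"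
    and instr: "random_instrument P T"
    \<comment> \<open>(H1)\<close>
    and \<theta>_meas: "\<theta> \<in> measurable P P" and \<theta>i_meas: "\<theta>i \<in> measurable P P"
    and inv1: "\<forall>\<omega>\<in>space P. \<theta>i (\<theta> \<omega>) = \<omega>" and inv2: "\<forall>\<omega>\<in>space P. \<theta> (\<theta>i \<omega>) = \<omega>"
    and erg: "ergodic_map P \<theta>" and pres: "measure_preserving_map P \<theta>"
    \<comment> \<open>(H2)\<close>
    and \<delta>_pos: "\<delta> > 0"
    and mix: "summable (\<lambda>n. alpha_mix P T \<theta> \<theta>i (Suc n) powr (\<delta> / (2 + \<delta>)))"
    \<comment> \<open>(H3)\<close>
    and s_state: "random_state P s" and s_stat: "dyn_stationary P T \<theta> s"
    and r_nonneg: "\<forall>n. 0 \<le> r n"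
    and r_sum: "summable (\<lambda>n. r (Suc n) powr (\<delta> / (2 + \<delta>)))"
    and conv: "\<forall>\<psi> n. random_state P \<psi> \<longrightarrow> 1 \<le> n \<longrightarrow>
        (\<integral>\<omega>. trnorm (Phin T \<theta> n \<omega> (\<psi> \<omega>) - s ((\<theta> ^^ n) \<omega>)) \<partial>P) \<le> r n"
    \<comment> \<open>the word \<bf>b\<close>
    and b: "b \<noteq> []"
  shows "let Q = annealed P T \<theta> s;
             \<mu> = (\<integral>z. dN b 1 z \<partial>Q);
             c = (\<lambda>k. \<integral>z. (dN b 1 z - \<mu>) * (dN b (1 + k) z - \<mu>) \<partial>Q);
             \<Sigma>2 = c 0 + 2 * (\<Sum>k. c (Suc k));
             S = (\<lambda>n z. (\<Sum>k=1..n. dN b k z - \<mu>) / sqrt (real n))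
         in summable (\<lambda>k. \<bar>c (Suc k)\<bar>) \<and> 0 \<le> \<Sigma>2 \<and>
            weak_conv_m (\<lambda>n. distr Q borel (S n)) (gauss_law \<Sigma>2) \<and>
            (\<Sigma>2 = 0 \<longrightarrow>
               ((\<lambda>n. \<integral>z. (S n z)\<^sup>2 \<partial>Q) \<longlonglongrightarrow> 0) \<and>
               (\<forall>\<epsilon>>0. (\<lambda>n. measure Q {z \<in> space Q. \<epsilon> < \<bar>S n z\<bar>}) \<longlonglongrightarrow> 0))"
proof -
  interpret mixing_instrument_system P T \<theta> \<theta>i s r
  proof -
    interpret prob_space P by (rule P)
    show "mixing_instrument_system P T \<theta> \<theta>i s r"
      using instr \<theta>_meas pres \<theta>i_meas inv1 inv2 s_state s_stat conv
      by unfold_locales (auto simp: measure_preserving_map_def)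
  qed
  \<comment> \<open>The exponent lies in (0, 1], so both power series hypotheses yield plain
    summability.\<close>
  define \<kappa> where "\<kappa> = \<delta> / (2 + \<delta>)"
  have \<kappa>: "0 < \<kappa>" "\<kappa> \<le> 1" using \<delta>_pos by (auto simp: \<kappa>_def)
  have r_sum': "summable r"
    using summable_of_summable_powr[OF _ \<kappa>, of "\<lambda>n. r (Suc n)"] r_sum r_nonneg by (simp add: \<kappa>_def summable_Suc_iff)
  then have r0: "r \<longlonglongrightarrow> 0" by (rule summable_LIMSEQ_zero)
  have \<alpha>_sum: "summable (\<lambda>n. alpha_mix P T \<theta> \<theta>i (Suc n))"
    by (rule summable_of_summable_powr[OF alpha_mix_nonneg \<kappa> mix[folded \<kappa>_def]])
  have r_nonneg': "0 \<le> r n" for n using r_nonneg by blast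
  interpret W: weakly_dependent Q "X b" "\<lambda>k. past (k + length b - 1)" "gap b" "cov b"
    by (rule counts_weakly_dependent[OF b r0 r_sum' r_nonneg' \<alpha>_sum])
  have c: "(\<integral>z. (dN b 1 z - \<mu> b) * (dN b (1 + k) z - \<mu> b) \<partial>Q) = cov b k" for k
    by (simp add: cov_def X_def)
  \<comment> \<open>Counts are indexed from one, the abstract sequence from zero:
    \<open>X b k\<close> is the centred count at k + 1.\<close>
  have S: "(\<Sum>k=1..n. dN b k z - \<mu> b) / sqrt (real n) = W.S n z / sqrt (real n)" for n z
    by (simp add: W.S_def X_def sum.atLeast1_atMost_eq)
  have \<mu>: "(\<integral>z. dN b 1 z \<partial>Q) = \<mu> b"
    by (simp add: \<mu>_def)
  have \<sigma>2: "cov b 0 + 2 * (\<Sum>k. cov b (Suc k)) = W.\<sigma>2"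
    by (simp add: W.\<sigma>2_def)
  have conclusion: "summable (\<lambda>k. \<bar>cov b (Suc k)\<bar>) \<and> 0 \<le> W.\<sigma>2 \<and>
      weak_conv_m (\<lambda>n. distr Q borel (\<lambda>z. W.S n z / sqrt (real n))) (gauss_law W.\<sigma>2) \<and>
      (W.\<sigma>2 = 0 \<longrightarrow> ((\<lambda>n. \<integral>z. (W.S n z / sqrt (real n))\<^sup>2 \<partial>Q) \<longlonglongrightarrow> 0) \<and>
        (\<forall>\<epsilon>>0. (\<lambda>n. measure Q {z \<in> space Q. \<epsilon> < \<bar>W.S n z / sqrt (real n)\<bar>}) \<longlonglongrightarrow> 0))"
  proof (intro conjI impI allI)
    show "(\<lambda>n. \<integral>z. (W.S n z / sqrt (real n))\<^sup>2 \<partial>Q) \<longlonglongrightarrow> 0" if "W.\<sigma>2 = 0"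
      using W.S_square_limit that by simp
  qed (fact W.c_summable W.\<sigma>2_nonneg W.central_limit | rule W.degenerate_limit; assumption)+
  show ?thesis
    unfolding Let_def \<mu> c S \<sigma>2 by (rule conclusion)
qed

end
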